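(* Let $A=R/I$, $R=K[[x,y,z]]$, be a local ring of type $(2,2)$ and multiplicity $e$. The following conditions are equivalent: (i) $HF_A=H(e)$, where $H(e)(t)=1$ for $t=0$, $H(e)(t)=t+2$ for $t=1,\dots,e-3$, $H(e)(t)=e$ for $t\ge e-2$; and $I^*$ does not contain the square of a linear form. (ii) Up to analytic isomorphism (i.e. after replacing $I$ by $\phi(I)$ for some $K$-algebra automorphism $\phi$ of $R$), $I$ is generated in $R$ by $$f=x^2+xz+F,\qquad g=xy+d\,yz+\alpha y^r+\beta z^s,$$ where - $r\ge 3$; - $F\in K[[y,z]]$ and $\operatorname{order}(F)\ge 3$; - $d$ is a unit of $K[[y,z]]$ with $d(0,0)=1$; - $\alpha=0$ or $\alpha$ is a unit of $K[[y]]$; $\beta=0$ or $\beta$ is a unit of $K[[z]]$; and $s\ge e-1\ge 3$; - $\operatorname{order}\big(F+d(d-1)z^2+\alpha(2d-1)z y^{r-1}+\alpha^2y^{2(r-1)}\big)=e-2$.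
   Context: $K$ is an algebraically closed field of characteristic zero, $R=K[[x,y,z]]$ with maximal ideal $\mathcal M=(x,y,z)$, $P=K[x,y,z]$. For nonzero $f\in R$, $\operatorname{order}(f)$ is the least degree $v$ of a monomial appearing in $f$, with $\operatorname{order}(0)=\infty$, and $f^*\in P$ is the homogeneous component of degree $v$ of $f$ (its initial form). $I^*\subset P$ is the homogeneous ideal generated by the initial forms of the nonzero elements of $I$. $A=R/I$ is of type $(2,2)$ if $I$ is generated by a regular sequence $\{f,g\}$ with $\operatorname{order}(f)=\operatorname{order}(g)=2$ and $g^*\notin(f^* )$. With $\mathfrak m=\mathcal M/I$, $HF_A(t)=\dim_K(\mathfrak m^t/\mathfrak m^{t+1})$. Such $A$ is one-dimensional Cohen-Macaulay; its multiplicity $e$ is the value of $HF_A(t)$ for all large $t$.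
   Formalization: The formal theorem assumes e ≥ 5; for e = 4 the stated equivalence fails, since (ii) forces e − 2 ≥ 3 while I = (x²−y², x²−z²) satisfies (i) with e = 4. "Square of a linear form" means of a nonzero linear form. *)

theory Defs
  imports
    "HOL-Library.Extended_Nat"
    "HOL-Computational_Algebra.Computational_Algebra"
begin

subsection \<open>The rings \<open>R = K[[x,y,z]]\<close> and \<open>P = K[x,y,z]\<close>\<close>

text \<open>
  Both rings are iterated univariate rings, the outermost variable being \<open>x\<close> and the
  innermost one \<open>z\<close>: \<open>K[[z]][[y]][[x]]\<close> and \<open>K[z][y][x]\<close>.
\<close>

type_synonym 'a ps3 = "'a fps fps fps"
type_synonym 'a poly3 = "'a poly poly poly"

definition ps_coeff :: "'a::zero ps3 \<Rightarrow> nat \<Rightarrow> nat \<Rightarrow> nat \<Rightarrow> 'a" where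
  "ps_coeff f i j k = fps_nth (fps_nth (fps_nth f i) j) k"

definition ps_const :: "'a::zero \<Rightarrow> 'a ps3" where
  "ps_const c = fps_const (fps_const (fps_const c))"

definition xv :: "'a::comm_ring_1 ps3" where
  "xv = fps_X"

definition yv :: "'a::comm_ring_1 ps3" where
  "yv = fps_const fps_X"

definition zv :: "'a::comm_ring_1 ps3" where
  "zv = fps_const (fps_const fps_X)"

definition poly_monom :: "'a::zero \<Rightarrow> nat \<Rightarrow> nat \<Rightarrow> nat \<Rightarrow> 'a poly3" where
  "poly_monom c i j k = monom (monom (monom c k) j) i"

text \<open>The subrings \<open>K[[y,z]]\<close>, \<open>K[[y]]\<close> and \<open>K[[z]]\<close> of \<open>R\<close>.\<close>

definition K_yz :: "'a::zero ps3 set" where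
  "K_yz = {h. \<forall>i j k. ps_coeff h i j k \<noteq> 0 \<longrightarrow> i = 0}"

definition K_y :: "'a::zero ps3 set" where
  "K_y = {h. \<forall>i j k. ps_coeff h i j k \<noteq> 0 \<longrightarrow> i = 0 \<and> k = 0}"

definition K_z :: "'a::zero ps3 set" where
  "K_z = {h. \<forall>i j k. ps_coeff h i j k \<noteq> 0 \<longrightarrow> i = 0 \<and> j = 0}"

definition is_unit_of :: "'r::comm_ring_1 set \<Rightarrow> 'r \<Rightarrow> bool" where
  "is_unit_of S u \<longleftrightarrow> u \<in> S \<and> (\<exists>v\<in>S. u * v = 1)"

definition K_algebra_automorphism :: "('a::comm_ring_1 ps3 \<Rightarrow> 'a ps3) \<Rightarrow> bool" where
  "K_algebra_automorphism \<phi> \<longleftrightarrow> bij \<phi>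
     \<and> (\<forall>f g. \<phi> (f + g) = \<phi> f + \<phi> g)
     \<and> (\<forall>f g. \<phi> (f * g) = \<phi> f * \<phi> g)
     \<and> (\<forall>c. \<phi> (ps_const c) = ps_const c)"

subsection \<open>Ideals\<close>

text \<open>A commutative ring is a module over itself, and its ideals are the submodules.\<close>

lemma module_ring_mult: "module ((*) :: 'r::comm_ring_1 \<Rightarrow> 'r \<Rightarrow> 'r)"
  by unfold_locales (simp_all add: algebra_simps)

definition ideal_gen :: "'r::comm_ring_1 set \<Rightarrow> 'r set" where
  "ideal_gen S = module.span (*) S"

primrec ideal_power :: "'r::comm_ring_1 set \<Rightarrow> nat \<Rightarrow> 'r set" where
  "ideal_power J 0 = UNIV"
| "ideal_power J (Suc n) = ideal_gen {a * b |a b. a \<in> J \<and> b \<in> ideal_power J n}"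

definition ideal_sum :: "'r::comm_ring_1 set \<Rightarrow> 'r set \<Rightarrow> 'r set" where
  "ideal_sum J L = {a + b |a b. a \<in> J \<and> b \<in> L}"

definition max_ideal :: "'a::comm_ring_1 ps3 set" where
  "max_ideal = ideal_gen {xv, yv, zv}"

subsection \<open>Order and initial forms\<close>

text \<open>The infimum of the empty set is \<open>\<infinity>\<close>, hence \<open>ps_order 0 = \<infinity>\<close>.\<close>

definition ps_order :: "'a::zero ps3 \<Rightarrow> enat" where
  "ps_order f = Inf {enat (i + j + k) |i j k. ps_coeff f i j k \<noteq> 0}"

definition hom_component :: "nat \<Rightarrow> 'a::comm_ring_1 ps3 \<Rightarrow> 'a poly3" where
  "hom_component v f =
     (\<Sum>(i, j, k) \<in> {(i, j, k). i + j + k = v}. poly_monom (ps_coeff f i j k) i j k)"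

text \<open>Only meaningful for \<open>f \<noteq> 0\<close>.\<close>

definition initial_form :: "'a::comm_ring_1 ps3 \<Rightarrow> 'a poly3" where
  "initial_form f = hom_component (the_enat (ps_order f)) f"

definition initial_ideal :: "'a::comm_ring_1 ps3 set \<Rightarrow> 'a poly3 set" where
  "initial_ideal I = ideal_gen {initial_form f |f. f \<in> I \<and> f \<noteq> 0}"

definition linear_form :: "'a::comm_ring_1 \<Rightarrow> 'a \<Rightarrow> 'a \<Rightarrow> 'a poly3" where
  "linear_form a b c = poly_monom a 1 0 0 + poly_monom b 0 1 0 + poly_monom c 0 0 1"

text \<open>The zero form has to be excluded, because \<open>0\<close> is the square of \<open>0\<close> and lies in every ideal.\<close>

definition contains_square_of_linear_form :: "'a::comm_ring_1 poly3 set \<Rightarrow> bool" where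
  "contains_square_of_linear_form J \<longleftrightarrow>
     (\<exists>a b c. (a, b, c) \<noteq> (0, 0, 0) \<and> (linear_form a b c)\<^sup>2 \<in> J)"

subsection \<open>Hilbert function and multiplicity\<close>

text \<open>
  The classes of \<open>b 0, \<dots>, b (n - 1)\<close> form a \<open>K\<close>-basis of \<open>U / W\<close>, where \<open>W \<subseteq> U\<close> are
  \<open>K\<close>-subspaces of \<open>R\<close>: every class has unique coordinates \<open>c 0, \<dots>, c (n - 1)\<close>.
\<close>

definition is_quotient_basis ::
    "'a::comm_ring_1 ps3 set \<Rightarrow> 'a ps3 set \<Rightarrow> nat \<Rightarrow> (nat \<Rightarrow> 'a ps3) \<Rightarrow> bool" where
  "is_quotient_basis U W n b \<longleftrightarrow> (\<forall>i<n. b i \<in> U) \<and>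
     (\<forall>u\<in>U. \<exists>!c. (\<forall>i\<ge>n. c i = 0) \<and> u - (\<Sum>i<n. ps_const (c i) * b i) \<in> W)"

definition quotient_dim :: "'a::comm_ring_1 ps3 set \<Rightarrow> 'a ps3 set \<Rightarrow> nat" where
  "quotient_dim U W = (THE n. \<exists>b. is_quotient_basis U W n b)"

text \<open>
  For \<open>A = R/I\<close> with maximal ideal \<open>\<mm> = \<M>/I\<close>, the ideal \<open>\<mm>\<^sup>t\<close> of \<open>A\<close> is \<open>(\<M>\<^sup>t + I)/I\<close>,
  so \<open>\<mm>\<^sup>t/\<mm>\<^sup>t\<^sup>+\<^sup>1 = (\<M>\<^sup>t + I)/(\<M>\<^sup>t\<^sup>+\<^sup>1 + I)\<close>.
\<close>

definition hilbert_fun :: "'a::comm_ring_1 ps3 set \<Rightarrow> nat \<Rightarrow> nat" where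
  "hilbert_fun I t = quotient_dim
     (ideal_sum (ideal_power max_ideal t) I) (ideal_sum (ideal_power max_ideal (Suc t)) I)"

definition has_multiplicity :: "'a::comm_ring_1 ps3 set \<Rightarrow> nat \<Rightarrow> bool" where
  "has_multiplicity I e \<longleftrightarrow> (\<exists>N. \<forall>t\<ge>N. hilbert_fun I t = e)"

text \<open>\<open>t + 3 \<le> e\<close> is \<open>t \<le> e - 3\<close> without truncated subtraction.\<close>

definition H :: "nat \<Rightarrow> nat \<Rightarrow> nat" where
  "H e t = (if t = 0 then 1 else if t + 3 \<le> e then t + 2 else e)"

subsection \<open>Local rings of type \<open>(2,2)\<close>\<close>

definition regular_sequence2 :: "'r::comm_ring_1 \<Rightarrow> 'r \<Rightarrow> bool" where
  "regular_sequence2 f g \<longleftrightarrow>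
     (\<forall>h. f * h = 0 \<longrightarrow> h = 0) \<and>
     (\<forall>h. g * h \<in> ideal_gen {f} \<longrightarrow> h \<in> ideal_gen {f}) \<and>
     ideal_gen {f, g} \<noteq> UNIV"

definition type22 :: "'a::comm_ring_1 ps3 set \<Rightarrow> bool" where
  "type22 I \<longleftrightarrow> (\<exists>f g. I = ideal_gen {f, g} \<and> regular_sequence2 f g \<and>
     ps_order f = 2 \<and> ps_order g = 2 \<and> initial_form g \<notin> ideal_gen {initial_form f})"

subsection \<open>The normal form\<close>

text \<open>
  A ring of type \<open>(2,2)\<close> has multiplicity at least \<open>4\<close>. The normal form forces \<open>e \<ge> 5\<close>: its last
  condition takes the order of a series all of whose summands have order at least \<open>3\<close>
  (\<open>d - 1\<close> is not a unit and \<open>r \<ge> 3\<close>). In multiplicity \<open>4\<close>, on the other hand,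
  \<open>I = (x\<^sup>2 - y\<^sup>2, x\<^sup>2 - z\<^sup>2)\<close> has Hilbert function \<open>1, 3, 4, 4, \<dots>\<close>, that is \<open>H 4\<close>, and its
  initial ideal contains no square of a nonzero linear form. So the equivalence of the
  intrinsic conditions with the normal form is about \<open>e \<ge> 5\<close>.
\<close>

definition normal_form_generators :: "nat \<Rightarrow> 'a::comm_ring_1 ps3 \<Rightarrow> 'a ps3 \<Rightarrow> bool" where
  "normal_form_generators e f g \<longleftrightarrow> (\<exists>r s F d \<alpha> \<beta>.
     f = xv\<^sup>2 + xv * zv + F \<and>
     g = xv * yv + d * yv * zv + \<alpha> * yv ^ r + \<beta> * zv ^ s \<and>
     3 \<le> r \<and>
     F \<in> K_yz \<and> 3 \<le> ps_order F \<and>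
     is_unit_of K_yz d \<and> ps_coeff d 0 0 0 = 1 \<and>
     (\<alpha> = 0 \<or> is_unit_of K_y \<alpha>) \<and>
     (\<beta> = 0 \<or> is_unit_of K_z \<beta>) \<and>
     e - 1 \<le> s \<and> 3 \<le> e - 1 \<and>
     ps_order (F + d * (d - 1) * zv\<^sup>2 + \<alpha> * (2 * d - 1) * zv * yv ^ (r - 1)
                 + \<alpha>\<^sup>2 * yv ^ (2 * (r - 1))) = enat (e - 2))"

end

theory Submission
  imports Defs
begin

text \<open>
  Write \<open>l = x + z\<close>. If the Hilbert function takes the value \<open>5\<close> in degree \<open>3\<close>, the two initial
  quadrics satisfy a linear relation, hence have a common linear factor; without squares of linear
  forms in \<open>I\<^sup>*\<close> they become \<open>x l\<close> and \<open>y l\<close> after a linear change of coordinates. Weierstrass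
  division by \<open>f\<close> and the substitution of new coordinates for \<open>y\<close> and \<open>z\<close> then give the normal form,
  except for the conditions on \<open>s\<close> and on the order of
  \<open>\<Delta> = F + d(d-1)z\<^sup>2 + \<alpha>(2d-1)zw + \<alpha>\<^sup>2w\<^sup>2\<close>, where \<open>w\<close> is the power of \<open>y\<close> with exponent \<open>r - 1\<close>.

  With \<open>\<epsilon> = (1-d)z - \<alpha>w\<close>, \<open>L = l - \<epsilon>\<close>, \<open>X = x + \<epsilon>\<close> and \<open>b = \<beta>z\<^sup>s\<close> one has \<open>f = LX + \<Delta>\<close> and
  \<open>g = Ly + b\<close>. The series \<open>h = yf - Xg = y\<Delta> - bX\<close> satisfies \<open>Lh = \<Delta>g - bf\<close>, and these two relations
  make \<open>f, g, h\<close> a standard basis. So, with \<open>m\<close> the minimum of the orders of \<open>\<Delta>\<close> and \<open>b\<close>, the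
  Hilbert function is \<open>t + 2\<close> for \<open>1 \<le> t \<le> m\<close> and \<open>m + 2\<close> from then on; in particular \<open>e = m + 2\<close>.
  If \<open>s = e - 2\<close>, choose a zero of the initial form of \<open>h\<close> on the line \<open>l = 0\<close> of the projective
  plane and replace \<open>y\<close> by a combination of \<open>x\<close> and \<open>y\<close> that vanishes there. Repeating the normalisation now gives \<open>s \<ge> e - 1\<close>.
\<close>

subsection \<open>Power series in three variables\<close>

text \<open>The obstacle is that the second normalisation might undo the choice of the new
  \<open>y\<close>. Two facts prevent this. The initial forms of \<open>f\<close> and
  \<open>g\<close> are divisible by \<open>l\<close>, so on the line \<open>l = 0\<close> the degree
  \<open>e - 1\<close> component of any element of the ideal of order at least \<open>e - 1\<close>
  is proportional to that of \<open>h\<close>: the chosen zero belongs to the ideal, not to its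
  generators. And the normalising automorphism keeps leading components (\<open>near_id\<close>), so
  the zero stays where the shear puts it, at \<open>(1 : 0 : -1)\<close>. There \<open>y\<close>
  vanishes, and for \<open>s = e - 2\<close> the degree \<open>e - 1\<close> component of
  \<open>h\<close> takes, up to sign, the constant term of the unit \<open>\<beta>\<close> as its
  value. So a second failure is contradictory, and one repetition is enough.

  The value \<open>t + 2\<close> counts the coordinates of a form of degree \<open>t\<close> modulo
  \<open>x l\<close> and \<open>y l\<close>: \<open>t + 1\<close> coefficients on the line
  \<open>l = 0\<close> and one value at \<open>(0 : 0 : 1)\<close>. As \<open>h\<close> has order
  \<open>m + 1\<close> and a nonzero leading component on that line, its multiples take away all
  further growth.\<close>

definition ps_make :: "(nat \<Rightarrow> nat \<Rightarrow> nat \<Rightarrow> 'a) \<Rightarrow> 'a ps3" where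
  "ps_make c = Abs_fps (\<lambda>i. Abs_fps (\<lambda>j. Abs_fps (c i j)))"

lemma ps_coeff_make [simp]: "ps_coeff (ps_make c) i j k = c i j k"
  by (simp add: ps_make_def ps_coeff_def)

lemma ps_eqI: "(\<And>i j k. ps_coeff f i j k = ps_coeff g i j k) \<Longrightarrow> f = g"
  by (simp add: ps_coeff_def fps_eq_iff)

lemma ps_coeff_0 [simp]: "ps_coeff 0 i j k = 0"
  by (simp add: ps_coeff_def)

lemma ps_coeff_add [simp]:
  "ps_coeff (f + g :: 'a::comm_ring_1 ps3) i j k = ps_coeff f i j k + ps_coeff g i j k"
  by (simp add: ps_coeff_def)

lemma ps_coeff_diff [simp]:
  "ps_coeff (f - g :: 'a::comm_ring_1 ps3) i j k = ps_coeff f i j k - ps_coeff g i j k"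
  by (simp add: ps_coeff_def)

lemma ps_coeff_minus [simp]:
  "ps_coeff (- f :: 'a::comm_ring_1 ps3) i j k = - ps_coeff f i j k"
  by (simp add: ps_coeff_def)

lemma ps_coeff_sum [simp]:
  "ps_coeff (\<Sum>a\<in>A. f a :: 'a::comm_ring_1 ps3) i j k = (\<Sum>a\<in>A. ps_coeff (f a) i j k)"
  by (induction A rule: infinite_finite_induct) simp_all

lemma ps_coeff_const: "ps_coeff (ps_const c) i j k = (if i = 0 \<and> j = 0 \<and> k = 0 then c else 0)"
  by (simp add: ps_coeff_def ps_const_def)

lemma ps_coeff_const_mult [simp]:
  "ps_coeff (ps_const c * f :: 'a::comm_ring_1 ps3) i j k = c * ps_coeff f i j k"
  by (simp add: ps_coeff_def ps_const_def)

lemma ps_coeff_xv_mult [simp]: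
  "ps_coeff (xv * f :: 'a::comm_ring_1 ps3) i j k = (if i = 0 then 0 else ps_coeff f (i - 1) j k)"
  by (simp add: ps_coeff_def xv_def)

lemma ps_coeff_yv_mult [simp]:
  "ps_coeff (yv * f :: 'a::comm_ring_1 ps3) i j k = (if j = 0 then 0 else ps_coeff f i (j - 1) k)"
  by (simp add: ps_coeff_def yv_def)

lemma ps_coeff_zv_mult [simp]:
  "ps_coeff (zv * f :: 'a::comm_ring_1 ps3) i j k = (if k = 0 then 0 else ps_coeff f i j (k - 1))"
  by (simp add: ps_coeff_def zv_def)

lemma ps_coeff_xv: "ps_coeff xv i j k = (if i = 1 \<and> j = 0 \<and> k = 0 then 1 else 0)"
  and ps_coeff_yv: "ps_coeff yv i j k = (if i = 0 \<and> j = 1 \<and> k = 0 then 1 else 0)"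
  and ps_coeff_zv: "ps_coeff zv i j k = (if i = 0 \<and> j = 0 \<and> k = 1 then 1 else 0)"
  by (auto simp: ps_coeff_def xv_def yv_def zv_def fps_X_def)

lemma ps_const_0 [simp]: "ps_const 0 = 0" and ps_const_1 [simp]: "ps_const 1 = (1::'a::comm_ring_1 ps3)"
  and ps_const_add: "ps_const (a + b) = ps_const a + (ps_const b :: 'a ps3)"
  and ps_const_mult: "ps_const (a * b) = ps_const a * (ps_const b :: 'a ps3)"
  and ps_const_minus: "ps_const (- a) = - (ps_const a :: 'a ps3)"
  and ps_const_diff: "ps_const (a - b) = ps_const a - (ps_const b :: 'a ps3)"
  by (simp_all add: ps_const_def flip: fps_const_neg)

lemma ps_coeff_1: "ps_coeff (1::'a::comm_ring_1 ps3) i j k = (if i = 0 \<and> j = 0 \<and> k = 0 then 1 else 0)"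
  using ps_coeff_const[of "1::'a"] by simp

lemma ps_const_sum: "ps_const (sum f A) = (\<Sum>a\<in>A. ps_const (f a) :: 'a::comm_ring_1 ps3)"
  by (induction A rule: infinite_finite_induct) (simp_all add: ps_const_add)

lemma ps_coeff_mult:
  "ps_coeff (f * g :: 'a::comm_ring_1 ps3) i j k =
     (\<Sum>(i', j', k') \<in> {..i} \<times> {..j} \<times> {..k}. ps_coeff f i' j' k' * ps_coeff g (i - i') (j - j') (k - k'))"
proof -
  have nth_sum: "fps_nth (\<Sum>a\<in>A. h a) n = (\<Sum>a\<in>A. fps_nth (h a) n)"
    for A :: "nat set" and h :: "nat \<Rightarrow> 'b::comm_ring_1 fps" and n
    by (induction A rule: infinite_finite_induct) simp_all
  show ?thesis
    by (simp add: ps_coeff_def fps_mult_nth nth_sum sum.cartesian_product' atLeast0AtMost)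
qed

lemma ps_coeff_monom:
  "ps_coeff (xv ^ i * yv ^ j * zv ^ k :: 'a::comm_ring_1 ps3) i' j' k' =
     (if i' = i \<and> j' = j \<and> k' = k then 1 else 0)"
proof -
  have z: "ps_coeff (zv ^ k :: 'a ps3) i' j' k' = (if i' = 0 \<and> j' = 0 \<and> k' = k then 1 else 0)" for i' j' k'
    by (induction k arbitrary: k') (auto simp: ps_coeff_1)
  have y: "ps_coeff (yv ^ j * zv ^ k :: 'a ps3) i' j' k' = (if i' = 0 \<and> j' = j \<and> k' = k then 1 else 0)" for i' j' k'
    by (induction j arbitrary: j') (auto simp: z mult.assoc)
  have "ps_coeff (xv ^ i * (yv ^ j * zv ^ k) :: 'a ps3) i' j' k' = (if i' = i \<and> j' = j \<and> k' = k then 1 else 0)" for i' j' k'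
    by (induction i arbitrary: i') (auto simp: y mult.assoc)
  thus ?thesis by (simp add: mult.assoc)
qed

section \<open>The filtration by order\<close>

text \<open>The power \<open>n\<close> of the maximal ideal, described by coefficients;
  \<open>ideal_power_max_ideal\<close> identifies the two. Orders and initial forms are handled
  through membership here, which treats the zero series like any other.\<close>

definition Mpow :: "nat \<Rightarrow> 'a::comm_ring_1 ps3 set" where
  "Mpow n = {h. \<forall>i j k. i + j + k < n \<longrightarrow> ps_coeff h i j k = 0}"

lemma MpowI: "(\<And>i j k. i + j + k < n \<Longrightarrow> ps_coeff h i j k = 0) \<Longrightarrow> h \<in> Mpow n"
  and MpowD: "h \<in> Mpow n \<Longrightarrow> i + j + k < n \<Longrightarrow> ps_coeff h i j k = 0"
  by (auto simp: Mpow_def)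

lemma Mpow_zero [simp]: "0 \<in> Mpow n" and Mpow_UNIV [simp]: "h \<in> Mpow 0"
  and Mpow_add: "f \<in> Mpow n \<Longrightarrow> g \<in> Mpow n \<Longrightarrow> f + g \<in> Mpow n"
  and Mpow_diff: "f \<in> Mpow n \<Longrightarrow> g \<in> Mpow n \<Longrightarrow> f - g \<in> Mpow n"
  and Mpow_minus: "f \<in> Mpow n \<Longrightarrow> - f \<in> Mpow n"
  by (auto simp: Mpow_def)

lemma Mpow_minus_iff [simp]: "- f \<in> Mpow n \<longleftrightarrow> f \<in> Mpow n"
  by (auto simp: Mpow_def)

lemma Mpow_sum: "(\<And>a. a \<in> A \<Longrightarrow> f a \<in> Mpow n) \<Longrightarrow> sum f A \<in> Mpow n"
  by (auto simp: Mpow_def)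

lemma Mpow_mono: "f \<in> Mpow n \<Longrightarrow> m \<le> n \<Longrightarrow> f \<in> Mpow m"
  by (auto simp: Mpow_def)

lemma Mpow_mult: "f \<in> Mpow m \<Longrightarrow> g \<in> Mpow n \<Longrightarrow> f * g \<in> Mpow (m + n)"
proof (rule MpowI)
  fix i j k assume f: "f \<in> Mpow m" and g: "g \<in> Mpow n" and *: "i + j + k < m + n"
  have "ps_coeff f i' j' k' * ps_coeff g (i - i') (j - j') (k - k') = 0"
    if "i' \<le> i" "j' \<le> j" "k' \<le> k" for i' j' k'
  proof (cases "i' + j' + k' < m")
    case True thus ?thesis by (simp add: MpowD[OF f])
  next
    case False
    with that * have "(i - i') + (j - j') + (k - k') < n" by linarith
    thus ?thesis by (simp add: MpowD[OF g])
  qed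
  thus "ps_coeff (f * g) i j k = 0"
    unfolding ps_coeff_mult by (intro sum.neutral) auto
qed

lemma Mpow_mult': "f \<in> Mpow m \<Longrightarrow> g \<in> Mpow n \<Longrightarrow> p \<le> m + n \<Longrightarrow> f * g \<in> Mpow p"
  using Mpow_mult Mpow_mono by blast

lemma Mpow_multL: "g \<in> Mpow n \<Longrightarrow> f * g \<in> Mpow n"
  and Mpow_multR: "g \<in> Mpow n \<Longrightarrow> g * f \<in> Mpow n"
  using Mpow_mult[of f 0 g n] Mpow_mult[of g n f 0] by auto

lemma Mpow_power: "f \<in> Mpow m \<Longrightarrow> f ^ n \<in> Mpow (n * m)"
  by (induction n) (auto intro: Mpow_mult)

lemma Mpow_power1: "f \<in> Mpow 1 \<Longrightarrow> f ^ n \<in> Mpow n"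
  using Mpow_power[of f 1 n] by simp

lemma xv_Mpow: "xv \<in> Mpow 1" and yv_Mpow: "yv \<in> Mpow 1" and zv_Mpow: "zv \<in> Mpow 1"
  by (auto simp: Mpow_def ps_coeff_xv ps_coeff_yv ps_coeff_zv)

text \<open>Separatedness of the filtration: identities between limits are proved by showing that
  the difference lies in every \<open>Mpow N\<close>.\<close>

lemma Mpow_Inter: "(\<And>n. h \<in> Mpow n) \<Longrightarrow> h = 0"
proof (rule ps_eqI)
  fix i j k assume "\<And>n. h \<in> Mpow n"
  from MpowD[OF this[of "Suc (i + j + k)"], of i j k] show "ps_coeff h i j k = ps_coeff 0 i j k" by simp
qed

lemma Mpow_1_iff: "h \<in> Mpow (Suc 0) \<longleftrightarrow> ps_coeff h 0 0 0 = 0"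
  by (auto simp: Mpow_def)

lemma Mpow_Suc_iff: "h \<in> Mpow (Suc n) \<longleftrightarrow> h \<in> Mpow n \<and> (\<forall>i j k. i + j + k = n \<longrightarrow> ps_coeff h i j k = 0)"
  by (auto simp: Mpow_def less_Suc_eq)

text \<open>Each monomial is assigned to the first of \<open>x\<close>, \<open>y\<close>,
  \<open>z\<close> that divides it, so that no term is counted twice.\<close>

lemma Mpow_Suc_decomp:
  assumes "h \<in> Mpow (Suc n)"
  obtains a b c where "a \<in> Mpow n" "b \<in> Mpow n" "c \<in> Mpow n" "h = xv * a + yv * b + zv * c"
proof
  let ?a = "ps_make (\<lambda>i j k. ps_coeff h (Suc i) j k)"
  let ?b = "ps_make (\<lambda>i j k. if i = 0 then ps_coeff h 0 (Suc j) k else 0)"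
  let ?c = "ps_make (\<lambda>i j k. if i = 0 \<and> j = 0 then ps_coeff h 0 0 (Suc k) else 0)"
  show "?a \<in> Mpow n" "?b \<in> Mpow n" "?c \<in> Mpow n"
    using assms by (auto simp: Mpow_def)
  have "ps_coeff h 0 0 0 = 0" using assms by (auto simp: Mpow_def)
  thus "h = xv * ?a + yv * ?b + zv * ?c"
    by (intro ps_eqI) auto
qed

text \<open>The sum of all \<open>u n\<close> if \<open>u n\<close> has order at least \<open>n\<close>; otherwise it drops terms.\<close>

definition psum :: "(nat \<Rightarrow> 'a::comm_ring_1 ps3) \<Rightarrow> 'a ps3" where
  "psum u = ps_make (\<lambda>i j k. \<Sum>n\<le>i + j + k. ps_coeff (u n) i j k)"

lemma psum_approx:
  assumes "\<And>n. u n \<in> Mpow n"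
  shows "psum u - (\<Sum>n<N. u n) \<in> Mpow N"
proof (rule MpowI)
  fix i j k assume "i + j + k < N"
  hence "(\<Sum>n\<le>i + j + k. ps_coeff (u n) i j k) = (\<Sum>n<N. ps_coeff (u n) i j k)"
    by (intro sum.mono_neutral_left) (auto intro: MpowD[OF assms])
  thus "ps_coeff (psum u - (\<Sum>n<N. u n)) i j k = 0" by (simp add: psum_def)
qed

text \<open>The Neumann series \<open>h + E h + E (E h) + ...\<close> converges because its terms
  have growing order. \<open>E\<close> is additive rather than linear over the series, so that it
  can be multiplication by a series, the difference of the identity and an endomorphism, or a
  division error.\<close>

lemma geometric_ex:
  fixes E :: "'a::comm_ring_1 ps3 \<Rightarrow> 'a ps3"
  assumes add: "\<And>f g. E (f + g) = E f + E g"
    and raise: "\<And>n f. f \<in> Mpow n \<Longrightarrow> E f \<in> Mpow (Suc n)"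
  shows "\<exists>u. u - E u = h"
proof
  define w where "w n = (E ^^ n) h" for n
  have w: "w n \<in> Mpow n" for n
    by (induction n) (auto simp: w_def raise)
  have E_diff: "E (f - g) = E f - E g" for f g
    using add[of "f - g" g] by (simp add: algebra_simps)
  have E0: "E 0 = 0" using add[of 0 0] by simp
  have E_sum: "E (\<Sum>n<N. w n) = (\<Sum>n<N. w (Suc n))" for N
    by (induction N) (simp_all add: E0 add w_def)
  have "psum w - E (psum w) - h \<in> Mpow N" for N
  proof -
    \<comment> \<open>One term more than for \<open>E (psum w)\<close>, so that the two partial sums
      differ exactly by \<open>w 0 = h\<close>.\<close>
    have a: "psum w - (\<Sum>n<Suc N. w n) \<in> Mpow N"
      using psum_approx[OF w, where N = "Suc N"] by (rule Mpow_mono) simp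
    have b: "E (psum w) - (\<Sum>n<N. w (Suc n)) \<in> Mpow N"
      using raise[OF psum_approx[OF w, where N = N]] by (simp add: E_diff E_sum Mpow_Suc_iff)
    have "psum w - E (psum w) - h =
        (psum w - (\<Sum>n<Suc N. w n)) - (E (psum w) - (\<Sum>n<N. w (Suc n)))"
      by (subst sum.lessThan_Suc_shift) (simp add: w_def)
    thus ?thesis using a b by (metis Mpow_diff)
  qed
  from Mpow_Inter[OF this] show "psum w - E (psum w) = h" by simp
qed

lemma geometric_unique:
  fixes E :: "'a::comm_ring_1 ps3 \<Rightarrow> 'a ps3"
  assumes raise: "\<And>n f. f \<in> Mpow n \<Longrightarrow> E f \<in> Mpow (Suc n)" and "u = E u"
  shows "u = 0"
proof (rule Mpow_Inter)
  show "u \<in> Mpow n" for n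
    by (induction n) (simp, metis assms(2) raise)
qed

section \<open>Homogeneous components and their evaluation\<close>

definition degree_triples :: "nat \<Rightarrow> (nat \<times> nat \<times> nat) set" where
  "degree_triples n = {(i, j, k). i + j + k = n}"

lemma finite_degree_triples [simp]: "finite (degree_triples n)"
  by (rule finite_subset[of _ "{..n} \<times> {..n} \<times> {..n}"]) (auto simp: degree_triples_def)

definition hom_eval :: "'a::comm_ring_1 ps3 \<Rightarrow> 'a ps3 \<Rightarrow> 'a ps3 \<Rightarrow> 'a ps3 \<Rightarrow> nat \<Rightarrow> 'a ps3" where
  "hom_eval X Y Z h n =
     (\<Sum>(i, j, k) \<in> degree_triples n. ps_const (ps_coeff h i j k) * (X ^ i * Y ^ j * Z ^ k))"

lemma hom_eval_add: "hom_eval X Y Z (f + g) n = hom_eval X Y Z f n + hom_eval X Y Z g n"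
  by (simp add: hom_eval_def ps_const_add distrib_right sum.distrib split_def)

text \<open>Both sides sum over pairs of monomials of total degree \<open>n\<close>, grouped on the
  left by their product and on the right by the degree of the first factor.\<close>

lemma hom_eval_mult:
  "hom_eval X Y Z (f * g) n = (\<Sum>m\<le>n. hom_eval X Y Z f m * hom_eval X Y Z g (n - m))"
proof -
  define T where "T = (\<lambda>(i,j,k) (i',j',k').
     ps_const (ps_coeff f i j k) * (X ^ i * Y ^ j * Z ^ k) *
     (ps_const (ps_coeff g i' j' k') * (X ^ i' * Y ^ j' * Z ^ k')))"
  have "hom_eval X Y Z (f * g) n =
     (\<Sum>(i, j, k) \<in> degree_triples n. \<Sum>(i',j',k') \<in> {..i} \<times> {..j} \<times> {..k}.
        T (i',j',k') (i - i', j - j', k - k'))"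
    unfolding hom_eval_def ps_coeff_mult
    apply (intro sum.cong refl)
    apply (clarsimp simp: ps_const_sum sum_distrib_right)
    apply (intro sum.cong refl)
    apply (auto simp: T_def ps_const_mult)
    subgoal for i j k i' j' k'
      using power_add[of X i' "i - i'"] power_add[of Y j' "j - j'"] power_add[of Z k' "k - k'"]
      by (simp add: mult_ac)
    done
  also have "\<dots> = (\<Sum>((i, j, k), (i',j',k')) \<in> (SIGMA s : degree_triples n. (case s of (i,j,k) \<Rightarrow> {..i} \<times> {..j} \<times> {..k})).
        T (i',j',k') (i - i', j - j', k - k'))"
    by (subst sum.Sigma[symmetric]) (auto intro!: sum.cong)
  also have "\<dots> = (\<Sum>(m, s, t) \<in> (SIGMA m : {..n}. degree_triples m \<times> degree_triples (n - m)). T s t)"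
    by (rule sum.reindex_bij_witness[where
         j = "\<lambda>((i,j,k),(i',j',k')). (i'+j'+k', (i',j',k'), (i-i',j-j',k-k'))" and
         i = "\<lambda>(m,(i,j,k),(i',j',k')). ((i+i',j+j',k+k'),(i,j,k))"])
       (auto simp: degree_triples_def)
  also have "\<dots> = (\<Sum>m\<le>n. hom_eval X Y Z f m * hom_eval X Y Z g (n - m))"
    unfolding hom_eval_def sum_product
    apply (subst sum.Sigma[symmetric])
      apply simp
     apply simp
    apply (intro sum.cong refl)
    apply (subst sum.cartesian_product)
    apply (intro sum.cong refl)
    apply (auto simp: T_def)
    done
  finally show ?thesis .
qed

lemma hom_eval_id_coeff:
  "ps_coeff (hom_eval xv yv zv h n) i j k = (if i + j + k = n then ps_coeff h i j k else 0)"
proof -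
  have "ps_coeff (hom_eval xv yv zv h n) i j k = (\<Sum>s\<in>degree_triples n. if s = (i,j,k) then ps_coeff h i j k else 0)"
    unfolding hom_eval_def ps_coeff_sum
    by (intro sum.cong refl) (auto simp: ps_coeff_monom split: prod.splits)
  also have "\<dots> = (if i + j + k = n then ps_coeff h i j k else 0)"
    using finite_degree_triples[of n] by (subst sum.delta) (auto simp: degree_triples_def)
  finally show ?thesis .
qed

lemma hom_eval_id_approx: "h - (\<Sum>n<N. hom_eval xv yv zv h n) \<in> Mpow N"
  by (rule MpowI) (simp add: hom_eval_id_coeff)

text \<open>The degree \<open>m + n\<close> component of the product is the product of the lowest
  components, and the series over a field form a domain.\<close>

lemma Mpow_mult_exact:
  fixes f g :: "'a::field ps3"
  assumes "f * g \<in> Mpow (Suc (m + n))" "f \<in> Mpow m" "g \<in> Mpow n"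
  shows "f \<in> Mpow (Suc m) \<or> g \<in> Mpow (Suc n)"
proof -
  let ?c = "hom_eval xv yv zv"
  have zero: "?c h k = 0 \<longleftrightarrow> (\<forall>a b c. a + b + c = k \<longrightarrow> ps_coeff h a b c = 0)" for h k
  proof
    assume "?c h k = 0"
    hence "ps_coeff (?c h k) a b c = 0" for a b c by simp
    thus "\<forall>a b c. a + b + c = k \<longrightarrow> ps_coeff h a b c = 0" by (metis hom_eval_id_coeff)
  next
    assume "\<forall>a b c. a + b + c = k \<longrightarrow> ps_coeff h a b c = 0"
    thus "?c h k = 0" by (intro ps_eqI) (simp add: hom_eval_id_coeff)
  qed
  have low: "?c h k = 0" if "h \<in> Mpow p" "k < p" for h k p
    using that by (auto simp: zero Mpow_def)
  have "0 = ?c (f * g) (m + n)" using low[OF assms(1)] by simp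
  also have "\<dots> = (\<Sum>k\<le>m + n. if k = m then ?c f m * ?c g n else 0)"
    unfolding hom_eval_mult
  proof (intro sum.cong refl)
    fix k assume "k \<in> {..m + n}"
    thus "?c f k * ?c g (m + n - k) = (if k = m then ?c f m * ?c g n else 0)"
      using low[OF assms(2), of k] low[OF assms(3), of "m + n - k"] by (cases k m rule: linorder_cases) auto
  qed
  finally have "?c f m = 0 \<or> ?c g n = 0" by simp
  thus ?thesis using assms(2,3) by (auto simp: zero Mpow_Suc_iff)
qed

text \<open>The factor \<open>f\<close> has some exact order \<open>m' \<le> m\<close>; by
  \<open>Mpow_mult_exact\<close> the order of \<open>g\<close> can be raised one step at a time
  until it reaches \<open>n\<close>.\<close>

lemma Mpow_mult_cancel:
  fixes f g :: "'a::field ps3"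
  assumes "f * g \<in> Mpow (m + n)" "f \<notin> Mpow (Suc m)"
  shows "g \<in> Mpow n"
proof -
  obtain m' where m': "f \<in> Mpow m'" "f \<notin> Mpow (Suc m')" "m' \<le> m"
  proof -
    define m' where "m' = (LEAST k. f \<notin> Mpow (Suc k))"
    have "f \<notin> Mpow (Suc m')" "m' \<le> m"
      unfolding m'_def using assms(2)
      by (rule LeastI[of "\<lambda>k. f \<notin> Mpow (Suc k)"], rule Least_le[of "\<lambda>k. f \<notin> Mpow (Suc k)"])
    moreover have "f \<in> Mpow m'"
      using not_less_Least[of "m' - 1" "\<lambda>k. f \<notin> Mpow (Suc k)"] by (cases m') (auto simp: m'_def)
    ultimately show ?thesis using that by blast
  qed
  have "k \<le> n \<Longrightarrow> g \<in> Mpow k" for k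
  proof (induction k)
    case (Suc k)
    have "f * g \<in> Mpow (Suc (m' + k))"
      using assms(1) by (rule Mpow_mono) (use Suc.prems m' in simp)
    thus ?case using Mpow_mult_exact[OF _ m'(1)] Suc m' by auto
  qed simp
  thus ?thesis by simp
qed

subsection \<open>Substitutions and automorphisms\<close>

text \<open>The last conjunct is continuity for the order filtration. With it an endomorphism is
  determined by the images of the three variables (\<open>alg_endo_unique\<close>);
  \<open>automorphism_endo\<close> derives it for every automorphism.\<close>

definition alg_endo :: "('a::comm_ring_1 ps3 \<Rightarrow> 'a ps3) \<Rightarrow> bool" where
  "alg_endo \<phi> \<longleftrightarrow> (\<forall>f g. \<phi> (f + g) = \<phi> f + \<phi> g) \<and> (\<forall>f g. \<phi> (f * g) = \<phi> f * \<phi> g)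
     \<and> (\<forall>c. \<phi> (ps_const c) = ps_const c) \<and> (\<forall>n. \<forall>h\<in>Mpow n. \<phi> h \<in> Mpow n)"

lemma alg_endo_add: "alg_endo \<phi> \<Longrightarrow> \<phi> (f + g) = \<phi> f + \<phi> g"
  and alg_endo_mult: "alg_endo \<phi> \<Longrightarrow> \<phi> (f * g) = \<phi> f * \<phi> g"
  and alg_endo_const: "alg_endo \<phi> \<Longrightarrow> \<phi> (ps_const c) = ps_const c"
  and alg_endo_Mpow: "alg_endo \<phi> \<Longrightarrow> h \<in> Mpow n \<Longrightarrow> \<phi> h \<in> Mpow n"
  by (auto simp: alg_endo_def)

lemma alg_endo_0: "alg_endo \<phi> \<Longrightarrow> \<phi> 0 = 0"
  using alg_endo_const[of \<phi> 0] by simp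

lemma alg_endo_1: "alg_endo \<phi> \<Longrightarrow> \<phi> 1 = 1"
  using alg_endo_const[of \<phi> 1] by simp

lemma alg_endo_minus: "alg_endo \<phi> \<Longrightarrow> \<phi> (- f) = - \<phi> f"
  using alg_endo_add[of \<phi> f "- f"] alg_endo_0[of \<phi>] by (simp add: eq_neg_iff_add_eq_0 add.commute)

lemma alg_endo_diff: "alg_endo \<phi> \<Longrightarrow> \<phi> (f - g) = \<phi> f - \<phi> g"
  using alg_endo_add[of \<phi> f "- g"] alg_endo_minus[of \<phi> g] by simp

lemma alg_endo_power: "alg_endo \<phi> \<Longrightarrow> \<phi> (f ^ n) = \<phi> f ^ n"
  by (induction n) (simp_all add: alg_endo_1 alg_endo_mult)

lemma alg_endo_sum: "alg_endo \<phi> \<Longrightarrow> \<phi> (sum f A) = (\<Sum>a\<in>A. \<phi> (f a))"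
  by (induction A rule: infinite_finite_induct) (simp_all add: alg_endo_0 alg_endo_add)

lemmas alg_endo_simps = alg_endo_0 alg_endo_1 alg_endo_add alg_endo_mult alg_endo_const
  alg_endo_minus alg_endo_diff alg_endo_power

lemma alg_endo_comp: "alg_endo \<phi> \<Longrightarrow> alg_endo \<chi> \<Longrightarrow> alg_endo (\<phi> \<circ> \<chi>)"
  by (simp add: alg_endo_def)

lemma alg_endo_id: "alg_endo (\<lambda>h. h)"
  by (simp add: alg_endo_def)

lemma hom_eval_Mpow:
  assumes "X \<in> Mpow 1" "Y \<in> Mpow 1" "Z \<in> Mpow 1"
  shows "hom_eval X Y Z h n \<in> Mpow n"
proof -
  have "ps_const c * (X ^ i * Y ^ j * Z ^ k) \<in> Mpow (i + j + k)" for c i j k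
    by (rule Mpow_multL, intro Mpow_mult Mpow_power1 assms)
  thus ?thesis unfolding hom_eval_def
    by (intro Mpow_sum) (auto simp: degree_triples_def)
qed

lemma alg_endo_approx:
  assumes "alg_endo \<phi>"
  shows "\<phi> h - (\<Sum>n<N. hom_eval (\<phi> xv) (\<phi> yv) (\<phi> zv) h n) \<in> Mpow N"
proof -
  have "\<phi> (hom_eval xv yv zv h n) = hom_eval (\<phi> xv) (\<phi> yv) (\<phi> zv) h n" for n
    by (simp add: hom_eval_def alg_endo_sum[OF assms] alg_endo_simps[OF assms] split_def)
  thus ?thesis
    using alg_endo_Mpow[OF assms hom_eval_id_approx[of h N]]
    by (simp add: alg_endo_diff[OF assms] alg_endo_sum[OF assms])
qed

lemma alg_endo_unique:
  assumes "alg_endo \<phi>" "alg_endo \<chi>" "\<phi> xv = \<chi> xv" "\<phi> yv = \<chi> yv" "\<phi> zv = \<chi> zv"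
  shows "\<phi> h = \<chi> h"
proof -
  have "\<phi> h - \<chi> h \<in> Mpow N" for N
    using Mpow_diff[OF alg_endo_approx[OF assms(1), of h N] alg_endo_approx[OF assms(2), of h N]] assms(3-5)
    by simp
  from Mpow_Inter[OF this] show ?thesis by simp
qed

lemma sum_triangle:
  "(\<Sum>n<N. \<Sum>m\<le>n. g m (n - m)) = (\<Sum>m<N. \<Sum>k<N - m. g m k :: 'a::comm_monoid_add)"
  for N :: nat
proof (induction N)
  case (Suc N)
  have "(\<Sum>m<Suc N. \<Sum>k<Suc N - m. g m k) = (\<Sum>m<N. (\<Sum>k<N - m. g m k) + g m (N - m)) + g N 0"
    by (auto simp: Suc_diff_le intro!: sum.cong)
  also have "\<dots> = (\<Sum>m<N. \<Sum>k<N - m. g m k) + (\<Sum>m\<le>N. g m (N - m))"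
    by (simp add: sum.distrib add.assoc flip: lessThan_Suc_atMost)
  finally show ?case using Suc by simp
qed simp

lemma psum_mult:
  assumes u: "\<And>n. u n \<in> Mpow n" and v: "\<And>n. v n \<in> Mpow n"
  shows "psum (\<lambda>n. \<Sum>m\<le>n. u m * v (n - m)) = psum u * psum v"
proof -
  let ?w = "\<lambda>n. \<Sum>m\<le>n. u m * v (n - m)"
  have w: "?w n \<in> Mpow n" for n
    by (intro Mpow_sum Mpow_mult'[OF u v]) auto
  have "psum ?w - psum u * psum v \<in> Mpow N" for N
  proof -
    have a: "psum ?w - (\<Sum>m<N. \<Sum>k<N - m. u m * v k) \<in> Mpow N"
      using psum_approx[of ?w, OF w, where N = N] by (simp add: sum_triangle[where g = "\<lambda>m k. u m * v k"])
    have b: "(psum u - (\<Sum>m<N. u m)) * psum v \<in> Mpow N"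
      by (intro Mpow_multR psum_approx u)
    have c: "(\<Sum>m<N. u m * (psum v - (\<Sum>k<N - m. v k))) \<in> Mpow N"
      by (intro Mpow_sum Mpow_mult'[OF u psum_approx[OF v]]) auto
    \<comment> \<open>Three errors of order at least \<open>N\<close>: the tail of the Cauchy
      product, the tail of \<open>u\<close>, and the tails of \<open>v\<close> cut off at
      \<open>N - m\<close>.\<close>
    have "psum ?w - psum u * psum v = (psum ?w - (\<Sum>m<N. \<Sum>k<N - m. u m * v k))
       - (psum u - (\<Sum>m<N. u m)) * psum v - (\<Sum>m<N. u m * (psum v - (\<Sum>k<N - m. v k)))"
    proof -
      have "(\<Sum>m<N. u m * (psum v - (\<Sum>k<N - m. v k))) =
          (\<Sum>m<N. u m) * psum v - (\<Sum>m<N. \<Sum>k<N - m. u m * v k)"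
        by (simp only: right_diff_distrib sum_subtractf sum_distrib_right sum_distrib_left)
      thus ?thesis by (simp add: left_diff_distrib)
    qed
    moreover have "\<dots> \<in> Mpow N"
      by (intro Mpow_diff a b c)
    ultimately show ?thesis by (simp only:)
  qed
  from Mpow_Inter[OF this] show ?thesis by simp
qed

text \<open>Substitution \<open>h(x,y,z) \<mapsto> h(X,Y,Z)\<close>; meaningful for \<open>X, Y, Z\<close> without constant term.\<close>

definition sub :: "'a::comm_ring_1 ps3 \<Rightarrow> 'a ps3 \<Rightarrow> 'a ps3 \<Rightarrow> 'a ps3 \<Rightarrow> 'a ps3" where
  "sub X Y Z h = psum (hom_eval X Y Z h)"

lemma sub_monom:
  assumes h: "\<And>i j k. ps_coeff h i j k = (if i = a \<and> j = b \<and> k = c then e else 0)"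
    and XYZ: "X \<in> Mpow 1" "Y \<in> Mpow 1" "Z \<in> Mpow 1"
  shows "sub X Y Z h = ps_const e * (X ^ a * Y ^ b * Z ^ c)"
proof -
  let ?m = "ps_const e * (X ^ a * Y ^ b * Z ^ c)"
  have *: "hom_eval X Y Z h n = (if n = a + b + c then ?m else 0)" for n
  proof -
    have "hom_eval X Y Z h n = (\<Sum>s\<in>degree_triples n. if s = (a, b, c) then ?m else 0)"
      unfolding hom_eval_def by (intro sum.cong refl) (auto simp: h split: if_splits)
    also have "\<dots> = (if n = a + b + c then ?m else 0)"
      using finite_degree_triples[of n] by (subst sum.delta) (auto simp: degree_triples_def)
    finally show ?thesis .
  qed
  have "sub X Y Z h - ?m \<in> Mpow N" for N
  proof -
    have "sub X Y Z h - (\<Sum>n<N + Suc (a + b + c). hom_eval X Y Z h n) \<in> Mpow N"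
      unfolding sub_def using psum_approx[OF hom_eval_Mpow[OF XYZ]] by (rule Mpow_mono) simp
    moreover have "(\<Sum>n<N + Suc (a + b + c). hom_eval X Y Z h n) = ?m"
      unfolding * by (subst sum.delta) auto
    ultimately show ?thesis by (simp only:)
  qed
  from Mpow_Inter[OF this] show ?thesis by simp
qed

context
  fixes X Y Z :: "'a::comm_ring_1 ps3"
  assumes XYZ: "X \<in> Mpow 1" "Y \<in> Mpow 1" "Z \<in> Mpow 1"
begin

lemma sub_xv: "sub X Y Z xv = X" and sub_yv: "sub X Y Z yv = Y" and sub_zv: "sub X Y Z zv = Z"
  and sub_const: "sub X Y Z (ps_const c) = ps_const c"
  using sub_monom[OF ps_coeff_xv XYZ] sub_monom[OF ps_coeff_yv XYZ] sub_monom[OF ps_coeff_zv XYZ]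
    sub_monom[OF ps_coeff_const XYZ] by simp_all

lemma alg_endo_sub: "alg_endo (sub X Y Z)"
  unfolding alg_endo_def
proof (intro conjI allI ballI)
  note H = hom_eval_Mpow[OF XYZ]
  show "sub X Y Z (f + g) = sub X Y Z f + sub X Y Z g" for f g
    by (rule ps_eqI) (simp add: sub_def psum_def hom_eval_add sum.distrib)
  show "sub X Y Z (f * g) = sub X Y Z f * sub X Y Z g" for f g
    unfolding sub_def psum_mult[OF H H, symmetric] by (simp add: psum_def hom_eval_mult)
  show "sub X Y Z (ps_const c) = ps_const c" for c
    by (rule sub_const)
  fix n and h :: "'a ps3" assume h: "h \<in> Mpow n"
  have "hom_eval X Y Z h m = 0" if "m < n" for m
    unfolding hom_eval_def using that
    by (intro sum.neutral) (auto simp: degree_triples_def MpowD[OF h])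
  hence "(\<Sum>m<n. hom_eval X Y Z h m) = 0" by simp
  thus "sub X Y Z h \<in> Mpow n"
    using psum_approx[of "hom_eval X Y Z h" n, OF H] by (simp add: sub_def)
qed

end

text \<open>The behaviour on the variables spreads to all series by the product rule
  \<open>\<phi>(va) - va = (\<phi>v - v) \<phi>a + v (\<phi>a - a)\<close>.\<close>

lemma alg_endo_near_id:
  assumes \<phi>: "alg_endo \<phi>"
    and v: "\<phi> xv - xv \<in> Mpow 2" "\<phi> yv - yv \<in> Mpow 2" "\<phi> zv - zv \<in> Mpow 2"
  shows "h \<in> Mpow n \<Longrightarrow> \<phi> h - h \<in> Mpow (Suc n)"
proof (induction n arbitrary: h)
  have step: "\<phi> (v * a) - v * a \<in> Mpow (Suc (Suc n))"
    if "\<phi> v - v \<in> Mpow 2" "v \<in> Mpow 1" "a \<in> Mpow n" "\<phi> a - a \<in> Mpow (Suc n)" for v a n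
  proof -
    have "\<phi> (v * a) - v * a = (\<phi> v - v) * \<phi> a + v * (\<phi> a - a)"
      by (simp add: alg_endo_mult[OF \<phi>] algebra_simps)
    also have "\<dots> \<in> Mpow (Suc (Suc n))"
      using Mpow_mult[OF that(1) alg_endo_Mpow[OF \<phi> that(3)]] Mpow_mult[OF that(2,4)]
      by (intro Mpow_add) simp_all
    finally show ?thesis .
  qed
  {
    case 0
    define h' where "h' = h - ps_const (ps_coeff h 0 0 0)"
    have "h' \<in> Mpow (Suc 0)" by (simp add: h'_def Mpow_1_iff ps_coeff_const)
    from Mpow_diff[OF alg_endo_Mpow[OF \<phi> this] this]
    show ?case by (simp add: h'_def alg_endo_simps[OF \<phi>])
  next
    case (Suc n)
    from Suc.prems obtain a b c where abc: "a \<in> Mpow n" "b \<in> Mpow n" "c \<in> Mpow n"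
      and h: "h = xv * a + yv * b + zv * c" by (rule Mpow_Suc_decomp)
    have "\<phi> h - h = (\<phi> (xv * a) - xv * a) + (\<phi> (yv * b) - yv * b) + (\<phi> (zv * c) - zv * c)"
      by (simp add: h alg_endo_add[OF \<phi>])
    also have "\<dots> \<in> Mpow (Suc (Suc n))"
      by (intro Mpow_add step v xv_Mpow yv_Mpow zv_Mpow abc Suc.IH)
    finally show ?case .
  }
qed

text \<open>The operator \<open>h - \<phi> h\<close> raises orders, so its Neumann series inverts
  \<open>\<phi>\<close>.\<close>

lemma alg_endo_near_id_bij:
  assumes \<phi>: "alg_endo \<phi>" and near: "\<And>n h. h \<in> Mpow n \<Longrightarrow> \<phi> h - h \<in> Mpow (Suc n)"
  shows "bij \<phi>"
proof -
  have raise: "h \<in> Mpow n \<Longrightarrow> h - \<phi> h \<in> Mpow (Suc n)" for n h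
    using Mpow_minus[OF near] by fastforce
  have "inj \<phi>"
  proof (rule injI)
    fix f g assume "\<phi> f = \<phi> g"
    hence "f - g = (\<lambda>h. h - \<phi> h) (f - g)" by (simp add: alg_endo_diff[OF \<phi>])
    from geometric_unique[of "\<lambda>h. h - \<phi> h" "f - g", OF raise this] show "f = g" by simp
  qed
  moreover have "\<exists>u. \<phi> u = h" for h
    using geometric_ex[of "\<lambda>h. h - \<phi> h" h, OF _ raise] by (simp add: alg_endo_add[OF \<phi>])
  ultimately show ?thesis by (metis bij_def surj_def)
qed

section \<open>Units and automorphisms of the ring of series\<close>

lemma ps_unit_ex:
  fixes h :: "'a::field ps3"
  assumes "ps_coeff h 0 0 0 \<noteq> 0"
  obtains v where "h * v = 1"
proof -
  define c where "c = ps_const (inverse (ps_coeff h 0 0 0))"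
  have "1 - c * h \<in> Mpow 1"
    using assms by (simp add: Mpow_1_iff c_def ps_coeff_1)
  hence "f \<in> Mpow n \<Longrightarrow> (1 - c * h) * f \<in> Mpow (Suc n)" for n f
    using Mpow_mult[of "1 - c * h" 1 f n] by simp
  then obtain u where "u - (1 - c * h) * u = 1"
    using geometric_ex[of "\<lambda>u. (1 - c * h) * u" 1] by (auto simp: algebra_simps)
  hence "h * (c * u) = 1" by (simp add: algebra_simps)
  thus ?thesis by (rule that)
qed

lemma ps_unit_iff: "ps_coeff (h::'a::field ps3) 0 0 0 \<noteq> 0 \<longleftrightarrow> (\<exists>v. h * v = 1)"
proof
  assume "\<exists>v. h * v = 1"
  then obtain v where "h * v = 1" ..
  hence "ps_coeff (h * v) 0 0 0 = 1" by (simp add: ps_coeff_1)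
  thus "ps_coeff h 0 0 0 \<noteq> 0" by (auto simp: ps_coeff_mult)
qed (metis ps_unit_ex)

lemma alg_endo_automorphism: "alg_endo \<phi> \<Longrightarrow> bij \<phi> \<Longrightarrow> K_algebra_automorphism \<phi>"
  by (simp add: alg_endo_def K_algebra_automorphism_def)

lemma automorphism_bij: "K_algebra_automorphism \<phi> \<Longrightarrow> bij \<phi>"
  by (simp add: K_algebra_automorphism_def)

text \<open>Continuity is automatic: an automorphism maps non-units to non-units, hence the maximal
  ideal into itself, and then also its powers.\<close>

lemma automorphism_endo:
  fixes \<phi> :: "'a::field ps3 \<Rightarrow> 'a ps3"
  assumes "K_algebra_automorphism \<phi>"
  shows "alg_endo \<phi>"
proof -
  from assms have bij: "bij \<phi>" and add: "\<phi> (f + g) = \<phi> f + \<phi> g" and mult: "\<phi> (f * g) = \<phi> f * \<phi> g"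
    and const: "\<phi> (ps_const c) = ps_const c" for f g c
    by (auto simp: K_algebra_automorphism_def)
  have one: "\<phi> 1 = 1" using const[of 1] by simp
  have M1: "\<phi> h \<in> Mpow 1" if "h \<in> Mpow 1" for h
  proof (rule ccontr)
    assume "\<phi> h \<notin> Mpow 1"
    then obtain v where v: "\<phi> h * v = 1"
      by (auto simp: Mpow_1_iff elim: ps_unit_ex)
    obtain w where "v = \<phi> w" using bij by (metis bij_pointE)
    with v mult one have "\<phi> (h * w) = \<phi> 1" by simp
    hence "h * w = 1" using bij by (metis bij_def injD)
    with that ps_unit_iff[of h] show False by (auto simp: Mpow_1_iff)
  qed
  have "h \<in> Mpow n \<Longrightarrow> \<phi> h \<in> Mpow n" for n h
  proof (induction n arbitrary: h)
    case (Suc n)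
    from Suc.prems obtain a b c where abc: "a \<in> Mpow n" "b \<in> Mpow n" "c \<in> Mpow n"
      and h: "h = xv * a + yv * b + zv * c" by (rule Mpow_Suc_decomp)
    have "\<phi> xv * \<phi> a + \<phi> yv * \<phi> b + \<phi> zv * \<phi> c \<in> Mpow (1 + n)"
      by (intro Mpow_add Mpow_mult M1 Suc.IH abc xv_Mpow yv_Mpow zv_Mpow)
    thus ?case by (simp add: h add mult)
  qed simp
  thus ?thesis using add mult const by (simp add: alg_endo_def)
qed

lemma automorphism_inv:
  fixes \<phi> :: "'a::field ps3 \<Rightarrow> 'a ps3"
  assumes "K_algebra_automorphism \<phi>"
  shows "K_algebra_automorphism (inv \<phi>)"
proof -
  have bij: "bij \<phi>" and e: "alg_endo \<phi>"
    using assms by (simp_all add: automorphism_bij automorphism_endo)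
  have inj: "inj \<phi>" and s: "\<phi> (inv \<phi> f) = f" for f
    using bij by (simp_all add: bij_def surj_f_inv_f)
  show ?thesis
    unfolding K_algebra_automorphism_def
    by (auto intro!: bij_imp_bij_inv bij inv_f_eq inj simp: alg_endo_simps[OF e] s)
qed

lemma automorphism_comp:
  "K_algebra_automorphism \<phi> \<Longrightarrow> K_algebra_automorphism \<chi> \<Longrightarrow> K_algebra_automorphism (\<phi> \<circ> \<chi>)"
  by (auto simp: K_algebra_automorphism_def intro: bij_comp)

lemma automorphism_Mpow_iff:
  fixes \<phi> :: "'a::field ps3 \<Rightarrow> 'a ps3"
  assumes "K_algebra_automorphism \<phi>"
  shows "\<phi> h \<in> Mpow n \<longleftrightarrow> h \<in> Mpow n"
  using alg_endo_Mpow[OF automorphism_endo[OF assms]]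
    alg_endo_Mpow[OF automorphism_endo[OF automorphism_inv[OF assms]], of "\<phi> h" n]
    automorphism_bij[OF assms] by (auto simp: bij_def)

section \<open>Linear systems over a field\<close>

lemma homogeneous_system_nontrivial:
  fixes c :: "'b \<Rightarrow> nat \<Rightarrow> 'a::field"
  shows "finite S \<Longrightarrow> n < card S \<Longrightarrow>
    \<exists>a. (\<exists>i\<in>S. a i \<noteq> 0) \<and> (\<forall>j<n. (\<Sum>i\<in>S. a i * c i j) = 0)"
proof (induction n arbitrary: S c)
  case 0
  thus ?case by (intro exI[of _ "\<lambda>_. 1"]) (auto simp: card_gt_0_iff)
next
  case (Suc n)
  show ?case
  proof (cases "\<forall>i\<in>S. c i n = 0")
    case True
    from Suc.IH[of S c] Suc.prems obtain a where
      "\<exists>i\<in>S. a i \<noteq> 0" "\<forall>j<n. (\<Sum>i\<in>S. a i * c i j) = 0" by auto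
    thus ?thesis using True by (intro exI[of _ a]) (auto simp: less_Suc_eq)
  next
    case False
    then obtain p where p: "p \<in> S" "c p n \<noteq> 0" by auto
    \<comment> \<open>Elimination of the unknown \<open>p\<close> by means of equation
      \<open>n\<close>, in which it has a nonzero coefficient; \<open>t\<close> below is its value
      by back substitution.\<close>
    define c' where "c' i j = c i j - c i n / c p n * c p j" for i j
    have "n < card (S - {p})" using Suc.prems p by simp
    with Suc.IH[of "S - {p}" c'] Suc.prems obtain a where
      a: "\<exists>i\<in>S - {p}. a i \<noteq> 0" "\<forall>j<n. (\<Sum>i\<in>S - {p}. a i * c' i j) = 0" by blast
    define t where "t = - (\<Sum>i\<in>S - {p}. a i * c i n) / c p n"
    define a' where "a' i = (if i = p then t else a i)" for i
    have sum: "(\<Sum>i\<in>S. a' i * c i j) = t * c p j + (\<Sum>i\<in>S - {p}. a i * c i j)" for j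
      using p Suc.prems by (subst sum.remove[of _ p]) (auto simp: a'_def intro!: sum.cong)
    have c': "(\<Sum>i\<in>S - {p}. a i * c' i j) = (\<Sum>i\<in>S - {p}. a i * c i j) + t * c p j" for j
      by (simp add: c'_def t_def right_diff_distrib sum_subtractf sum_divide_distrib sum_distrib_right mult.assoc)
    have "(\<Sum>i\<in>S. a' i * c i j) = 0" if "j < Suc n" for j
    proof (cases "j = n")
      case True
      thus ?thesis using p by (simp add: sum t_def)
    next
      case False
      with that a(2) c'[of j] show ?thesis by (simp add: sum add.commute)
    qed
    moreover have "\<exists>i\<in>S. a' i \<noteq> 0" using a(1) by (auto simp: a'_def)
    ultimately show ?thesis by blast
  qed
qed

subsection \<open>Linear forms\<close>

definition lin :: "'a::comm_ring_1 \<Rightarrow> 'a \<Rightarrow> 'a \<Rightarrow> 'a ps3" where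
  "lin a b c = ps_const a * xv + ps_const b * yv + ps_const c * zv"

lemma ps_coeff_lin: "ps_coeff (lin a b c) i j k =
   (if (i, j, k) = (1, 0, 0) then a else if (i, j, k) = (0, 1, 0) then b
    else if (i, j, k) = (0, 0, 1) then c else 0)"
  by (auto simp: lin_def ps_coeff_xv ps_coeff_yv ps_coeff_zv)

lemma lin_eq_iff: "lin a b c = lin a' b' c' \<longleftrightarrow> a = a' \<and> b = b' \<and> c = c'"
proof
  assume *: "lin a b c = lin a' b' c'"
  show "a = a' \<and> b = b' \<and> c = c'"
    using arg_cong[OF *, of "\<lambda>f. ps_coeff f 1 0 0"] arg_cong[OF *, of "\<lambda>f. ps_coeff f 0 1 0"]
      arg_cong[OF *, of "\<lambda>f. ps_coeff f 0 0 1"] by (simp add: ps_coeff_lin)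
qed simp

lemma lin_Mpow: "lin a b c \<in> Mpow 1"
  by (auto simp: Mpow_def ps_coeff_lin)

lemma lin_Mpow2_iff: "lin a b c \<in> Mpow 2 \<longleftrightarrow> a = 0 \<and> b = 0 \<and> c = 0"
proof
  assume "lin a b c \<in> Mpow 2"
  from MpowD[OF this, of 1 0 0] MpowD[OF this, of 0 1 0] MpowD[OF this, of 0 0 1]
  show "a = 0 \<and> b = 0 \<and> c = 0" by (simp add: ps_coeff_lin)
qed (simp add: lin_def)

lemma lin_0 [simp]: "lin 0 0 0 = 0" and lin_x: "lin 1 0 0 = xv" and lin_y: "lin 0 1 0 = yv"
  and lin_z: "lin 0 0 1 = zv"
  and lin_add: "lin a b c + lin a' b' c' = lin (a + a') (b + b') (c + c')"
  and lin_diff: "lin a b c - lin a' b' c' = lin (a - a') (b - b') (c - c')"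
  and lin_scale: "ps_const t * lin a b c = lin (t * a) (t * b) (t * c)"
  by (simp_all add: lin_def ps_const_add ps_const_diff ps_const_mult algebra_simps)

definition lin_indep :: "'a::comm_ring_1 ps3 \<Rightarrow> 'a ps3 \<Rightarrow> 'a ps3 \<Rightarrow> bool" where
  "lin_indep X Y Z \<longleftrightarrow> X \<in> range (\<lambda>(a, b, c). lin a b c) \<and> Y \<in> range (\<lambda>(a, b, c). lin a b c)
     \<and> Z \<in> range (\<lambda>(a, b, c). lin a b c)
     \<and> (\<forall>a b c. ps_const a * X + ps_const b * Y + ps_const c * Z = 0 \<longrightarrow> a = 0 \<and> b = 0 \<and> c = 0)"

text \<open>Four vectors in a space of dimension three are dependent, and independence of
  \<open>X, Y, Z\<close> forces the coefficient of the fourth to be nonzero.\<close>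

lemma lin_indep_span:
  fixes X :: "'a::field ps3"
  assumes "lin_indep X Y Z"
  obtains a b c where "lin p q r = ps_const a * X + ps_const b * Y + ps_const c * Z"
proof -
  from assms obtain x1 x2 x3 y1 y2 y3 z1 z2 z3 where
    XYZ: "X = lin x1 x2 x3" "Y = lin y1 y2 y3" "Z = lin z1 z2 z3"
    by (auto simp: lin_indep_def)
  define M where "M = [[x1,x2,x3],[y1,y2,y3],[z1,z2,z3],[p,q,r]]"
  from homogeneous_system_nontrivial[of "{..<4::nat}" 3 "\<lambda>i j. M ! i ! j"]
  obtain a where a: "\<exists>i\<in>{..<4}. a i \<noteq> 0" "\<forall>j<3. (\<Sum>i<4. a i * M ! i ! j) = 0" by auto
  have *: "a 0 * x1 + a 1 * y1 + a 2 * z1 + a 3 * p = 0"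
    "a 0 * x2 + a 1 * y2 + a 2 * z2 + a 3 * q = 0"
    "a 0 * x3 + a 1 * y3 + a 2 * z3 + a 3 * r = 0"
    using a(2)[rule_format, of 0] a(2)[rule_format, of 1] a(2)[rule_format, of 2]
    by (simp_all add: M_def numeral_eq_Suc add.assoc)
  have rel: "ps_const (a 0) * X + ps_const (a 1) * Y + ps_const (a 2) * Z + ps_const (a 3) * lin p q r = 0"
    unfolding XYZ lin_scale lin_add by (simp only: * lin_0)
  have "a 3 \<noteq> 0"
  proof
    assume 3: "a 3 = 0"
    with rel assms have "a 0 = 0 \<and> a 1 = 0 \<and> a 2 = 0" by (simp add: lin_indep_def)
    with 3 a(1) show False by (auto simp: numeral_eq_Suc less_Suc_eq)
  qed
  define t where "t = - inverse (a 3)"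
  have t: "ps_const t * ps_const (a 3) = -1"
    using \<open>a 3 \<noteq> 0\<close> by (simp add: t_def ps_const_minus flip: ps_const_mult)
  have "lin p q r = lin p q r + ps_const t *
      (ps_const (a 0) * X + ps_const (a 1) * Y + ps_const (a 2) * Z + ps_const (a 3) * lin p q r)"
    by (simp only: rel mult_zero_right add_0_right)
  also have "\<dots> = lin p q r + (ps_const t * ps_const (a 3)) * lin p q r +
      (ps_const (t * a 0) * X + ps_const (t * a 1) * Y + ps_const (t * a 2) * Z)"
    by (simp add: ps_const_mult algebra_simps)
  also have "\<dots> = ps_const (t * a 0) * X + ps_const (t * a 1) * Y + ps_const (t * a 2) * Z"
    by (simp add: t)
  finally show ?thesis by (rule that)
qed

lemma lin_indep_right_inverse:
  fixes X :: "'a::field ps3"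
  assumes "lin_indep X Y Z"
  obtains X' Y' Z' where "lin_indep X' Y' Z'" "\<And>h. sub X Y Z (sub X' Y' Z' h) = h"
proof -
  have XYZ: "X \<in> Mpow 1" "Y \<in> Mpow 1" "Z \<in> Mpow 1"
    using assms lin_Mpow by (auto simp: lin_indep_def)
  note e = alg_endo_sub[OF XYZ]
  note es = alg_endo_simps[OF e] sub_xv[OF XYZ] sub_yv[OF XYZ] sub_zv[OF XYZ]
  obtain x1 x2 x3 where x: "xv = ps_const x1 * X + ps_const x2 * Y + ps_const x3 * Z"
    using lin_indep_span[OF assms, of 1 0 0] by (auto simp: lin_x)
  obtain y1 y2 y3 where y: "yv = ps_const y1 * X + ps_const y2 * Y + ps_const y3 * Z"
    using lin_indep_span[OF assms, of 0 1 0] by (auto simp: lin_y)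
  obtain z1 z2 z3 where z: "zv = ps_const z1 * X + ps_const z2 * Y + ps_const z3 * Z"
    using lin_indep_span[OF assms, of 0 0 1] by (auto simp: lin_z)
  let ?X = "lin x1 x2 x3" and ?Y = "lin y1 y2 y3" and ?Z = "lin z1 z2 z3"
  have s: "sub X Y Z ?X = xv" "sub X Y Z ?Y = yv" "sub X Y Z ?Z = zv"
    by (simp_all add: lin_def es x[symmetric] y[symmetric] z[symmetric])
  have "sub X Y Z (sub ?X ?Y ?Z h) = h" for h
    using alg_endo_unique[OF alg_endo_comp[OF e alg_endo_sub[OF lin_Mpow lin_Mpow lin_Mpow]] alg_endo_id,
        of x1 x2 x3 y1 y2 y3 z1 z2 z3 h]
    by (simp add: sub_xv sub_yv sub_zv lin_Mpow[unfolded One_nat_def] s)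
  moreover have "lin_indep ?X ?Y ?Z"
    unfolding lin_indep_def
  proof (intro conjI allI impI)
    fix a b c assume "ps_const a * ?X + ps_const b * ?Y + ps_const c * ?Z = 0"
    hence "sub X Y Z (ps_const a * ?X + ps_const b * ?Y + ps_const c * ?Z) = 0"
      by (simp add: es)
    hence "lin a b c = lin 0 0 0" by (simp add: es s) (simp add: lin_def)
    thus "a = 0" "b = 0" "c = 0" by (simp_all only: lin_eq_iff)
  qed (auto simp: image_iff)
  ultimately show ?thesis using that by blast
qed

text \<open>The right inverse of the substitution is again a substitution of independent forms and
  so has a right inverse of its own. A map with inverses on both sides is bijective.\<close>

lemma lin_indep_automorphism:
  fixes X :: "'a::field ps3"
  assumes "lin_indep X Y Z"
  obtains \<phi> where "K_algebra_automorphism \<phi>" "\<phi> X = xv" "\<phi> Y = yv" "\<phi> Z = zv"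
proof -
  have M: "A \<in> Mpow 1 \<and> B \<in> Mpow 1 \<and> C \<in> Mpow 1" if "lin_indep A B C" for A B C :: "'a ps3"
    using that lin_Mpow by (auto simp: lin_indep_def)
  note XYZ = M[OF assms, THEN conjunct1] M[OF assms, THEN conjunct2, THEN conjunct1]
    M[OF assms, THEN conjunct2, THEN conjunct2]
  obtain X' Y' Z' where i: "lin_indep X' Y' Z'" and 1: "\<And>h. sub X Y Z (sub X' Y' Z' h) = h"
    using assms by (rule lin_indep_right_inverse) blast
  obtain X'' Y'' Z'' where 2: "\<And>h. sub X' Y' Z' (sub X'' Y'' Z'' h) = h"
    using i by (rule lin_indep_right_inverse) blast
  have bij: "bij (sub X' Y' Z')"
  proof (rule bijI)
    show "inj (sub X' Y' Z')" using 1 by (metis injI)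
    show "surj (sub X' Y' Z')" using 2 by (rule surjI)
  qed
  have aut: "K_algebra_automorphism (sub X' Y' Z')"
    using M[OF i] by (intro alg_endo_automorphism bij alg_endo_sub) auto
  have 3: "sub X' Y' Z' (sub X Y Z h) = h" for h
  proof -
    obtain k where "h = sub X' Y' Z' k" using bij by (metis bij_pointE)
    thus ?thesis by (simp add: 1)
  qed
  show ?thesis
    using that[OF aut] 3[of xv] 3[of yv] 3[of zv]
    by (simp add: sub_xv[OF XYZ] sub_yv[OF XYZ] sub_zv[OF XYZ])
qed

section \<open>The subring of series in \<open>y\<close> and \<open>z\<close>\<close>

lemma K_yz_iff: "h \<in> K_yz \<longleftrightarrow> (\<forall>i j k. i \<noteq> 0 \<longrightarrow> ps_coeff h i j k = 0)"
  by (auto simp: K_yz_def)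

lemma K_yz_0 [simp]: "0 \<in> K_yz" and K_yz_1 [simp]: "(1::'a::comm_ring_1 ps3) \<in> K_yz"
  and K_yz_const [simp]: "ps_const c \<in> K_yz"
  and K_yz_yv [simp]: "(yv::'a ps3) \<in> K_yz" and K_yz_zv [simp]: "(zv::'a ps3) \<in> K_yz"
  and K_yz_add: "f \<in> K_yz \<Longrightarrow> g \<in> K_yz \<Longrightarrow> f + g \<in> (K_yz :: 'a ps3 set)"
  and K_yz_diff: "f \<in> K_yz \<Longrightarrow> g \<in> K_yz \<Longrightarrow> f - g \<in> (K_yz :: 'a ps3 set)"
  and K_yz_minus: "f \<in> K_yz \<Longrightarrow> - f \<in> (K_yz :: 'a ps3 set)"
  by (simp_all add: K_yz_iff ps_coeff_1 ps_coeff_const ps_coeff_yv ps_coeff_zv)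

lemma K_yz_mult: "f \<in> K_yz \<Longrightarrow> g \<in> K_yz \<Longrightarrow> f * g \<in> (K_yz :: 'a::comm_ring_1 ps3 set)"
  unfolding K_yz_iff ps_coeff_mult
proof (intro allI impI sum.neutral ballI)
  fix i j k :: nat and s
  assume f: "\<forall>i j k. i \<noteq> 0 \<longrightarrow> ps_coeff f i j k = 0" and g: "\<forall>i j k. i \<noteq> 0 \<longrightarrow> ps_coeff g i j k = 0"
    and i: "i \<noteq> 0" and "s \<in> {..i} \<times> {..j} \<times> {..k}"
  obtain i' j' k' where s: "s = (i', j', k')" by (cases s) auto
  show "(case s of (i', j', k') \<Rightarrow> ps_coeff f i' j' k' * ps_coeff g (i - i') (j - j') (k - k')) = 0"
    using f g i by (cases "i' = 0") (simp_all add: s)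
qed

lemma K_yz_power: "f \<in> K_yz \<Longrightarrow> f ^ n \<in> (K_yz :: 'a::comm_ring_1 ps3 set)"
  by (induction n) (simp_all add: K_yz_mult)

subsection \<open>Restriction to the plane \<open>x + z = 0\<close>\<close>

text \<open>The substitution of \<open>- z\<close> for \<open>x\<close>, written out in
  coefficients: a ring homomorphism onto \<open>K_yz\<close> whose kernel is generated by
  \<open>x + z\<close>.\<close>

definition rho :: "'a::comm_ring_1 ps3 \<Rightarrow> 'a ps3" where
  "rho h = ps_make (\<lambda>i j k. if i = 0 then \<Sum>c\<le>k. (-1) ^ c * ps_coeff h c j (k - c) else 0)"

text \<open>The alternating sum is the expansion of \<open>1/(x + z)\<close> into terms
  \<open>z^c x^(-1-c)\<close>, applied to \<open>h\<close> with the negative powers of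
  \<open>x\<close> dropped.\<close>

definition lquot :: "'a::comm_ring_1 ps3 \<Rightarrow> 'a ps3" where
  "lquot h = ps_make (\<lambda>i j k. \<Sum>c\<le>k. (-1) ^ c * ps_coeff h (i + 1 + c) j (k - c))"

lemma rho_division: "h = rho h + (xv + zv) * lquot h"
proof (rule ps_eqI)
  fix i j k
  have shift: "ps_coeff (lquot h) i j (k - 1) =
      ps_coeff h i j k - (\<Sum>c\<le>k. (-1) ^ c * ps_coeff h (i + c) j (k - c))" if "k > 0" for i
  proof -
    obtain m where k: "k = Suc m" using \<open>k > 0\<close> by (cases k) auto
    have "(\<Sum>c\<le>k. (-1) ^ c * ps_coeff h (i + c) j (k - c)) =
        ps_coeff h i j k + (\<Sum>c\<le>m. - ((-1) ^ c * ps_coeff h (i + 1 + c) j (m - c)))"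
      unfolding k by (subst sum.atMost_Suc_shift) simp
    thus ?thesis by (simp add: lquot_def k sum_negf)
  qed
  show "ps_coeff h i j k = ps_coeff (rho h + (xv + zv) * lquot h) i j k"
  proof (cases i)
    case 0
    thus ?thesis using shift[of 0] by (cases "k = 0") (simp_all add: distrib_right rho_def)
  next
    case (Suc a)
    thus ?thesis using shift[of "Suc a"]
      by (cases "k = 0") (simp_all add: distrib_right rho_def lquot_def)
  qed
qed

lemma rho_Mpow: "h \<in> Mpow n \<Longrightarrow> rho h \<in> Mpow n"
  by (auto simp: Mpow_def rho_def intro!: sum.neutral)

lemma lquot_Mpow: "h \<in> Mpow n \<Longrightarrow> lquot h \<in> Mpow (n - 1)"
  by (auto simp: Mpow_def lquot_def intro!: sum.neutral)

lemma rho_K_yz: "rho h \<in> K_yz"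
  by (simp add: K_yz_iff rho_def)

lemma rho_id: "h \<in> K_yz \<Longrightarrow> rho h = h"
proof (rule ps_eqI)
  fix i j k assume h: "h \<in> K_yz"
  have "(\<Sum>c\<le>k. (-1) ^ c * ps_coeff h c j (k - c)) = (\<Sum>c\<le>k. if c = 0 then ps_coeff h 0 j k else 0)"
    using h by (intro sum.cong) (auto simp: K_yz_iff)
  thus "ps_coeff (rho h) i j k = ps_coeff h i j k"
    using h by (simp add: rho_def K_yz_iff)
qed

lemma rho_add: "rho (f + g) = rho f + rho g"
  by (rule ps_eqI) (simp add: rho_def distrib_left sum.distrib)

lemma rho_scale: "rho (ps_const c * f) = ps_const c * rho f"
  by (rule ps_eqI) (simp add: rho_def sum_distrib_left mult.left_commute)

lemma rho_minus: "rho (- f) = - rho f"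
  by (rule ps_eqI) (simp add: rho_def sum_negf)

lemma rho_diff: "rho (f - g) = rho f - rho g"
  using rho_add[of f "- g"] by (simp add: rho_minus)

text \<open>The coefficients of a product with \<open>x + z\<close> at positive powers of
  \<open>x\<close> relate each coefficient of \<open>q\<close> to one with a smaller exponent of
  \<open>z\<close>. This is uniqueness of the division by \<open>x + z\<close>, from which
  \<open>rho\<close> is seen to be multiplicative.\<close>

lemma l_mult_K_yz: "(xv + zv) * q \<in> K_yz \<Longrightarrow> q = 0"
proof (rule ps_eqI)
  fix i j k assume *: "(xv + zv) * q \<in> K_yz"
  show "ps_coeff q i j k = ps_coeff 0 i j k"
  proof (induction k arbitrary: i)
    case 0
    show ?case using *[unfolded K_yz_iff, rule_format, of "Suc i" j 0] by (simp add: distrib_right)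
  next
    case (Suc k)
    show ?case using *[unfolded K_yz_iff, rule_format, of "Suc i" j "Suc k"] Suc[of "Suc i"]
      by (simp add: distrib_right)
  qed
qed

lemma rho_l_mult: "rho ((xv + zv) * h) = 0"
proof -
  let ?w = "(xv + zv) * h"
  have *: "(xv + zv) * (h - lquot ?w) = rho ?w"
    using rho_division[of ?w] by (simp add: algebra_simps)
  hence "h - lquot ?w = 0" using rho_K_yz[of ?w] by (intro l_mult_K_yz) simp
  with * show ?thesis by simp
qed

lemma rho_mult: "rho (f * g) = rho f * rho g"
proof -
  have "f * g = (rho f + (xv + zv) * lquot f) * g"
    by (rule arg_cong[where f = "\<lambda>u. u * g", OF rho_division])
  also have "\<dots> = rho f * g + (xv + zv) * (lquot f * g)"
    by (simp only: distrib_right mult.assoc)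
  also have "rho f * g = rho f * (rho g + (xv + zv) * lquot g)"
    by (rule arg_cong[where f = "\<lambda>u. rho f * u", OF rho_division])
  finally have "f * g = rho f * rho g + (xv + zv) * (rho f * lquot g + lquot f * g)"
    by (simp only: algebra_simps)
  hence "rho (f * g) = rho (rho f * rho g)" by (metis rho_add rho_l_mult add.right_neutral)
  thus ?thesis by (simp add: rho_id K_yz_mult rho_K_yz)
qed

subsection \<open>Ideals\<close>

definition is_ideal :: "'r::comm_ring_1 set \<Rightarrow> bool" where
  "is_ideal J \<longleftrightarrow> module.subspace (*) J"

lemma is_ideal_iff: "is_ideal J \<longleftrightarrow> 0 \<in> J \<and> (\<forall>a\<in>J. \<forall>b\<in>J. a + b \<in> J) \<and> (\<forall>c. \<forall>a\<in>J. c * a \<in> J)"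
  by (simp add: is_ideal_def module.subspace_def[OF module_ring_mult])

lemma ideal_0: "is_ideal J \<Longrightarrow> 0 \<in> J"
  and ideal_add: "is_ideal J \<Longrightarrow> a \<in> J \<Longrightarrow> b \<in> J \<Longrightarrow> a + b \<in> J"
  and ideal_multL: "is_ideal J \<Longrightarrow> a \<in> J \<Longrightarrow> c * a \<in> J"
  by (auto simp: is_ideal_iff)

lemma ideal_multR: "is_ideal J \<Longrightarrow> a \<in> J \<Longrightarrow> a * c \<in> J"
  using ideal_multL[of J a c] by (simp add: mult.commute)

lemma ideal_minus: "is_ideal J \<Longrightarrow> a \<in> J \<Longrightarrow> - a \<in> J"
  using ideal_multL[of J a "- 1"] by simp

lemma ideal_gen_ideal: "is_ideal (ideal_gen S)"
  by (simp add: is_ideal_def ideal_gen_def module.subspace_span[OF module_ring_mult])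

lemma ideal_gen_superset: "a \<in> S \<Longrightarrow> a \<in> ideal_gen S"
  by (simp add: ideal_gen_def module.span_base[OF module_ring_mult])

lemma ideal_gen_minimal: "is_ideal J \<Longrightarrow> S \<subseteq> J \<Longrightarrow> ideal_gen S \<subseteq> J"
  by (simp add: is_ideal_def ideal_gen_def module.span_minimal[OF module_ring_mult])

lemma ideal_gen_singleton: "ideal_gen {f} = {a * f |a. True}"
  by (auto simp: ideal_gen_def module.span_singleton[OF module_ring_mult])

lemma ideal_gen_pair: "ideal_gen {f, g} = {a * f + b * g |a b. True}"
proof
  have "is_ideal {a * f + b * g |a b. True}"
    unfolding is_ideal_iff
  proof (safe, goal_cases)
    case 1 show ?case by (intro exI[of _ 0]) simp
  next
    case (2 _ _ a a' b b')
    show ?case by (rule exI[of _ "a + a'"], rule exI[of _ "b + b'"]) (simp add: algebra_simps)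
  next
    case (3 c _ a b)
    show ?case by (rule exI[of _ "c * a"], rule exI[of _ "c * b"]) (simp add: algebra_simps)
  qed
  moreover have "f = 1 * f + 0 * g" "g = 0 * f + 1 * g" by simp_all
  ultimately show "ideal_gen {f, g} \<subseteq> {a * f + b * g |a b. True}"
    by (intro ideal_gen_minimal) blast+
  show "{a * f + b * g |a b. True} \<subseteq> ideal_gen {f, g}"
    by (auto intro!: ideal_add[OF ideal_gen_ideal] ideal_multL[OF ideal_gen_ideal] intro: ideal_gen_superset)
qed

lemma is_ideal_Mpow: "is_ideal (Mpow n)"
  by (simp add: is_ideal_iff Mpow_add Mpow_multL)

lemma max_ideal_eq: "max_ideal = Mpow 1"
proof
  show "max_ideal \<subseteq> (Mpow 1 :: 'a::comm_ring_1 ps3 set)"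
    unfolding max_ideal_def
    by (intro ideal_gen_minimal is_ideal_Mpow) (simp add: xv_Mpow yv_Mpow zv_Mpow flip: One_nat_def)
  show "Mpow 1 \<subseteq> (max_ideal :: 'a ps3 set)"
  proof
    fix h :: "'a ps3" assume "h \<in> Mpow 1"
    then obtain a b c where h: "h = xv * a + yv * b + zv * c"
      using Mpow_Suc_decomp[of h 0] by auto
    have "xv \<in> max_ideal" "yv \<in> max_ideal" "zv \<in> (max_ideal :: 'a ps3 set)"
      by (simp_all add: max_ideal_def ideal_gen_superset)
    thus "h \<in> max_ideal" unfolding max_ideal_def h
      by (intro ideal_add[OF ideal_gen_ideal] ideal_multR[OF ideal_gen_ideal])
  qed
qed

lemma ideal_power_max_ideal: "ideal_power max_ideal n = Mpow n"
proof (induction n)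
  case 0 show ?case by auto
next
  case (Suc n)
  let ?S = "{a * b |a b. a \<in> Mpow 1 \<and> b \<in> Mpow n} :: 'a ps3 set"
  have "ideal_gen ?S = Mpow (Suc n)"
  proof
    show "ideal_gen ?S \<subseteq> Mpow (Suc n)"
      using Mpow_mult[of _ 1 _ n] by (intro ideal_gen_minimal is_ideal_Mpow) auto
    show "Mpow (Suc n) \<subseteq> ideal_gen ?S"
    proof
      fix h :: "'a ps3" assume "h \<in> Mpow (Suc n)"
      then obtain a b c where "a \<in> Mpow n" "b \<in> Mpow n" "c \<in> Mpow n" "h = xv * a + yv * b + zv * c"
        by (rule Mpow_Suc_decomp)
      moreover have "xv * a \<in> ?S" "yv * b \<in> ?S" "zv * c \<in> ?S"
        using calculation xv_Mpow yv_Mpow zv_Mpow by blast+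
      ultimately show "h \<in> ideal_gen ?S"
        by (simp add: ideal_add[OF ideal_gen_ideal] ideal_gen_superset)
    qed
  qed
  with Suc show ?case by (simp add: max_ideal_eq)
qed

subsection \<open>Dimensions of quotients\<close>

definition K_subspace :: "'a::comm_ring_1 ps3 set \<Rightarrow> bool" where
  "K_subspace W \<longleftrightarrow> 0 \<in> W \<and> (\<forall>a\<in>W. \<forall>b\<in>W. a + b \<in> W) \<and> (\<forall>c. \<forall>a\<in>W. ps_const c * a \<in> W)"

lemma K_subspace_0: "K_subspace W \<Longrightarrow> 0 \<in> W"
  and K_subspace_add: "K_subspace W \<Longrightarrow> a \<in> W \<Longrightarrow> b \<in> W \<Longrightarrow> a + b \<in> W"
  and K_subspace_scale: "K_subspace W \<Longrightarrow> a \<in> W \<Longrightarrow> ps_const c * a \<in> W"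
  by (auto simp: K_subspace_def)

lemma K_subspace_minus: "K_subspace W \<Longrightarrow> a \<in> W \<Longrightarrow> - a \<in> W"
  using K_subspace_scale[of W a "- 1"] by (simp add: ps_const_minus)

lemma K_subspace_diff: "K_subspace W \<Longrightarrow> a \<in> W \<Longrightarrow> b \<in> W \<Longrightarrow> a - b \<in> W"
  using K_subspace_add[of W a "- b"] K_subspace_minus[of W b] by simp

lemma K_subspace_sum: "K_subspace W \<Longrightarrow> (\<And>a. a \<in> A \<Longrightarrow> f a \<in> W) \<Longrightarrow> sum f A \<in> W"
  by (induction A rule: infinite_finite_induct) (auto simp: K_subspace_0 K_subspace_add)

lemma is_ideal_K_subspace: "is_ideal J \<Longrightarrow> K_subspace J"
  by (simp add: K_subspace_def is_ideal_iff)

definition lcomb :: "nat \<Rightarrow> (nat \<Rightarrow> 'a::comm_ring_1) \<Rightarrow> (nat \<Rightarrow> 'a ps3) \<Rightarrow> 'a ps3" where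
  "lcomb n c b = (\<Sum>i<n. ps_const (c i) * b i)"

lemma lcomb_mem: "K_subspace W \<Longrightarrow> (\<And>i. i < n \<Longrightarrow> b i \<in> W) \<Longrightarrow> lcomb n c b \<in> W"
  by (auto simp: lcomb_def intro!: K_subspace_sum K_subspace_scale)

lemma lcomb_diff: "lcomb n (\<lambda>i. c i - d i) b = lcomb n c b - lcomb n d b"
  by (simp add: lcomb_def ps_const_diff left_diff_distrib sum_subtractf)

lemma lcomb_scale: "lcomb n (\<lambda>i. t * c i) b = ps_const t * lcomb n c b"
  by (simp add: lcomb_def ps_const_mult sum_distrib_left mult.assoc)

lemma lcomb_cong: "(\<And>i. i < n \<Longrightarrow> c i = d i) \<Longrightarrow> (\<And>i. i < n \<Longrightarrow> b i = b' i) \<Longrightarrow> lcomb n c b = lcomb n d b'"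
  by (simp add: lcomb_def)

lemma lcomb_Suc: "lcomb (Suc n) c b = lcomb n c b + ps_const (c n) * b n"
  by (simp add: lcomb_def)

lemma lcomb_append: "lcomb (n + k) c b = lcomb n c b + lcomb k (\<lambda>i. c (n + i)) (\<lambda>i. b (n + i))"
  by (induction k) (simp_all add: lcomb_def add.assoc)

definition spans_mod where
  "spans_mod U W n b \<longleftrightarrow> (\<forall>u\<in>U. \<exists>c. u - lcomb n c b \<in> W)"

definition indep_mod where
  "indep_mod W n b \<longleftrightarrow> (\<forall>c. lcomb n c b \<in> W \<longrightarrow> (\<forall>i<n. c i = 0))"

lemma indep_modD: "indep_mod W n b \<Longrightarrow> lcomb n c b \<in> W \<Longrightarrow> i < n \<Longrightarrow> c i = 0"
  by (simp add: indep_mod_def)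

text \<open>Dimension as a relation, with spanning and independence kept apart so that they can be
  transferred separately; \<open>quotient_dim_eq\<close> turns it into the value of
  \<open>quotient_dim\<close>.\<close>

definition qdim :: "'a::comm_ring_1 ps3 set \<Rightarrow> 'a ps3 set \<Rightarrow> nat \<Rightarrow> bool" where
  "qdim U W n \<longleftrightarrow> (\<exists>b. (\<forall>i<n. b i \<in> U) \<and> spans_mod U W n b \<and> indep_mod W n b)"

lemma is_quotient_basis_iff:
  assumes W: "K_subspace W" and U: "0 \<in> U"
  shows "is_quotient_basis U W n b \<longleftrightarrow> (\<forall>i<n. b i \<in> U) \<and> spans_mod U W n b \<and> indep_mod W n b"
proof (intro iffI conjI)
  assume *: "is_quotient_basis U W n b"
  show "\<forall>i<n. b i \<in> U" using * by (simp add: is_quotient_basis_def)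
  show "spans_mod U W n b" using * by (auto simp: is_quotient_basis_def spans_mod_def lcomb_def)
  show "indep_mod W n b"
    unfolding indep_mod_def
  proof (intro allI impI)
    fix c i assume c: "lcomb n c b \<in> W" and i: "i < n"
    \<comment> \<open>Uniqueness of coordinates is applied to \<open>u = 0\<close>, which has the
      coordinates \<open>0\<close> and also \<open>c'\<close>; the padding by zeros is what
      \<open>is_quotient_basis\<close> asks for.\<close>
    define c' where "c' j = (if j < n then c j else 0)" for j
    have "0 - lcomb n c' b \<in> W"
      using K_subspace_minus[OF W c] lcomb_cong[of n c' c b b] by (simp add: c'_def)
    moreover have "0 - lcomb n (\<lambda>_. 0) b \<in> W" using W by (simp add: lcomb_def K_subspace_0)
    moreover have "\<exists>!c. (\<forall>i\<ge>n. c i = 0) \<and> 0 - lcomb n c b \<in> W"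
      using bspec[OF conjunct2[OF *[unfolded is_quotient_basis_def]] U] by (simp only: lcomb_def)
    ultimately have "c' = (\<lambda>_. 0)" by (auto simp: c'_def)
    with i show "c i = 0" by (metis c'_def)
  qed
next
  assume *: "(\<forall>i<n. b i \<in> U) \<and> spans_mod U W n b \<and> indep_mod W n b"
  have "\<exists>!c. (\<forall>i\<ge>n. c i = 0) \<and> u - lcomb n c b \<in> W" if "u \<in> U" for u
  proof -
    from * that obtain c where c: "u - lcomb n c b \<in> W" by (auto simp: spans_mod_def)
    define c' where "c' j = (if j < n then c j else 0)" for j
    show ?thesis
    proof (rule ex1I[of _ c'])
      show "(\<forall>i\<ge>n. c' i = 0) \<and> u - lcomb n c' b \<in> W"
        using c lcomb_cong[of n c' c b b] by (simp add: c'_def)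
      fix d assume d: "(\<forall>i\<ge>n. d i = 0) \<and> u - lcomb n d b \<in> W"
      have "lcomb n (\<lambda>i. c i - d i) b = (u - lcomb n d b) - (u - lcomb n c b)"
        by (simp add: lcomb_diff)
      also have "\<dots> \<in> W" by (rule K_subspace_diff[OF W conjunct2[OF d] c])
      finally have "\<forall>i<n. c i - d i = 0"
        using * indep_modD[of W n b "\<lambda>i. c i - d i"] by blast
      thus "d = c'" using d by (auto simp: c'_def)
    qed
  qed
  thus "is_quotient_basis U W n b" using * by (simp add: is_quotient_basis_def lcomb_def)
qed

text \<open>Steinitz exchange: if \<open>n' > n\<close>, the coordinate vectors of the
  \<open>b' i\<close> with respect to \<open>b\<close> satisfy a nontrivial linear relation, which
  holds for the \<open>b' i\<close> modulo \<open>W\<close>.\<close>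

lemma indep_le_spans:
  fixes b :: "nat \<Rightarrow> 'a::field ps3"
  assumes W: "K_subspace W" and b': "\<And>i. i < n' \<Longrightarrow> b' i \<in> U" "indep_mod W n' b'"
    and b: "spans_mod U W n b"
  shows "n' \<le> n"
proof (rule ccontr)
  assume "\<not> n' \<le> n"
  have "\<exists>c. b' i - lcomb n c b \<in> W" if "i < n'" for i
    using b b'(1)[OF that] by (auto simp: spans_mod_def)
  then obtain c where c: "\<And>i. i < n' \<Longrightarrow> b' i - lcomb n (c i) b \<in> W" by metis
  from homogeneous_system_nontrivial[of "{..<n'}" n c] \<open>\<not> n' \<le> n\<close> obtain a where
    a: "\<exists>i<n'. a i \<noteq> 0" "\<And>j. j < n \<Longrightarrow> (\<Sum>i<n'. a i * c i j) = 0" by auto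
  have "(\<Sum>i<n'. ps_const (a i) * lcomb n (c i) b) = lcomb n (\<lambda>j. \<Sum>i<n'. a i * c i j) b"
  proof -
    have "(\<Sum>i<n'. ps_const (a i) * lcomb n (c i) b) = (\<Sum>i<n'. \<Sum>j<n. ps_const (a i * c i j) * b j)"
      by (simp add: lcomb_def sum_distrib_left ps_const_mult mult.assoc)
    also have "\<dots> = (\<Sum>j<n. \<Sum>i<n'. ps_const (a i * c i j) * b j)"
      by (rule sum.swap)
    also have "\<dots> = lcomb n (\<lambda>j. \<Sum>i<n'. a i * c i j) b"
      by (simp add: lcomb_def ps_const_sum sum_distrib_right)
    finally show ?thesis .
  qed
  also have "\<dots> = 0" by (simp add: lcomb_def a(2))
  finally have "lcomb n' a b' = (\<Sum>i<n'. ps_const (a i) * (b' i - lcomb n (c i) b))"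
    by (simp add: right_diff_distrib sum_subtractf) (simp add: lcomb_def)
  also have "\<dots> \<in> W" using c by (auto intro!: K_subspace_sum K_subspace_scale W)
  finally have "\<forall>i<n'. a i = 0" using b'(2) by (simp add: indep_mod_def)
  with a(1) show False by auto
qed

lemma qdim_unique:
  fixes U :: "'a::field ps3 set"
  shows "K_subspace W \<Longrightarrow> qdim U W n \<Longrightarrow> qdim U W n' \<Longrightarrow> n = n'"
  unfolding qdim_def by (metis indep_le_spans order_antisym)

lemma quotient_dim_eq:
  fixes U :: "'a::field ps3 set"
  assumes "K_subspace W" "0 \<in> U" "qdim U W n"
  shows "quotient_dim U W = n"
  unfolding quotient_dim_def is_quotient_basis_iff[OF assms(1,2)] qdim_def[symmetric]
  using assms qdim_unique by blast

text \<open>An independent family of maximal length spans, and \<open>indep_le_spans\<close> bounds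
  the possible lengths by \<open>n\<close>.\<close>

lemma qdim_exists:
  fixes U :: "'a::field ps3 set"
  assumes W: "K_subspace W" and b: "spans_mod U W n b"
  shows "\<exists>k. qdim U W k"
proof -
  define P where "P k \<longleftrightarrow> (\<exists>b'. (\<forall>i<k. b' i \<in> U) \<and> indep_mod W k b')" for k
  have bound: "k \<le> n" if "P k" for k
    using that indep_le_spans[OF W _ _ b] by (auto simp: P_def)
  have "P 0" by (simp add: P_def indep_mod_def)
  define k where "k = Greatest P"
  have k: "P k" unfolding k_def using \<open>P 0\<close> bound by (rule GreatestI_nat)
  have nk: "\<not> P (Suc k)"
    using Greatest_le_nat[of P "Suc k" n] bound by (auto simp: k_def)
  from k obtain b' where b': "\<And>i. i < k \<Longrightarrow> b' i \<in> U" "indep_mod W k b'" by (auto simp: P_def)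
  have "spans_mod U W k b'"
    unfolding spans_mod_def
  proof
    fix u assume u: "u \<in> U"
    define b'' where "b'' = b'(k := u)"
    have "\<forall>i<Suc k. b'' i \<in> U" using b'(1) u by (simp add: b''_def)
    with nk have "\<not> indep_mod W (Suc k) b''" by (auto simp: P_def)
    then obtain c i where c: "lcomb (Suc k) c b'' \<in> W" and i: "i < Suc k" "c i \<noteq> 0"
      by (auto simp: indep_mod_def)
    have c': "lcomb k c b' + ps_const (c k) * u \<in> W"
      using c lcomb_cong[of k c c b'' b'] by (simp add: lcomb_Suc b''_def)
    have "c k \<noteq> 0"
    proof
      assume "c k = 0"
      with c' b'(2) have "\<forall>i<k. c i = 0" by (simp add: indep_mod_def)
      with \<open>c k = 0\<close> i show False by (metis less_antisym)
    qed
    have "ps_const (inverse (c k)) * (lcomb k c b' + ps_const (c k) * u) =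
        ps_const (inverse (c k)) * lcomb k c b' + u"
      using \<open>c k \<noteq> 0\<close> by (simp add: distrib_left mult.assoc[symmetric] flip: ps_const_mult)
    also have "\<dots> = u - lcomb k (\<lambda>i. - inverse (c k) * c i) b'"
      unfolding lcomb_scale by (simp add: ps_const_minus)
    finally show "\<exists>c. u - lcomb k c b' \<in> W"
      using K_subspace_scale[OF W c', of "inverse (c k)"] by auto
  qed
  with b' show ?thesis by (auto simp: qdim_def)
qed

text \<open>Additivity in a chain of subspaces; \<open>hilbert_high\<close> uses it to obtain an
  unknown dimension from two known ones.\<close>

lemma qdim_add:
  assumes "K_subspace W" "K_subspace W'" "W \<subseteq> U" "qdim U W n" "qdim W W' k" "W' \<subseteq> W"
  shows "qdim U W' (n + k)"
proof -
  from assms(4,5) obtain b b' where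
    b: "\<And>i. i < n \<Longrightarrow> b i \<in> U" "spans_mod U W n b" "indep_mod W n b" and
    b': "\<And>i. i < k \<Longrightarrow> b' i \<in> W" "spans_mod W W' k b'" "indep_mod W' k b'"
    by (auto simp: qdim_def)
  define b'' where "b'' i = (if i < n then b i else b' (i - n))" for i
  have lc: "lcomb (n + k) c b'' = lcomb n c b + lcomb k (\<lambda>i. c (n + i)) b'" for c
    unfolding lcomb_append by (intro arg_cong2[where f = "(+)"] lcomb_cong) (auto simp: b''_def)
  have "\<forall>i<n + k. b'' i \<in> U"
    using b b' assms(3) by (auto simp: b''_def)
  moreover have "spans_mod U W' (n + k) b''"
    unfolding spans_mod_def
  proof
    fix u assume "u \<in> U"
    then obtain c where "u - lcomb n c b \<in> W" using b by (auto simp: spans_mod_def)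
    then obtain d where d: "u - lcomb n c b - lcomb k d b' \<in> W'" using b' by (auto simp: spans_mod_def)
    define e where "e i = (if i < n then c i else d (i - n))" for i
    have "lcomb (n + k) e b'' = lcomb n c b + lcomb k d b'"
      unfolding lc by (intro arg_cong2[where f = "(+)"] lcomb_cong) (auto simp: e_def)
    with d show "\<exists>c. u - lcomb (n + k) c b'' \<in> W'" by (metis diff_diff_eq)
  qed
  moreover have "indep_mod W' (n + k) b''"
    unfolding indep_mod_def
  proof (intro allI impI)
    fix c i assume c: "lcomb (n + k) c b'' \<in> W'" and i: "i < n + k"
    have m: "lcomb k (\<lambda>i. c (n + i)) b' \<in> W" using assms(1) b'(1) by (rule lcomb_mem)
    have "lcomb n c b = lcomb (n + k) c b'' - lcomb k (\<lambda>i. c (n + i)) b'" by (simp add: lc)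
    also have "\<dots> \<in> W" using assms(1,6) c m by (intro K_subspace_diff) auto
    finally have n: "\<forall>i<n. c i = 0" using b by (simp add: indep_mod_def)
    hence "lcomb n c b = 0" by (simp add: lcomb_def)
    with c have "lcomb k (\<lambda>i. c (n + i)) b' \<in> W'" by (simp add: lc)
    from b'(3)[unfolded indep_mod_def, rule_format, OF this] have "\<forall>i<k. c (n + i) = 0" by blast
    with n i show "c i = 0" by (metis le_add_diff_inverse nat_add_left_cancel_less not_less)
  qed
  ultimately show ?thesis by (auto simp: qdim_def)
qed

text \<open>Functionals with a dual family of vectors: the coordinates of \<open>u\<close> modulo
  the common kernel are the values \<open>r i u\<close>.\<close>

lemma qdim_dual_basis:
  assumes add: "\<And>i f g. i < n \<Longrightarrow> r i (f + g) = r i f + r i g"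
    and scale: "\<And>i c f. i < n \<Longrightarrow> r i (ps_const c * f) = c * (r i f :: 'a::comm_ring_1)"
    and dual: "\<And>i j. i < n \<Longrightarrow> j < n \<Longrightarrow> r i (b j) = (if i = j then 1 else 0)"
    and b: "\<And>i. i < n \<Longrightarrow> b i \<in> U" and U: "K_subspace U"
  shows "qdim U {h \<in> U. \<forall>i<n. r i h = 0} n"
proof -
  have r0: "i < n \<Longrightarrow> r i 0 = 0" for i using add[of i 0 0] by simp
  have r_sum: "i < n \<Longrightarrow> r i (sum f A) = (\<Sum>a\<in>A. r i (f a))" for i and f :: "nat \<Rightarrow> _" and A
    by (induction A rule: infinite_finite_induct) (simp_all add: add r0)
  have r_lc: "r i (lcomb n c b) = c i" if "i < n" for i c
    using that by (simp add: lcomb_def r_sum scale dual if_distrib cong: if_cong)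
  have r_diff: "i < n \<Longrightarrow> r i (f - g) = r i f - r i g" for i f g
    using add[of i "f - g" g] by (simp add: algebra_simps)
  have "spans_mod U {h \<in> U. \<forall>i<n. r i h = 0} n b"
    unfolding spans_mod_def
  proof
    fix u assume "u \<in> U"
    hence "u - lcomb n (\<lambda>i. r i u) b \<in> {h \<in> U. \<forall>i<n. r i h = 0}"
      using U b by (auto simp: r_diff r_lc intro!: K_subspace_diff lcomb_mem)
    thus "\<exists>c. u - lcomb n c b \<in> {h \<in> U. \<forall>i<n. r i h = 0}" by blast
  qed
  moreover have "indep_mod {h \<in> U. \<forall>i<n. r i h = 0} n b"
    by (simp add: indep_mod_def r_lc)
  ultimately show ?thesis using b by (auto simp: qdim_def)
qed

lemma qdim_Mpow: "qdim (Mpow t) (Mpow (Suc t)) (card (degree_triples t))"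
proof -
  obtain e where "bij_betw e {0..<card (degree_triples t)} (degree_triples t)"
    using ex_bij_betw_nat_finite[OF finite_degree_triples] by blast
  hence e: "bij_betw e {..<card (degree_triples t)} (degree_triples t)" by (simp add: atLeast0LessThan)
  let ?N = "card (degree_triples t)"
  define r where "r i h = (case e i of (p, q, s) \<Rightarrow> ps_coeff h p q s)" for i and h :: "'a ps3"
  define b where "b i = (case e i of (p, q, s) \<Rightarrow> xv ^ p * yv ^ q * (zv :: 'a ps3) ^ s)" for i
  have inj: "i < ?N \<Longrightarrow> j < ?N \<Longrightarrow> e i = e j \<longleftrightarrow> i = j" for i j
    using e by (auto simp: bij_betw_def inj_on_def)
  have mem: "i < ?N \<Longrightarrow> e i \<in> degree_triples t" for i
    using e by (auto simp: bij_betw_def)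
  have "qdim (Mpow t) {h \<in> Mpow t. \<forall>i<?N. r i h = 0} ?N"
  proof (rule qdim_dual_basis[of ?N r b])
    fix i j assume "i < ?N" "j < ?N"
    thus "r i (b j) = (if i = j then 1 else 0)"
      using inj[of i j] by (auto simp: r_def b_def ps_coeff_monom split: prod.splits)
  next
    fix i assume "i < ?N"
    from mem[OF this] show "b i \<in> Mpow t"
      using Mpow_mult[OF Mpow_mult[OF Mpow_power1[OF xv_Mpow] Mpow_power1[OF yv_Mpow]] Mpow_power1[OF zv_Mpow]]
      by (auto simp: b_def degree_triples_def split: prod.splits)
  qed (auto simp: r_def is_ideal_K_subspace is_ideal_Mpow split: prod.splits)
  moreover have "{h \<in> Mpow t. \<forall>i<?N. r i h = 0} = Mpow (Suc t)"
  proof -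
    have "(\<forall>i<?N. r i h = 0) \<longleftrightarrow> (\<forall>(p,q,s)\<in>degree_triples t. ps_coeff h p q s = 0)" for h
    proof -
      have "degree_triples t = e ` {..<?N}" using e by (simp add: bij_betw_def)
      hence "(\<forall>(p,q,s)\<in>degree_triples t. ps_coeff h p q s = 0) \<longleftrightarrow>
        (\<forall>i<?N. case e i of (p,q,s) \<Rightarrow> ps_coeff h p q s = 0)"
        by (metis (no_types, lifting) image_iff lessThan_iff)
      thus ?thesis by (simp add: r_def split: prod.splits)
    qed
    thus ?thesis by (auto simp: Mpow_Suc_iff degree_triples_def)
  qed
  ultimately show ?thesis by simp
qed

subsection \<open>The Hilbert function in terms of initial forms\<close>

text \<open>The elements of \<open>\<M>\<^sup>t\<close> whose component of degree \<open>t\<close> lies in \<open>I\<^sup>*\<close>.\<close>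

definition initial_part :: "'a::comm_ring_1 ps3 set \<Rightarrow> nat \<Rightarrow> 'a ps3 set" where
  "initial_part I t = {h \<in> Mpow t. \<exists>k\<in>I. h - k \<in> Mpow (Suc t)}"

lemma K_subspace_initial_part:
  assumes "is_ideal I"
  shows "K_subspace (initial_part I t)"
  unfolding K_subspace_def
proof (intro conjI ballI allI)
  show "0 \<in> initial_part I t" using ideal_0[OF assms] by (auto simp: initial_part_def intro!: bexI[of _ 0])
next
  fix a b assume "a \<in> initial_part I t" "b \<in> initial_part I t"
  then obtain k l where "a \<in> Mpow t" "b \<in> Mpow t" "k \<in> I" "l \<in> I" "a - k \<in> Mpow (Suc t)" "b - l \<in> Mpow (Suc t)"
    by (auto simp: initial_part_def)
  thus "a + b \<in> initial_part I t"
    using Mpow_add[of "a - k" "Suc t" "b - l"] ideal_add[OF assms, of k l]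
    by (auto simp: initial_part_def add_diff_add intro!: Mpow_add bexI[of _ "k + l"])
next
  fix c a assume "a \<in> initial_part I t"
  then obtain k where "a \<in> Mpow t" "k \<in> I" "a - k \<in> Mpow (Suc t)"
    by (auto simp: initial_part_def)
  thus "ps_const c * a \<in> initial_part I t"
    using Mpow_multL[of "a - k" "Suc t" "ps_const c"] ideal_multL[OF assms, of k "ps_const c"]
    by (auto simp: initial_part_def right_diff_distrib intro: Mpow_multL)
qed

lemma Mpow_Suc_subset_initial_part: "is_ideal I \<Longrightarrow> Mpow (Suc t) \<subseteq> initial_part I t"
  using ideal_0 by (force simp: initial_part_def Mpow_Suc_iff)

lemma qdim_initial_part_exists:
  fixes I :: "'a::field ps3 set"
  assumes "is_ideal I"
  shows "\<exists>n. qdim (Mpow t) (initial_part I t) n"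
proof -
  from qdim_Mpow[of t] obtain b :: "nat \<Rightarrow> 'a ps3" where
    "spans_mod (Mpow t) (Mpow (Suc t)) (card (degree_triples t)) b"
    by (auto simp: qdim_def)
  hence "spans_mod (Mpow t) (initial_part I t) (card (degree_triples t)) b"
    using Mpow_Suc_subset_initial_part[OF assms] by (fastforce simp: spans_mod_def)
  with K_subspace_initial_part[OF assms] show ?thesis by (rule qdim_exists)
qed

lemma K_subspace_ideal_sum:
  assumes "is_ideal I" "is_ideal J"
  shows "K_subspace (ideal_sum J I)"
  unfolding K_subspace_def
proof (intro conjI ballI allI)
  show "0 \<in> ideal_sum J I"
    using ideal_0[OF assms(1)] ideal_0[OF assms(2)] by (force simp: ideal_sum_def)
next
  fix a b assume "a \<in> ideal_sum J I" "b \<in> ideal_sum J I"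
  then obtain j k j' k' where "a = j + k" "b = j' + k'" "j \<in> J" "k \<in> I" "j' \<in> J" "k' \<in> I"
    by (auto simp: ideal_sum_def)
  moreover from this have "a + b = (j + j') + (k + k')" by simp
  ultimately show "a + b \<in> ideal_sum J I"
    using ideal_add[OF assms(1)] ideal_add[OF assms(2)] unfolding ideal_sum_def by blast
next
  fix c a assume "a \<in> ideal_sum J I"
  then obtain j k where "a = j + k" "j \<in> J" "k \<in> I"
    by (auto simp: ideal_sum_def)
  moreover from this have "ps_const c * a = ps_const c * j + ps_const c * k" by (simp add: distrib_left)
  ultimately show "ps_const c * a \<in> ideal_sum J I"
    using ideal_multL[OF assms(1)] ideal_multL[OF assms(2)] unfolding ideal_sum_def by blast
qed

text \<open>Second isomorphism theorem: \<open>(M^t + I)/(M^(t+1) + I)\<close> is \<open>M^t\<close>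
  modulo its intersection with \<open>M^(t+1) + I\<close>, and that intersection is
  \<open>initial_part I t\<close>.\<close>

lemma hilbert_fun_eq_iff:
  fixes I :: "'a::field ps3 set"
  assumes I: "is_ideal I"
  shows "hilbert_fun I t = n \<longleftrightarrow> qdim (Mpow t) (initial_part I t) n"
proof -
  have *: "hilbert_fun I t = n" if q: "qdim (Mpow t) (initial_part I t) n" for n
  proof -
    let ?U = "ideal_sum (Mpow t) I" and ?W = "ideal_sum (Mpow (Suc t)) I"
    have sU: "K_subspace ?U" and sW: "K_subspace ?W"
      by (intro K_subspace_ideal_sum I is_ideal_Mpow)+
    have WI: "w \<in> ?W \<longleftrightarrow> w \<in> initial_part I t" if "w \<in> Mpow t" for w
    proof
      assume "w \<in> ?W"
      then obtain j k where "w = j + k" "j \<in> Mpow (Suc t)" "k \<in> I" by (auto simp: ideal_sum_def)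
      thus "w \<in> initial_part I t" using that by (auto simp: initial_part_def intro!: bexI[of _ k])
    next
      assume "w \<in> initial_part I t"
      then obtain k where "k \<in> I" "w - k \<in> Mpow (Suc t)" by (auto simp: initial_part_def)
      moreover have "w = (w - k) + k" by simp
      ultimately show "w \<in> ?W" unfolding ideal_sum_def by blast
    qed
    have IW: "k \<in> ?W" if "k \<in> I" for k
      using that Mpow_zero[of "Suc t"] by (force simp: ideal_sum_def)
    from q obtain b where b: "\<And>i. i < n \<Longrightarrow> b i \<in> Mpow t"
        "spans_mod (Mpow t) (initial_part I t) n b" "indep_mod (initial_part I t) n b"
      by (auto simp: qdim_def)
    have lc: "lcomb n c b \<in> Mpow t" for c
      using b(1) by (intro lcomb_mem is_ideal_K_subspace is_ideal_Mpow)
    have "\<forall>i<n. b i \<in> ?U"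
      using b(1) ideal_0[OF I] by (force simp: ideal_sum_def)
    moreover have "spans_mod ?U ?W n b"
      unfolding spans_mod_def
    proof
      fix u assume "u \<in> ?U"
      then obtain j k where u: "u = j + k" "j \<in> Mpow t" "k \<in> I" by (auto simp: ideal_sum_def)
      then obtain c where c: "j - lcomb n c b \<in> initial_part I t"
        using b(2) by (auto simp: spans_mod_def)
      hence "j - lcomb n c b \<in> ?W" using WI[of "j - lcomb n c b"] u lc by (simp add: Mpow_diff)
      from K_subspace_add[OF sW this IW[OF u(3)]]
      show "\<exists>c. u - lcomb n c b \<in> ?W" by (intro exI[of _ c]) (simp add: u algebra_simps)
    qed
    moreover have "indep_mod ?W n b"
      using b(3) WI[OF lc] by (simp add: indep_mod_def)
    ultimately have "qdim ?U ?W n" by (auto simp: qdim_def)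
    thus ?thesis
      unfolding hilbert_fun_def ideal_power_max_ideal
      by (intro quotient_dim_eq sW K_subspace_0[OF sU])
  qed
  show ?thesis using * qdim_initial_part_exists[OF I, of t] by blast
qed

section \<open>Initial ideals seen inside the ring of series\<close>

lemma Mpow_iff_order: "f \<in> Mpow n \<longleftrightarrow> enat n \<le> ps_order f"
proof -
  have "enat n \<le> ps_order f \<longleftrightarrow> (\<forall>i j k. ps_coeff f i j k \<noteq> 0 \<longrightarrow> enat n \<le> enat (i + j + k))"
    unfolding ps_order_def le_Inf_iff by blast
  thus ?thesis by (simp add: Mpow_def) (metis not_le)
qed

lemma ps_order_eq_iff: "ps_order f = enat n \<longleftrightarrow> f \<in> Mpow n \<and> f \<notin> Mpow (Suc n)"
  unfolding Mpow_iff_order by (cases "ps_order f") auto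

lemma Mpow_exact_ex:
  assumes "f \<noteq> 0"
  obtains n where "f \<in> Mpow n" "f \<notin> Mpow (Suc n)"
proof -
  have "ps_order f \<noteq> \<infinity>"
  proof
    assume "ps_order f = \<infinity>"
    hence "f \<in> Mpow n" for n by (simp add: Mpow_iff_order)
    from Mpow_Inter[OF this] assms show False by simp
  qed
  then obtain n where "ps_order f = enat n" by auto
  thus ?thesis using that by (auto simp: ps_order_eq_iff)
qed

text \<open>The inclusion of \<open>P\<close> into \<open>R\<close>.\<close>

definition emb :: "'a::comm_ring_1 poly3 \<Rightarrow> 'a ps3" where
  "emb u = ps_make (\<lambda>i j k. coeff (coeff (coeff u i) j) k)"

lemma emb_0 [simp]: "emb 0 = 0" and emb_add: "emb (u + v) = emb u + emb v"
  by (rule ps_eqI; simp add: emb_def)+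

lemma emb_sum: "emb (sum f A) = (\<Sum>a\<in>A. emb (f a))"
  by (induction A rule: infinite_finite_induct) (simp_all add: emb_add)

lemma emb_mult: "emb (u * v) = emb u * emb v"
proof (rule ps_eqI)
  fix i j k
  show "ps_coeff (emb (u * v)) i j k = ps_coeff (emb u * emb v) i j k"
    unfolding ps_coeff_mult
    by (simp add: emb_def coeff_mult coeff_sum sum.cartesian_product')
qed

lemma emb_inj: "emb u = emb v \<Longrightarrow> u = v"
proof (intro poly_eqI)
  fix i j k assume "emb u = emb v"
  from arg_cong[OF this, of "\<lambda>f. ps_coeff f i j k"]
  show "coeff (coeff (coeff u i) j) k = coeff (coeff (coeff v i) j) k" by (simp add: emb_def)
qed

lemma emb_poly_monom: "emb (poly_monom c i j k) = ps_const c * (xv ^ i * yv ^ j * zv ^ k)"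
  by (rule ps_eqI) (auto simp: emb_def poly_monom_def ps_coeff_monom)

lemma emb_linear_form: "emb (linear_form a b c) = lin a b c"
  by (simp add: linear_form_def emb_add emb_poly_monom lin_def)

lemma emb_hom_component: "emb (hom_component v f) = hom_eval xv yv zv f v"
  unfolding hom_component_def hom_eval_def degree_triples_def
  by (simp add: emb_sum split_def emb_poly_monom)

lemma hom_eval_id_hom_eval:
  "hom_eval xv yv zv (hom_eval xv yv zv f m) n = (if m = n then hom_eval xv yv zv f n else 0)"
  by (rule ps_eqI) (auto simp: hom_eval_id_coeff)

lemma hom_eval_id_eq_iff:
  "hom_eval xv yv zv f n = hom_eval xv yv zv g n \<longleftrightarrow>
     (\<forall>i j k. i + j + k = n \<longrightarrow> ps_coeff f i j k = ps_coeff g i j k)"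
proof
  assume *: "hom_eval xv yv zv f n = hom_eval xv yv zv g n"
  show "\<forall>i j k. i + j + k = n \<longrightarrow> ps_coeff f i j k = ps_coeff g i j k"
  proof (intro allI impI)
    fix i j k assume "i + j + k = n"
    with arg_cong[OF *, of "\<lambda>f. ps_coeff f i j k"] show "ps_coeff f i j k = ps_coeff g i j k"
      by (simp add: hom_eval_id_coeff)
  qed
qed (auto intro!: ps_eqI simp: hom_eval_id_coeff)

lemma hom_eval_lin_square: "hom_eval xv yv zv ((lin a b c)\<^sup>2) 2 = (lin a b c)\<^sup>2"
proof -
  have *: "hom_eval xv yv zv (lin a b c) m = (if m = 1 then lin a b c else 0)" for m
    by (rule ps_eqI) (auto simp: hom_eval_id_coeff ps_coeff_lin)
  show ?thesis
    by (simp add: power2_eq_square hom_eval_mult * numeral_2_eq_2)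
qed

lemma lin_part_ex:
  assumes "h \<in> Mpow 1"
  obtains a b c where "h - lin a b c \<in> Mpow 2"
proof
  show "h - lin (ps_coeff h 1 0 0) (ps_coeff h 0 1 0) (ps_coeff h 0 0 1) \<in> Mpow 2"
  proof (rule MpowI)
    fix i j k :: nat assume "i + j + k < 2"
    hence "(i, j, k) \<in> {(0,0,0), (1,0,0), (0,1,0), (0,0,1)}" by auto
    thus "ps_coeff (h - lin (ps_coeff h 1 0 0) (ps_coeff h 0 1 0) (ps_coeff h 0 0 1)) i j k = 0"
      using assms by (auto simp: ps_coeff_lin Mpow_1_iff)
  qed
qed

text \<open>An element of the initial ideal is only a combination of initial forms. The polynomials
  all of whose components come from elements of \<open>I\<close> of the right order form an ideal,
  and this ideal contains the generators.\<close>

lemma initial_ideal_component: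
  assumes I: "is_ideal I" and u: "u \<in> initial_ideal I"
  shows "\<exists>k\<in>I \<inter> Mpow v. hom_eval xv yv zv (emb u) v = hom_eval xv yv zv k v"
proof -
  let ?h = "hom_eval xv yv zv"
  define S where "S = {u. \<forall>v. \<exists>k\<in>I \<inter> Mpow v. ?h (emb u) v = ?h k v}"
  have "is_ideal S"
    unfolding is_ideal_iff
  proof (intro conjI ballI allI)
    show "0 \<in> S" using ideal_0[OF I] by (auto simp: S_def intro!: bexI[of _ 0])
  next
    fix a b assume a: "a \<in> S" and b: "b \<in> S"
    show "a + b \<in> S"
      unfolding S_def
    proof safe
      fix v
      from a b obtain k l where "k \<in> I \<inter> Mpow v" "?h (emb a) v = ?h k v"
        "l \<in> I \<inter> Mpow v" "?h (emb b) v = ?h l v" unfolding S_def by blast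
      thus "\<exists>k\<in>I \<inter> Mpow v. ?h (emb (a + b)) v = ?h k v"
        by (intro bexI[of _ "k + l"]) (auto simp: emb_add hom_eval_add Mpow_add ideal_add[OF I])
    qed
  next
    fix c a assume a: "a \<in> S"
    show "c * a \<in> S"
      unfolding S_def
    proof safe
      fix v
      from a have "\<forall>m. \<exists>k. k \<in> I \<inter> Mpow m \<and> ?h (emb a) m = ?h k m"
        unfolding S_def by blast
      from choice[OF this] obtain k where
        k: "\<And>m. k m \<in> I \<inter> Mpow m" "\<And>m. ?h (emb a) m = ?h (k m) m" by blast
      \<comment> \<open>The degree \<open>v\<close> component of \<open>c * a\<close> is a
        convolution of components; those of \<open>a\<close> are replaced by representatives in
        \<open>I\<close>.\<close>
      define K where "K = (\<Sum>m\<le>v. ?h (emb c) m * k (v - m))"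
      have sum: "?h (sum f A) n = (\<Sum>a\<in>A. ?h (f a) n)" for f :: "nat \<Rightarrow> 'a ps3" and A n
        by (rule ps_eqI) (auto simp: hom_eval_id_coeff)
      have "?h K v = (\<Sum>m\<le>v. ?h (emb c) m * ?h (k (v - m)) (v - m))"
        unfolding K_def sum hom_eval_mult hom_eval_id_hom_eval
        by (intro sum.cong refl) (simp add: mult_delta_left)
      also have "\<dots> = ?h (emb (c * a)) v"
        by (simp add: emb_mult hom_eval_mult k(2))
      finally have "?h (emb (c * a)) v = ?h K v" ..
      moreover have "K \<in> I"
        unfolding K_def using k(1)
        by (intro K_subspace_sum is_ideal_K_subspace I ideal_multL[OF I]) auto
      moreover have "K \<in> Mpow v"
        unfolding K_def using k(1) hom_eval_Mpow[OF xv_Mpow yv_Mpow zv_Mpow]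
        by (intro Mpow_sum Mpow_mult'[where n = "v - m" for m]) auto
      ultimately show "\<exists>k\<in>I \<inter> Mpow v. ?h (emb (c * a)) v = ?h k v" by blast
    qed
  qed
  moreover have "initial_form f \<in> S" if f: "f \<in> I" "f \<noteq> 0" for f
  proof -
    obtain w where w: "f \<in> Mpow w" "f \<notin> Mpow (Suc w)" using f(2) by (rule Mpow_exact_ex)
    hence "ps_order f = enat w" by (simp add: ps_order_eq_iff)
    hence e: "?h (emb (initial_form f)) v = (if v = w then ?h f v else 0)" for v
      by (simp add: initial_form_def emb_hom_component hom_eval_id_hom_eval)
    have z: "?h 0 v = 0" for v by (rule ps_eqI) (simp add: hom_eval_id_coeff)
    show ?thesis unfolding S_def
    proof safe
      fix v
      show "\<exists>k\<in>I \<inter> Mpow v. ?h (emb (initial_form f)) v = ?h k v"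
        using f w ideal_0[OF I] e[of v] z[of v]
        by (intro bexI[of _ "if v = w then f else 0"]) auto
    qed
  qed
  ultimately have "initial_ideal I \<subseteq> S"
    unfolding initial_ideal_def by (intro ideal_gen_minimal) auto
  thus ?thesis using u by (auto simp: S_def)
qed

text \<open>The linear form is replaced by a series of order one and the polynomial ideal by
  \<open>I\<close> itself, because automorphisms of \<open>R\<close> respect these but need not send
  linear forms to linear forms.\<close>

lemma contains_square_iff:
  fixes I :: "'a::field ps3 set"
  assumes I: "is_ideal I"
  shows "contains_square_of_linear_form (initial_ideal I) \<longleftrightarrow>
    (\<exists>h k. h \<in> Mpow 1 \<and> h \<notin> Mpow 2 \<and> k \<in> I \<and> k - h\<^sup>2 \<in> Mpow 3)"
proof
  assume "contains_square_of_linear_form (initial_ideal I)"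
  then obtain a b c where abc: "(a, b, c) \<noteq> (0, 0, 0)" and "(linear_form a b c)\<^sup>2 \<in> initial_ideal I"
    by (auto simp: contains_square_of_linear_form_def)
  from initial_ideal_component[OF I this(2), of 2] obtain k where k: "k \<in> I" "k \<in> Mpow 2"
    and "hom_eval xv yv zv ((lin a b c)\<^sup>2) 2 = hom_eval xv yv zv k 2"
    by (auto simp: power2_eq_square emb_mult emb_linear_form)
  hence eq: "ps_coeff k i j m = ps_coeff ((lin a b c)\<^sup>2) i j m" if "i + j + m = 2" for i j m
    using that by (auto simp: hom_eval_id_eq_iff)
  have "(lin a b c)\<^sup>2 \<in> Mpow 2"
    using Mpow_power1[OF lin_Mpow] .
  with k eq have "k - (lin a b c)\<^sup>2 \<in> Mpow 3"
    by (auto simp: numeral_3_eq_3 Mpow_Suc_iff[of _ "Suc (Suc 0)"] numeral_2_eq_2 intro: Mpow_diff)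
  moreover have "lin a b c \<notin> Mpow 2" using abc by (simp add: lin_Mpow2_iff)
  ultimately show "\<exists>h k. h \<in> Mpow 1 \<and> h \<notin> Mpow 2 \<and> k \<in> I \<and> k - h\<^sup>2 \<in> Mpow 3"
    using lin_Mpow k by blast
next
  assume "\<exists>h k. h \<in> Mpow 1 \<and> h \<notin> Mpow 2 \<and> k \<in> I \<and> k - h\<^sup>2 \<in> Mpow 3"
  then obtain h k where h: "h \<in> Mpow 1" "h \<notin> Mpow 2" and k: "k \<in> I" "k - h\<^sup>2 \<in> Mpow 3" by blast
  obtain a b c where abc: "h - lin a b c \<in> Mpow 2" using h(1) by (rule lin_part_ex)
  have "h \<in> Mpow 2" if "lin a b c \<in> Mpow 2" using Mpow_add[OF abc that] by simp
  hence nz: "lin a b c \<notin> Mpow 2" using h by blast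
  have "k - (lin a b c)\<^sup>2 = (k - h\<^sup>2) + (h - lin a b c) * (h + lin a b c)"
    by (simp add: power2_eq_square algebra_simps)
  also have "\<dots> \<in> Mpow 3"
    using Mpow_mult[OF abc Mpow_add[OF h(1) lin_Mpow]] k by (intro Mpow_add) simp_all
  finally have kl: "k - (lin a b c)\<^sup>2 \<in> Mpow 3" .
  have l2: "(lin a b c)\<^sup>2 \<in> Mpow 2" "(lin a b c)\<^sup>2 \<notin> Mpow 3"
  proof -
    show "(lin a b c)\<^sup>2 \<in> Mpow 2" by (rule Mpow_power1[OF lin_Mpow])
    show "(lin a b c)\<^sup>2 \<notin> Mpow 3"
      using Mpow_mult_exact[OF _ lin_Mpow lin_Mpow, of a b c a b c] nz
      by (auto simp: power2_eq_square numeral_3_eq_3 numeral_2_eq_2)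
  qed
  have "k \<in> Mpow 2" using Mpow_add[OF Mpow_mono[OF kl] l2(1)] by simp
  moreover have "k \<notin> Mpow 3" using l2(2) Mpow_diff[of k 3, OF _ kl] by auto
  ultimately have ord: "ps_order k = enat 2" by (simp add: ps_order_eq_iff)
  have "k \<noteq> 0" using \<open>k \<notin> Mpow 3\<close> by auto
  have "hom_eval xv yv zv k 2 = hom_eval xv yv zv ((lin a b c)\<^sup>2) 2"
    unfolding hom_eval_id_eq_iff using MpowD[OF kl] by auto
  hence "emb (initial_form k) = emb ((linear_form a b c)\<^sup>2)"
    by (simp add: initial_form_def ord emb_hom_component hom_eval_lin_square)
       (simp add: power2_eq_square emb_mult emb_linear_form)
  hence "(linear_form a b c)\<^sup>2 = initial_form k" using emb_inj by metis
  hence "(linear_form a b c)\<^sup>2 \<in> initial_ideal I"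
    unfolding initial_ideal_def using \<open>k \<noteq> 0\<close> k by (auto intro: ideal_gen_superset)
  moreover have "(a, b, c) \<noteq> (0, 0, 0)" using nz by auto
  ultimately show "contains_square_of_linear_form (initial_ideal I)"
    unfolding contains_square_of_linear_form_def by blast
qed

subsection \<open>Invariance under automorphisms\<close>

lemma automorphism_ideal_gen:
  assumes "K_algebra_automorphism \<phi>"
  shows "\<phi> ` ideal_gen {f, g} = ideal_gen {\<phi> f, \<phi> g}"
proof -
  from assms have add: "\<phi> (f + g) = \<phi> f + \<phi> g" and mult: "\<phi> (f * g) = \<phi> f * \<phi> g" for f g
    by (auto simp: K_algebra_automorphism_def)
  have surj: "\<exists>w. v = \<phi> w" for v using automorphism_bij[OF assms] by (metis bij_pointE)
  show ?thesis
  proof (intro equalityI subsetI)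
    fix h assume "h \<in> \<phi> ` ideal_gen {f, g}"
    then obtain a b where "h = \<phi> a * \<phi> f + \<phi> b * \<phi> g"
      by (auto simp: ideal_gen_pair add mult)
    thus "h \<in> ideal_gen {\<phi> f, \<phi> g}" unfolding ideal_gen_pair by blast
  next
    fix h assume "h \<in> ideal_gen {\<phi> f, \<phi> g}"
    then obtain a b where "h = a * \<phi> f + b * \<phi> g" by (auto simp: ideal_gen_pair)
    moreover obtain a' b' where "a = \<phi> a'" "b = \<phi> b'" using surj by metis
    ultimately have "h = \<phi> (a' * f + b' * g)" by (simp add: add mult)
    thus "h \<in> \<phi> ` ideal_gen {f, g}" by (auto simp: ideal_gen_pair)
  qed
qed

lemma automorphism_hilbert_fun:
  fixes I :: "'a::field ps3 set"
  assumes \<phi>: "K_algebra_automorphism \<phi>" and I: "is_ideal I" "is_ideal (\<phi> ` I)"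
  shows "hilbert_fun (\<phi> ` I) t = hilbert_fun I t"
proof -
  note e = automorphism_endo[OF \<phi>] and M = automorphism_Mpow_iff[OF \<phi>]
  have inj: "\<phi> u = \<phi> v \<longleftrightarrow> u = v" for u v
    using automorphism_bij[OF \<phi>] by (metis bij_def injD)
  have W: "\<phi> h \<in> initial_part (\<phi> ` I) t \<longleftrightarrow> h \<in> initial_part I t" for h
    by (auto simp: initial_part_def M simp flip: alg_endo_diff[OF e])
  have lc: "\<phi> (lcomb n c b) = lcomb n c (\<lambda>i. \<phi> (b i))" for n c b
    by (simp add: lcomb_def alg_endo_sum[OF e] alg_endo_simps[OF e])
  obtain n where n: "qdim (Mpow t) (initial_part I t) n"
    using qdim_initial_part_exists[OF I(1)] by blast
  then obtain b where b: "\<And>i. i < n \<Longrightarrow> b i \<in> Mpow t"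
      "spans_mod (Mpow t) (initial_part I t) n b" "indep_mod (initial_part I t) n b"
    by (auto simp: qdim_def)
  have "\<forall>i<n. \<phi> (b i) \<in> Mpow t" using b(1) M by blast
  moreover have "spans_mod (Mpow t) (initial_part (\<phi> ` I) t) n (\<lambda>i. \<phi> (b i))"
    unfolding spans_mod_def
  proof
    fix u :: "'a ps3" assume u: "u \<in> Mpow t"
    obtain v where v: "u = \<phi> v" using automorphism_bij[OF \<phi>] by (metis bij_pointE)
    with u M have "v \<in> Mpow t" by blast
    then obtain c where "v - lcomb n c b \<in> initial_part I t" using b(2) by (auto simp: spans_mod_def)
    hence "\<phi> (v - lcomb n c b) \<in> initial_part (\<phi> ` I) t" using W by blast
    thus "\<exists>c. u - lcomb n c (\<lambda>i. \<phi> (b i)) \<in> initial_part (\<phi> ` I) t"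
      by (auto simp: alg_endo_diff[OF e] lc v)
  qed
  moreover have "indep_mod (initial_part (\<phi> ` I) t) n (\<lambda>i. \<phi> (b i))"
    unfolding indep_mod_def
  proof (intro allI impI)
    fix c i assume "lcomb n c (\<lambda>i. \<phi> (b i)) \<in> initial_part (\<phi> ` I) t" and i: "i < n"
    hence "\<phi> (lcomb n c b) \<in> initial_part (\<phi> ` I) t" by (simp only: lc)
    hence "lcomb n c b \<in> initial_part I t" by (rule W[THEN iffD1])
    from indep_modD[OF b(3) this i] show "c i = 0" .
  qed
  ultimately have "qdim (Mpow t) (initial_part (\<phi> ` I) t) n"
    unfolding qdim_def by (intro exI[of _ "\<lambda>i. \<phi> (b i)"] conjI)
  thus ?thesis
    using n hilbert_fun_eq_iff[OF I(1), of t n] hilbert_fun_eq_iff[OF I(2), of t n] by simp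
qed

lemma automorphism_square:
  fixes I :: "'a::field ps3 set"
  assumes \<phi>: "K_algebra_automorphism \<phi>"
    and h: "h \<in> Mpow 1" "h \<notin> Mpow 2" "k \<in> I" "k - h\<^sup>2 \<in> Mpow 3"
  shows "\<exists>h k. h \<in> Mpow 1 \<and> h \<notin> Mpow 2 \<and> k \<in> \<phi> ` I \<and> k - h\<^sup>2 \<in> Mpow 3"
proof (intro exI conjI)
  note e = automorphism_endo[OF \<phi>] and M = automorphism_Mpow_iff[OF \<phi>]
  show "\<phi> h \<in> Mpow 1" "\<phi> h \<notin> Mpow 2" "\<phi> k \<in> \<phi> ` I" using h M by auto
  have "\<phi> (k - h\<^sup>2) \<in> Mpow 3" using h M by blast
  thus "\<phi> k - (\<phi> h)\<^sup>2 \<in> Mpow 3" by (simp add: alg_endo_simps[OF e])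
qed

lemma rho_yv: "rho yv = yv" and rho_zv: "rho zv = zv"
  by (simp_all add: rho_id)

lemma rho_xv: "rho xv = - (zv :: 'a::comm_ring_1 ps3)"
proof -
  have "rho (xv + zv :: 'a ps3) = 0" using rho_l_mult[of 1] by simp
  thus ?thesis by (simp add: rho_add rho_zv eq_neg_iff_add_eq_0)
qed

lemma rho_power: "rho (f ^ n) = rho f ^ n"
  by (induction n) (simp_all add: rho_mult rho_id)

lemma xz_notin_Mpow2: "(xv + zv :: 'a::field ps3) \<notin> Mpow (Suc 1)"
  using lin_Mpow2_iff[of "1::'a" 0 1] by (simp add: lin_def numeral_2_eq_2)

lemma xz_mult_commute: "(xv + zv) * xv = xv * (xv + zv)" "(xv + zv) * yv = yv * (xv + zv)"
  by (simp_all only: mult.commute)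

lemma xz_Mpow: "xv + zv \<in> Mpow 1"
  by (intro Mpow_add xv_Mpow zv_Mpow)

subsection \<open>The Hilbert function of a determinantal ideal\<close>

text \<open>The common kernel of the two coordinates of \<open>(K[x,y,z]/(x(x+z), y(x+z)))\<^sub>t\<close>: restriction to
  the plane \<open>x + z = 0\<close> and the value at the point \<open>(0 : 0 : 1)\<close>.\<close>

definition plane_point_kernel :: "nat \<Rightarrow> 'a::comm_ring_1 ps3 set" where
  "plane_point_kernel t = {h \<in> Mpow t. rho h \<in> Mpow (Suc t) \<and> ps_coeff h 0 0 t = 0}"

lemma K_subspace_plane_point_kernel: "K_subspace (plane_point_kernel t)"
  by (auto simp: K_subspace_def plane_point_kernel_def rho_add rho_scale rho_id
      intro: Mpow_add Mpow_multL)

lemma qdim_plane_point_kernel: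
  assumes t: "t \<ge> 1"
  shows "qdim (Mpow t) (plane_point_kernel t :: 'a::field ps3 set) (t + 2)"
proof -
  define r where "r i h = (if i \<le> t then ps_coeff (rho h) 0 i (t - i) else ps_coeff h 0 0 t)"
    for i and h :: "'a ps3"
  \<comment> \<open>The dual vectors. On the plane \<open>- x z^(t-1)\<close> equals
    \<open>z^t\<close>, but it vanishes at \<open>(0 : 0 : 1)\<close>, as do the monomials with a
    factor \<open>y\<close>; the last vector vanishes on the plane and has the value
    \<open>1\<close> at that point.\<close>
  define b :: "nat \<Rightarrow> 'a ps3" where "b i = (if i = 0 then - (xv * zv ^ (t - 1))
    else if i \<le> t then yv ^ i * zv ^ (t - i) else (xv + zv) * zv ^ (t - 1))" for i
  have zp: "zv * zv ^ (t - 1) = (zv ^ t :: 'a ps3)" using t by (cases t) auto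
  have z: "ps_coeff (zv ^ k :: 'a ps3) i j k' = (if i = 0 \<and> j = 0 \<and> k' = k then 1 else 0)" for k i j k'
    using ps_coeff_monom[of 0 0 k i j k', where ?'a = 'a] by simp
  have yz: "ps_coeff (yv ^ j * zv ^ k :: 'a ps3) i' j' k' = (if i' = 0 \<and> j' = j \<and> k' = k then 1 else 0)" for j k i' j' k'
    using ps_coeff_monom[of 0 j k i' j' k', where ?'a = 'a] by simp
  have rho_b: "rho (b i) = (if i = 0 then zv ^ t else if i \<le> t then yv ^ i * zv ^ (t - i) else 0)" for i
    using zp by (auto simp: b_def rho_minus rho_mult rho_xv rho_yv rho_zv rho_power rho_add)
  have "qdim (Mpow t) {h \<in> Mpow t. \<forall>i<t+2. r i h = 0} (t + 2)"
  proof (rule qdim_dual_basis[of "t + 2" r b])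
    fix i j assume i: "i < t + 2" and j: "j < t + 2"
    show "r i (b j) = (if i = j then 1 else 0)"
    proof (cases "i \<le> t")
      case True
      thus ?thesis using j by (auto simp: r_def rho_b yz z)
    next
      case False
      hence "i = t + 1" using i by simp
      thus ?thesis using j t by (auto simp: r_def b_def yz z distrib_right zp)
    qed
  next
    fix i assume "i < t + 2"
    have "xv * zv ^ (t - 1) \<in> (Mpow t :: 'a ps3 set)" "(xv + zv) * zv ^ (t - 1) \<in> (Mpow t :: 'a ps3 set)"
      using t by (auto intro!: Mpow_mult'[OF _ Mpow_power1[OF zv_Mpow]] xv_Mpow xz_Mpow)
    moreover have "yv ^ i * zv ^ (t - i) \<in> (Mpow t :: 'a ps3 set)"
      by (intro Mpow_mult'[OF Mpow_power1[OF yv_Mpow] Mpow_power1[OF zv_Mpow]]) simp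
    ultimately show "b i \<in> Mpow t" by (simp add: b_def)
  qed (auto simp: r_def rho_add rho_scale is_ideal_K_subspace is_ideal_Mpow)
  moreover have "{h \<in> Mpow t. \<forall>i<t+2. r i h = 0} = (plane_point_kernel t :: 'a ps3 set)"
  proof (rule set_eqI)
    fix h :: "'a ps3"
    show "h \<in> {h \<in> Mpow t. \<forall>i<t+2. r i h = 0} \<longleftrightarrow> h \<in> plane_point_kernel t"
    proof (cases "h \<in> Mpow t")
      case True
      have "(\<forall>i<t+2. r i h = 0) \<longleftrightarrow> (\<forall>i\<le>t. r i h = 0) \<and> r (Suc t) h = 0"
        by (auto simp: numeral_2_eq_2 less_Suc_eq_le le_Suc_eq)
      also have "\<dots> \<longleftrightarrow> (\<forall>i\<le>t. ps_coeff (rho h) 0 i (t - i) = 0) \<and> ps_coeff h 0 0 t = 0"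
        by (simp add: r_def)
      also have "(\<forall>i\<le>t. ps_coeff (rho h) 0 i (t - i) = 0) \<longleftrightarrow> rho h \<in> Mpow (Suc t)"
      proof
        assume *: "\<forall>i\<le>t. ps_coeff (rho h) 0 i (t - i) = 0"
        show "rho h \<in> Mpow (Suc t)"
          unfolding Mpow_Suc_iff
        proof (intro conjI allI impI rho_Mpow True)
          fix i j k assume "i + j + k = t"
          hence "j \<le> t" "t - j = i + k" by auto
          with *[rule_format, of j] show "ps_coeff (rho h) i j k = 0"
            using rho_K_yz[of h] by (cases "i = 0") (auto simp: K_yz_iff)
        qed
      qed (auto intro: MpowD)
      finally show ?thesis using True by (simp add: plane_point_kernel_def)
    qed (simp add: plane_point_kernel_def)
  qed
  ultimately show ?thesis by simp
qed

text \<open>A form vanishing at \<open>(0 : 0 : 1)\<close> lies in the ideal of \<open>x\<close> and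
  \<open>y\<close>. Applied to a quotient by \<open>x + z\<close>, this gives combinations of
  \<open>x(x+z)\<close> and \<open>y(x+z)\<close>.\<close>

lemma xy_decomp:
  assumes "q \<in> Mpow n" "ps_coeff q 0 0 n = 0"
  obtains a b c where "q = xv * a + yv * b + c" "a \<in> Mpow (n - 1)" "b \<in> Mpow (n - 1)" "c \<in> Mpow (Suc n)"
proof
  let ?a = "ps_make (\<lambda>i j k. ps_coeff q (Suc i) j k)"
  let ?b = "ps_make (\<lambda>i j k. if i = 0 then ps_coeff q 0 (Suc j) k else 0)"
  let ?c = "ps_make (\<lambda>i j k. if i = 0 \<and> j = 0 then ps_coeff q 0 0 k else 0)"
  show "q = xv * ?a + yv * ?b + ?c" by (rule ps_eqI) auto
  show "?a \<in> Mpow (n - 1)" "?b \<in> Mpow (n - 1)" using assms(1) by (auto simp: Mpow_def)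
  show "?c \<in> Mpow (Suc n)" using assms by (auto simp: Mpow_def less_Suc_eq)
qed

lemma y_decomp:
  obtains a b where "A = a + yv * b" "\<And>i j k. j \<noteq> 0 \<Longrightarrow> ps_coeff a i j k = 0"
    "\<And>n. A \<in> Mpow n \<Longrightarrow> a \<in> Mpow n \<and> b \<in> Mpow (n - 1)"
proof
  let ?a = "ps_make (\<lambda>i j k. if j = 0 then ps_coeff A i 0 k else 0)"
  let ?b = "ps_make (\<lambda>i j k. ps_coeff A i (Suc j) k)"
  show "A = ?a + yv * ?b" by (rule ps_eqI) auto
  show "?a \<in> Mpow n \<and> ?b \<in> Mpow (n - 1)" if "A \<in> Mpow n" for n
    using that by (auto simp: Mpow_def)
qed auto

section \<open>The standard basis \<open>f\<close>, \<open>g\<close>, \<open>h3\<close>\<close>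

text \<open>Up to sign, \<open>f\<close>, \<open>g\<close>, \<open>h3\<close> are the maximal minors
  of the matrix with rows \<open>(y, -X, -1)\<close> and \<open>(b, -\<Delta>, L)\<close>, the
  coefficients of the two syzygies. The locale fixes lower bounds on orders; that \<open>m\<close>
  is attained enters later, through the order of \<open>rho h3\<close>.\<close>

locale determinantal =
  fixes eps \<Delta> b :: "'a::field ps3" and m :: nat
  assumes m: "m \<ge> 3" and eps: "eps \<in> Mpow 2" and \<Delta>: "\<Delta> \<in> Mpow m" and b: "b \<in> Mpow m"
begin

definition L where "L = xv + zv - eps"
definition X where "X = xv + eps"
definition f where "f = L * X + \<Delta>"
definition g where "g = L * yv + b"
definition h3 where "h3 = yv * \<Delta> - b * X"

lemma syzygy1: "yv * f = X * g + h3"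
  by (simp add: f_def g_def h3_def algebra_simps)

lemma syzygy2: "L * h3 = \<Delta> * g - b * f"
  by (simp add: f_def g_def h3_def algebra_simps)

abbreviation "f' \<equiv> f - (xv + zv) * xv"
abbreviation "g' \<equiv> g - (xv + zv) * yv"

lemma f': "f' \<in> Mpow 3"
proof -
  have "f' = (xv + zv) * eps - eps * xv - eps * eps + \<Delta>"
    by (simp add: f_def L_def X_def algebra_simps)
  also have "\<dots> \<in> Mpow 3"
    by (intro Mpow_add Mpow_diff Mpow_mult'[OF xz_Mpow eps] Mpow_mult'[OF eps xv_Mpow]
        Mpow_mult'[OF eps eps] Mpow_mono[OF \<Delta>]) (use m in simp_all)
  finally show ?thesis .
qed

lemma g': "g' \<in> Mpow 3"
proof -
  have "g' = b - eps * yv" by (simp add: g_def L_def algebra_simps)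
  also have "\<dots> \<in> Mpow 3"
    by (intro Mpow_diff Mpow_mult'[OF eps yv_Mpow] Mpow_mono[OF b]) (use m in simp_all)
  finally show ?thesis .
qed

lemma X_Mpow: "X \<in> Mpow 1"
  unfolding X_def by (intro Mpow_add xv_Mpow Mpow_mono[OF eps]) simp

lemma h3_Mpow: "h3 \<in> Mpow (Suc m)"
  unfolding h3_def
  by (intro Mpow_diff Mpow_mult'[OF yv_Mpow \<Delta>] Mpow_mult'[OF b X_Mpow]) simp_all

lemma rho_f: "rho f \<in> Mpow 3" and rho_g: "rho g \<in> Mpow 3"
  using rho_Mpow[OF f'] rho_Mpow[OF g'] by (simp_all add: rho_diff rho_l_mult)

lemma f_Mpow: "f \<in> Mpow 2" and g_Mpow: "g \<in> Mpow 2"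
proof -
  have "(xv + zv) * xv \<in> (Mpow 2 :: 'a ps3 set)" "(xv + zv) * yv \<in> (Mpow 2 :: 'a ps3 set)"
    by (intro Mpow_mult'[OF xz_Mpow xv_Mpow] Mpow_mult'[OF xz_Mpow yv_Mpow]; simp)+
  from Mpow_add[OF Mpow_mono[OF f'] this(1)] Mpow_add[OF Mpow_mono[OF g'] this(2)]
  show "f \<in> Mpow 2" "g \<in> Mpow 2" by simp_all
qed

lemma h3_in: "h3 \<in> ideal_gen {f, g}"
proof -
  have "h3 = yv * f + (- X) * g" using syzygy1 by simp
  thus ?thesis unfolding ideal_gen_pair by blast
qed

text \<open>\<open>f, g, h3\<close> form a standard basis: the two syzygies of their initial forms lift.\<close>

lemma standard_rep:
  assumes k: "k \<in> ideal_gen {f, g}" "k \<in> Mpow t" and t: "2 \<le> t"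
    and exact: "t \<le> Suc m \<or> rho h3 \<notin> Mpow (m + 2)"
  shows "\<exists>A B C. A \<in> Mpow (t - 2) \<and> B \<in> Mpow (t - 2) \<and> C \<in> Mpow (t - Suc m) \<and> k = A * f + B * g + C * h3"
proof -
  \<comment> \<open>Starting from any representation, the orders of the coefficients are raised by
    one degree at a time. For \<open>n = 2\<close> the subtractions are truncated and all bounds are
    \<open>0\<close>.\<close>
  have "n \<le> t \<longrightarrow> (\<exists>A B C. A \<in> Mpow (n - 2) \<and> B \<in> Mpow (n - 2) \<and> C \<in> Mpow (n - Suc m)
      \<and> k = A * f + B * g + C * h3)" if "2 \<le> n" for n
    using that
  proof (induction n rule: dec_induct)
    case base
    from k obtain A B where "k = A * f + B * g" by (auto simp: ideal_gen_pair)
    thus ?case by (intro impI exI[of _ A] exI[of _ B] exI[of _ 0]) simp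
  next
    case (step n)
    show ?case
    proof
      assume nt: "Suc n \<le> t"
      hence kn: "k \<in> Mpow (Suc n)" using k(2) by (rule Mpow_mono[rotated])
      from step.IH nt obtain A B C where A: "A \<in> Mpow (n - 2)" and B: "B \<in> Mpow (n - 2)"
        and C: "C \<in> Mpow (n - Suc m)" and keq: "k = A * f + B * g + C * h3" by auto
      have "\<exists>A B C. A \<in> Mpow (n - 2) \<and> B \<in> Mpow (n - 2) \<and> C \<in> Mpow (n - m) \<and> k = A * f + B * g + C * h3"
      proof (cases "n \<le> m")
        case True
        with A B C keq show ?thesis by (intro exI[of _ A] exI[of _ B] exI[of _ C]) simp
      next
        case False
        with nt exact have ex: "rho h3 \<notin> Mpow (Suc (Suc m))" by simp
        \<comment> \<open>On the plane \<open>f\<close> and \<open>g\<close> have order at least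
          \<open>3\<close>, so in degree \<open>n\<close> only \<open>C * h3\<close> remains; the
          exact order \<open>m + 1\<close> of \<open>rho h3\<close> then bounds the order of
          \<open>rho C\<close>.\<close>
        have "rho C * rho h3 = rho k - rho A * rho f - rho B * rho g"
          by (simp add: keq rho_add rho_mult)
        also have "\<dots> \<in> Mpow (Suc n)"
          by (intro Mpow_diff rho_Mpow kn Mpow_mult'[OF rho_Mpow[OF A] rho_f]
              Mpow_mult'[OF rho_Mpow[OF B] rho_g]) simp_all
        finally have "rho h3 * rho C \<in> Mpow (Suc m + (n - m))"
          using False by (simp add: mult.commute)
        hence rC: "rho C \<in> Mpow (n - m)" using ex by (rule Mpow_mult_cancel)
        define C1 where "C1 = lquot C"
        have C1: "C1 \<in> Mpow (n - Suc m - 1)" unfolding C1_def by (rule lquot_Mpow[OF C])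
        \<comment> \<open>What is left of \<open>C\<close> is a multiple of
          \<open>x + z = L + eps\<close>. \<open>syzygy2\<close> turns the part with
          \<open>L\<close> into multiples of \<open>f\<close> and \<open>g\<close>, and
          \<open>eps\<close> raises the order.\<close>
        have "C = rho C + (L + eps) * C1"
          using rho_division[of C] by (simp add: C1_def L_def)
        hence "C * h3 = (rho C + (L + eps) * C1) * h3" by simp
        also have "\<dots> = (rho C + eps * C1) * h3 + C1 * (L * h3)" by (simp add: algebra_simps)
        also have "\<dots> = (rho C + eps * C1) * h3 + C1 * \<Delta> * g - C1 * b * f"
          unfolding syzygy2 by (simp add: algebra_simps)
        finally have "k = (A - C1 * b) * f + (B + C1 * \<Delta>) * g + (rho C + eps * C1) * h3"
          unfolding keq by (simp add: algebra_simps)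
        moreover have "A - C1 * b \<in> Mpow (n - 2)" "B + C1 * \<Delta> \<in> Mpow (n - 2)"
          using False by (auto intro!: Mpow_diff Mpow_add A B Mpow_mult'[OF C1 b] Mpow_mult'[OF C1 \<Delta>])
        moreover have "rho C + eps * C1 \<in> Mpow (n - m)"
          by (intro Mpow_add rC Mpow_mult'[OF eps C1]) simp
        ultimately show ?thesis by blast
      qed
      then obtain A B C where A: "A \<in> Mpow (n - 2)" and B: "B \<in> Mpow (n - 2)"
        and C: "C \<in> Mpow (n - m)" and keq: "k = A * f + B * g + C * h3" by blast
      \<comment> \<open>Degree \<open>n\<close> now reads \<open>(x+z)(A x + B y) = 0\<close>. Up to
        higher order \<open>(A, B)\<close> is therefore a multiple of \<open>(y, -x)\<close>, the
        relation between \<open>x\<close> and \<open>y\<close>; the multiplier is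
        \<open>A1\<close>.\<close>
      have "(xv + zv) * (A * xv + B * yv) = k - A * f' - B * g' - C * h3"
        by (simp add: keq algebra_simps)
      also have "\<dots> \<in> Mpow (Suc n)"
        by (intro Mpow_diff kn Mpow_mult'[OF A f'] Mpow_mult'[OF B g'] Mpow_mult'[OF C h3_Mpow]) simp_all
      finally have AB: "A * xv + B * yv \<in> Mpow n"
        using Mpow_mult_cancel[OF _ xz_notin_Mpow2, of "A * xv + B * yv" n] by simp
      obtain A0 A1 where A01: "A = A0 + yv * A1" "\<And>i j k. j \<noteq> 0 \<Longrightarrow> ps_coeff A0 i j k = 0"
        and "\<And>p. A \<in> Mpow p \<Longrightarrow> A0 \<in> Mpow p \<and> A1 \<in> Mpow (p - 1)" by (rule y_decomp) blast
      with A have A1: "A1 \<in> Mpow (n - 2 - 1)" by blast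
      have co: "ps_coeff (A * xv + B * yv) i j k =
          ps_coeff (xv * A0) i j k + ps_coeff (yv * (A1 * xv + B)) i j k" for i j k
      proof -
        have "A * xv + B * yv = xv * A0 + yv * (A1 * xv + B)" by (simp add: A01 algebra_simps)
        thus ?thesis by (simp only: ps_coeff_add)
      qed
      have A0: "A0 \<in> Mpow (n - 1)"
      proof (rule MpowI)
        fix i j k assume ijk: "i + j + k < n - 1"
        show "ps_coeff A0 i j k = 0"
        proof (cases "j = 0")
          case True
          have "ps_coeff (A * xv + B * yv) (Suc i) 0 k = 0" using AB ijk by (intro MpowD) auto
          thus ?thesis unfolding co using True by simp
        qed (simp add: A01)
      qed
      have B1: "A1 * xv + B \<in> Mpow (n - 1)"
      proof (rule MpowI)
        fix i j k assume ijk: "i + j + k < n - 1"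
        have "ps_coeff (A * xv + B * yv) i (Suc j) k = 0" using AB ijk by (intro MpowD) auto
        moreover have "ps_coeff (xv * A0) i (Suc j) k = 0" by (simp add: A01(2))
        ultimately show "ps_coeff (A1 * xv + B) i j k = 0" unfolding co by simp
      qed
      \<comment> \<open>\<open>syzygy1\<close> removes the multiple of \<open>(y, -x)\<close> at the
        price of adding \<open>A1\<close> to the coefficient of \<open>h3\<close>.\<close>
      have "k = A0 * f + A1 * (yv * f) + B * g + C * h3" by (simp add: keq A01 algebra_simps)
      also have "\<dots> = A0 * f + (A1 * X + B) * g + (C + A1) * h3"
        unfolding syzygy1 by (simp add: algebra_simps)
      finally have "k = A0 * f + (A1 * X + B) * g + (C + A1) * h3" .
      moreover have "A1 * X + B \<in> Mpow (n - 1)"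
      proof -
        have "A1 * X + B = (A1 * xv + B) + A1 * eps" by (simp add: X_def algebra_simps)
        also have "\<dots> \<in> Mpow (n - 1)"
          by (intro Mpow_add B1 Mpow_mult'[OF A1 eps]) simp
        finally show ?thesis .
      qed
      \<comment> \<open>\<open>A1\<close> has order at least \<open>n - 3\<close>, and
        \<open>m \<ge> 3\<close> makes this sufficient.\<close>
      moreover have "C + A1 \<in> Mpow (n - m)"
        by (intro Mpow_add C Mpow_mono[OF A1]) (use m in simp)
      moreover have "Suc n - 2 = n - 1" "Suc n - Suc m = n - m" by simp_all
      ultimately show "\<exists>A B C. A \<in> Mpow (Suc n - 2) \<and> B \<in> Mpow (Suc n - 2) \<and> C \<in> Mpow (Suc n - Suc m)
          \<and> k = A * f + B * g + C * h3" using A0 by metis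
    qed
  qed
  from this[of t] t show ?thesis by simp
qed

abbreviation "I \<equiv> ideal_gen {f, g}"

lemma I_Mpow2: "k \<in> I \<Longrightarrow> k \<in> Mpow 2"
  using f_Mpow g_Mpow by (auto simp: ideal_gen_pair intro!: Mpow_add Mpow_multL)

text \<open>The initial forms \<open>x(x+z)\<close> and \<open>y(x+z)\<close> vanish at
  \<open>(0 : 0 : 1)\<close>; in \<open>rho_rep\<close> the reason is that they vanish on the
  plane.\<close>

lemma coeff_00_rep:
  assumes "A \<in> Mpow (t - 2)" "B \<in> Mpow (t - 2)"
  shows "ps_coeff (A * f + B * g) 0 0 t = 0"
proof -
  have "A * f + B * g = xv * (A * (xv + zv)) + yv * (B * (xv + zv)) + (A * f' + B * g')"
    by (simp add: algebra_simps)
  moreover have "A * f' + B * g' \<in> Mpow (Suc t)"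
    by (intro Mpow_add Mpow_mult'[OF assms(1) f'] Mpow_mult'[OF assms(2) g']) simp_all
  ultimately show ?thesis using MpowD[of "A * f' + B * g'" "Suc t" 0 0 t] by simp
qed

lemma rho_rep:
  assumes "A \<in> Mpow (t - 2)" "B \<in> Mpow (t - 2)"
  shows "rho (A * f + B * g) \<in> Mpow (Suc t)"
  unfolding rho_add rho_mult
  by (intro Mpow_add Mpow_mult'[OF rho_Mpow[OF assms(1)] rho_f] Mpow_mult'[OF rho_Mpow[OF assms(2)] rho_g]) simp_all

text \<open>A form vanishing on the plane is \<open>(x + z) q\<close>. As \<open>x + z\<close> is
  nonzero at \<open>(0 : 0 : 1)\<close>, vanishing there puts \<open>q\<close> into the ideal of
  \<open>x\<close> and \<open>y\<close>, and the form becomes a combination of the initial forms of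
  \<open>f\<close> and \<open>g\<close>.\<close>

lemma plane_point_kernel_subset:
  assumes t: "t \<ge> 1"
  shows "plane_point_kernel t \<subseteq> initial_part I t"
proof
  fix h :: "'a ps3" assume "h \<in> plane_point_kernel t"
  hence h: "h \<in> Mpow t" "rho h \<in> Mpow (Suc t)" "ps_coeff h 0 0 t = 0"
    by (auto simp: plane_point_kernel_def)
  obtain n where n: "t = Suc n" using t by (cases t) auto
  have q: "lquot h \<in> Mpow n" using lquot_Mpow[OF h(1)] by (simp add: n)
  have "ps_coeff (rho h) 0 0 t = 0" using h(2) by (auto intro: MpowD)
  hence "ps_coeff (lquot h) 0 0 n = 0"
    using arg_cong[OF rho_division[of h], of "\<lambda>u. ps_coeff u 0 0 t"] h(3) by (simp add: distrib_right n)
  then obtain a c d where acd: "lquot h = xv * a + yv * c + d" "a \<in> Mpow (n - 1)" "c \<in> Mpow (n - 1)"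
      "d \<in> Mpow (Suc n)" using q xy_decomp by blast
  have "h - (a * f + c * g) = rho h + (xv + zv) * lquot h - (a * f + c * g)"
    using rho_division[of h] by simp
  also have "\<dots> = rho h + (xv + zv) * d - (a * f' + c * g')"
    by (simp add: acd algebra_simps)
  also have "\<dots> \<in> Mpow (Suc t)"
    by (intro Mpow_diff Mpow_add h(2) Mpow_mult'[OF xz_Mpow acd(4)] Mpow_mult'[OF acd(2) f']
        Mpow_mult'[OF acd(3) g']) (simp_all add: n)
  finally show "h \<in> initial_part I t"
    using h(1) unfolding initial_part_def ideal_gen_pair by blast
qed

lemma initial_partE:
  assumes "h \<in> initial_part I t"
  obtains k where "h \<in> Mpow t" "k \<in> I" "k \<in> Mpow t" "h - k \<in> Mpow (Suc t)"
proof -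
  from assms obtain k where k: "h \<in> Mpow t" "k \<in> I" "h - k \<in> Mpow (Suc t)" by (auto simp: initial_part_def)
  have "k \<in> Mpow t" using Mpow_diff[OF k(1) Mpow_mono[OF k(3), of t]] by simp
  with k that show ?thesis by blast
qed

lemma initial_part_eq:
  assumes t: "1 \<le> t" "t \<le> m"
  shows "initial_part I t = plane_point_kernel t"
proof (intro equalityI plane_point_kernel_subset t subsetI)
  fix h assume "h \<in> initial_part I t"
  then obtain k where k: "h \<in> Mpow t" "k \<in> I" "k \<in> Mpow t" "h - k \<in> Mpow (Suc t)" by (rule initial_partE)
  have "rho k \<in> Mpow (Suc t) \<and> ps_coeff k 0 0 t = 0"
  \<comment> \<open>\<open>standard_rep\<close> starts in degree \<open>2\<close>; in degree
    \<open>1\<close> the ideal has no leading components at all.\<close>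
  proof (cases "t = 1")
    case True
    with I_Mpow2[OF k(2)] show ?thesis
      using rho_Mpow[of k 2] MpowD[of k 2 0 0 1] by (simp add: numeral_2_eq_2)
  next
    case False
    with t standard_rep[OF k(2,3)] obtain A B C where
      A: "A \<in> Mpow (t - 2)" "B \<in> Mpow (t - 2)" and keq: "k = A * f + B * g + C * h3" by auto
    have "C * h3 \<in> Mpow (Suc t)" using t by (intro Mpow_multL Mpow_mono[OF h3_Mpow]) simp
    thus ?thesis
      using rho_rep[OF A] coeff_00_rep[OF A] MpowD[of "C * h3" "Suc t" 0 0 t]
      by (simp add: keq rho_add[of "A * f + B * g"] Mpow_add rho_Mpow)
  qed
  moreover have "h = k + (h - k)" by simp
  ultimately show "h \<in> plane_point_kernel t"
    unfolding plane_point_kernel_def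
    using k(1) Mpow_add[OF _ rho_Mpow[OF k(4)], of "rho k"] MpowD[OF k(4), of 0 0 t]
    by (simp add: rho_diff)
qed

lemma coeff_00_h3:
  assumes "C \<in> Mpow n"
  shows "ps_coeff (C * h3) 0 0 (n + Suc m) = 0"
proof -
  have "C * h3 = yv * (C * \<Delta>) + xv * (- C * b) + (- (C * b) * eps)"
    by (simp add: h3_def X_def algebra_simps)
  moreover have "- (C * b) * eps \<in> Mpow (n + m + 2)"
    by (intro Mpow_mult Mpow_minus assms b eps)
  ultimately show ?thesis using MpowD[of "- (C * b) * eps" "n + m + 2" 0 0 "n + Suc m"] by simp
qed

lemma hilbert_low:
  assumes t: "1 \<le> t" "t \<le> m"
  shows "hilbert_fun I t = t + 2"
  using qdim_plane_point_kernel[of t] t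
  by (simp add: hilbert_fun_eq_iff ideal_gen_ideal initial_part_eq)

lemma hilbert_0: "hilbert_fun I 0 = 1"
proof -
  have "initial_part I 0 = Mpow (Suc 0)"
  proof (intro equalityI Mpow_Suc_subset_initial_part ideal_gen_ideal subsetI)
    fix h assume "h \<in> initial_part I 0"
    then obtain k where k: "k \<in> I" "h - k \<in> Mpow (Suc 0)" by (rule initial_partE)
    from Mpow_add[OF k(2) Mpow_mono[OF I_Mpow2[OF k(1)]]] show "h \<in> Mpow (Suc 0)" by simp
  qed
  moreover have "card (degree_triples 0) = 1" by (simp add: degree_triples_def)
  ultimately show ?thesis
    using qdim_Mpow[of 0, where ?'a = 'a] by (simp add: hilbert_fun_eq_iff ideal_gen_ideal)
qed

text \<open>Modulo \<open>plane_point_kernel\<close>, the initial part in degree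
  \<open>t > m\<close> has as basis \<open>h3\<close> times the monomials of degree
  \<open>t - m - 1\<close> in \<open>y\<close> and \<open>z\<close>. These are \<open>t - m\<close>
  elements, and \<open>t + 2 - (t - m) = m + 2\<close>.\<close>

lemma hilbert_high:
  assumes exact: "rho h3 \<notin> Mpow (m + 2)" and t: "m \<le> t"
  shows "hilbert_fun I t = m + 2"
proof (cases "t = m")
  case True
  with hilbert_low[of m] m show ?thesis by simp
next
  case False
  define n where "n = t - Suc m"
  have tn: "t = n + Suc m" using False t by (simp add: n_def)
  have t1: "t \<ge> 1" using tn by simp
  have ex: "rho h3 \<notin> Mpow (Suc (Suc m))" using exact by simp
  define mon where "mon i = yv ^ i * (zv :: 'a ps3) ^ (n - i)" for i
  define bb where "bb i = h3 * mon i" for i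
  have lc: "lcomb (Suc n) c bb = h3 * lcomb (Suc n) c mon" for c
    by (simp add: lcomb_def bb_def sum_distrib_left mult_ac del: sum.lessThan_Suc)
  have monK: "lcomb (Suc n) c mon \<in> K_yz" for c
    by (intro lcomb_mem) (simp_all add: K_subspace_def K_yz_add K_yz_mult K_yz_power mon_def)
  have monM: "lcomb (Suc n) c mon \<in> Mpow n" for c
    by (intro lcomb_mem is_ideal_K_subspace is_ideal_Mpow)
       (auto simp: mon_def intro!: Mpow_mult'[OF Mpow_power1[OF yv_Mpow] Mpow_power1[OF zv_Mpow]])
  have co: "ps_coeff (lcomb (Suc n) c mon) 0 j (n - j) = c j" if "j \<le> n" for c j
  proof -
    have "ps_coeff (mon i) 0 j (n - j) = (if i = j then 1 else 0)" if "i < Suc n" for i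
      using ps_coeff_monom[of 0 i "n - i" 0 j "n - j", where ?'a = 'a] that \<open>j \<le> n\<close>
      by (auto simp: mon_def)
    hence "ps_coeff (lcomb (Suc n) c mon) 0 j (n - j) = (\<Sum>i<Suc n. if i = j then c j else 0)"
      unfolding lcomb_def ps_coeff_sum by (intro sum.cong refl) auto
    thus ?thesis using that by (subst (asm) sum.delta) auto
  qed
  have q: "qdim (initial_part I t) (plane_point_kernel t) (Suc n)"
    unfolding qdim_def
  proof (intro exI[of _ bb] conjI)
    show "\<forall>i<Suc n. bb i \<in> initial_part I t"
    proof (intro allI impI)
      fix i assume "i < Suc n"
      hence mi: "mon i \<in> Mpow n"
        unfolding mon_def by (intro Mpow_mult'[OF Mpow_power1[OF yv_Mpow] Mpow_power1[OF zv_Mpow]]) simp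
      have "bb i \<in> Mpow t" unfolding bb_def by (rule Mpow_mult'[OF h3_Mpow mi]) (simp add: tn)
      moreover have "bb i \<in> I" unfolding bb_def by (intro ideal_multR ideal_gen_ideal h3_in)
      ultimately show "bb i \<in> initial_part I t" unfolding initial_part_def by (auto intro!: bexI[of _ "bb i"])
    qed
    show "spans_mod (initial_part I t) (plane_point_kernel t) (Suc n) bb"
      unfolding spans_mod_def
    proof
      fix u assume "u \<in> initial_part I t"
      then obtain k where k: "u \<in> Mpow t" "k \<in> I" "k \<in> Mpow t" "u - k \<in> Mpow (Suc t)" by (rule initial_partE)
      have "2 \<le> t" using tn m by simp
      from standard_rep[OF k(2,3) this disjI2[OF exact]] obtain A B C where
        A: "A \<in> Mpow (t - 2)" "B \<in> Mpow (t - 2)" and C: "C \<in> Mpow (t - Suc m)"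
        and keq: "k = A * f + B * g + C * h3" by blast
      have C: "C \<in> Mpow n" using C by (simp add: n_def)
      \<comment> \<open>The degree \<open>n\<close> component of \<open>rho C\<close>. Replacing
        \<open>C\<close> by \<open>w\<close> changes \<open>C * h3\<close> by something that
        vanishes in degree \<open>t\<close> on the plane and, by \<open>coeff_00_h3\<close>, at the
        point.\<close>
      define w where "w = lcomb (Suc n) (\<lambda>j. ps_coeff (rho C) 0 j (n - j)) mon"
      have w: "w \<in> Mpow n" "w \<in> K_yz" unfolding w_def by (rule monM monK)+
      have Cw: "rho C - w \<in> Mpow (Suc n)"
        unfolding Mpow_Suc_iff
      proof (intro conjI allI impI Mpow_diff rho_Mpow C w)
        fix i j k assume ijk: "i + j + k = n"
        show "ps_coeff (rho C - w) i j k = 0"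
        proof (cases "i = 0")
          case True
          hence "k = n - j" "j \<le> n" using ijk by auto
          thus ?thesis using True by (simp add: w_def co)
        next
          case False
          thus ?thesis using rho_K_yz[of C] w(2) by (simp add: K_yz_iff)
        qed
      qed
      have hw: "h3 * w \<in> Mpow t" using Mpow_mult[OF h3_Mpow w(1)] by (simp add: tn add.commute)
      have "rho (u - h3 * w) = rho (u - k) + rho (A * f + B * g) + rho h3 * (rho C - w)"
        by (simp add: keq rho_diff rho_add rho_mult rho_id[OF w(2)] algebra_simps)
      also have "\<dots> \<in> Mpow (Suc t)"
        using Mpow_mult[OF rho_Mpow[OF h3_Mpow] Cw]
        by (intro Mpow_add rho_Mpow k(4) rho_rep A) (simp add: tn add.commute)
      finally have 1: "rho (u - h3 * w) \<in> Mpow (Suc t)" .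
      have "u - h3 * w = (u - k) + (A * f + B * g) + (C - w) * h3" by (simp add: keq algebra_simps)
      moreover have "ps_coeff (u - k) 0 0 t = 0" using k(4) by (rule MpowD) simp
      ultimately have 2: "ps_coeff (u - h3 * w) 0 0 t = 0"
        using coeff_00_rep[OF A] coeff_00_h3[OF Mpow_diff[OF C w(1)]]
        by (simp only: ps_coeff_add tn[symmetric]) simp
      from 1 2 show "\<exists>c. u - lcomb (Suc n) c bb \<in> plane_point_kernel t"
        unfolding lc plane_point_kernel_def w_def
        using Mpow_diff[OF k(1) hw] by (auto simp: w_def)
    qed
    show "indep_mod (plane_point_kernel t) (Suc n) bb"
      unfolding indep_mod_def
    proof (intro allI impI)
      fix c i assume "lcomb (Suc n) c bb \<in> plane_point_kernel t" and i: "i < Suc n"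
      hence "rho h3 * lcomb (Suc n) c mon \<in> Mpow (Suc m + Suc n)"
        by (simp add: plane_point_kernel_def lc rho_mult rho_id[OF monK] tn add.commute)
      hence "lcomb (Suc n) c mon \<in> Mpow (Suc n)" using ex by (rule Mpow_mult_cancel)
      from MpowD[OF this, of 0 i "n - i"] i show "c i = 0" by (simp add: co)
    qed
  qed
  obtain N where N: "qdim (Mpow t) (initial_part I t) N"
    using qdim_initial_part_exists[OF ideal_gen_ideal] by blast
  have "initial_part I t \<subseteq> Mpow t" by (auto simp: initial_part_def)
  from qdim_add[OF K_subspace_initial_part[OF ideal_gen_ideal] K_subspace_plane_point_kernel
      this N q plane_point_kernel_subset[OF t1]]
  have "qdim (Mpow t) (plane_point_kernel t :: 'a ps3 set) (N + Suc n)" .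
  hence "N + Suc n = t + 2"
    using qdim_unique[OF K_subspace_plane_point_kernel _ qdim_plane_point_kernel[OF t1]] by blast
  hence "N = m + 2" using tn by simp
  with N show ?thesis by (simp add: hilbert_fun_eq_iff ideal_gen_ideal)
qed

end

subsection \<open>Normalisation of the generators\<close>

definition xfree :: "'a::comm_ring_1 ps3 \<Rightarrow> 'a ps3" where
  "xfree h = ps_make (\<lambda>i j k. if i = 0 then ps_coeff h 0 j k else 0)"

definition xquot :: "'a::comm_ring_1 ps3 \<Rightarrow> 'a ps3" where
  "xquot h = ps_make (\<lambda>i j k. ps_coeff h (Suc i) j k)"

lemma xfree_xquot: "h = xfree h + xv * xquot h"
  by (rule ps_eqI) (simp add: xfree_def xquot_def)

lemma xfree_Mpow: "h \<in> Mpow n \<Longrightarrow> xfree h \<in> Mpow n"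
  and xquot_Mpow: "h \<in> Mpow n \<Longrightarrow> xquot h \<in> Mpow (n - 1)"
  and xfree_K_yz: "xfree h \<in> K_yz"
  by (auto simp: Mpow_def xfree_def xquot_def K_yz_iff)

lemma xquot_add: "xquot (f + g) = xquot f + xquot g"
  by (rule ps_eqI) (simp add: xquot_def)

lemma lquot_add: "lquot (f + g) = lquot f + lquot g"
  by (rule ps_eqI) (simp add: lquot_def distrib_left sum.distrib)

text \<open>Division by \<open>x(x+z)\<close> is explicit; the higher terms of \<open>f\<close> only perturb it by an
  operator that raises orders.\<close>

lemma weierstrass_division:
  fixes f :: "'a::comm_ring_1 ps3"
  assumes f: "f - (xv + zv) * xv \<in> Mpow 3" and h: "h \<in> Mpow n"
  obtains q a c where "h = q * f + a + xv * c" "a \<in> K_yz" "c \<in> K_yz" "a \<in> Mpow n" "c \<in> Mpow (n - 1)"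
proof -
  \<comment> \<open>\<open>Q\<close> is the quotient by \<open>x(x+z)\<close>: drop the terms free
    of \<open>x\<close>, divide by \<open>x\<close>, then by \<open>x + z\<close>. \<open>E\<close>
    is the error made by using \<open>f\<close> as divisor instead.\<close>
  define Q where "Q u = lquot (xquot u)" for u :: "'a ps3"
  define E where "E u = Q u * ((xv + zv) * xv - f)" for u
  have Q: "Q u \<in> Mpow (k - 1 - 1)" if "u \<in> Mpow k" for u k
    unfolding Q_def by (intro lquot_Mpow xquot_Mpow that)
  have f': "(xv + zv) * xv - f \<in> Mpow 3" using Mpow_minus[OF f] by simp
  have raise: "E u \<in> Mpow (Suc k)" if "u \<in> Mpow k" for u k
    unfolding E_def by (intro Mpow_mult'[OF Q[OF that] f']) simp
  have "E (u + v) = E u + E v" for u v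
    by (simp add: E_def Q_def xquot_add lquot_add algebra_simps)
  then obtain u where u: "u - E u = h" using geometric_ex[of E h] raise by blast
  have "k \<le> n \<Longrightarrow> u \<in> Mpow k" for k
  proof (induction k)
    case (Suc k)
    hence "E u + h \<in> Mpow (Suc k)" by (intro Mpow_add raise Mpow_mono[OF h]) simp_all
    thus ?case using u by (simp add: algebra_simps)
  qed simp
  hence un: "u \<in> Mpow n" by simp
  have "u = xfree u + xv * (rho (xquot u) + (xv + zv) * Q u)"
    unfolding Q_def using xfree_xquot[of u] rho_division[of "xquot u"] by simp
  hence "h = xfree u + xv * (rho (xquot u) + (xv + zv) * Q u) - Q u * ((xv + zv) * xv - f)"
    using u by (simp add: E_def)
  hence "h = Q u * f + xfree u + xv * rho (xquot u)"
    by (simp add: algebra_simps)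
  thus ?thesis
    using that xfree_K_yz rho_K_yz xfree_Mpow[OF un] rho_Mpow[OF xquot_Mpow[OF un]] by blast
qed

lemma ideal_gen_pair_eqI:
  assumes "f = a * f' + b * g'" "g = c * f' + d * g'" "f' = a' * f + b' * g" "g' = c' * f + d' * g"
  shows "ideal_gen {f, g} = ideal_gen {f', g'}"
proof
  show "ideal_gen {f, g} \<subseteq> ideal_gen {f', g'}"
    by (intro ideal_gen_minimal ideal_gen_ideal) (use assms(1,2) in \<open>auto simp: ideal_gen_pair\<close>)
  show "ideal_gen {f', g'} \<subseteq> ideal_gen {f, g}"
    by (intro ideal_gen_minimal ideal_gen_ideal) (use assms(3,4) in \<open>auto simp: ideal_gen_pair\<close>)
qed

lemma sub_K_yz:
  assumes "Y \<in> K_yz" "Z \<in> K_yz" "h \<in> K_yz"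
  shows "sub X Y Z h \<in> K_yz"
proof -
  have "hom_eval X Y Z h n \<in> K_yz" for n
    unfolding hom_eval_def
  proof (rule K_subspace_sum)
    show "K_subspace (K_yz :: 'a ps3 set)" by (simp add: K_subspace_def K_yz_add K_yz_mult)
    fix s assume "s \<in> degree_triples n"
    obtain i j k where s: "s = (i, j, k)" by (cases s) auto
    show "(case s of (i, j, k) \<Rightarrow> ps_const (ps_coeff h i j k) * (X ^ i * Y ^ j * Z ^ k)) \<in> K_yz"
      using assms by (cases "i = 0") (auto simp: s K_yz_mult K_yz_power K_yz_iff[of h])
  qed
  thus ?thesis by (simp add: K_yz_iff sub_def psum_def)
qed

text \<open>The identity on the associated graded ring. It is recorded because the values of leading
  components at a point must survive the second normalisation.\<close>

definition near_id :: "('a::comm_ring_1 ps3 \<Rightarrow> 'a ps3) \<Rightarrow> bool" where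
  "near_id \<phi> \<longleftrightarrow> (\<forall>n. \<forall>h\<in>Mpow n. \<phi> h - h \<in> Mpow (Suc n))"

lemma near_idD: "near_id \<phi> \<Longrightarrow> h \<in> Mpow n \<Longrightarrow> \<phi> h - h \<in> Mpow (Suc n)"
  by (simp add: near_id_def)

text \<open>Dividing \<open>x^2\<close> and \<open>g\<close> by \<open>f\<close> gives generators
  \<open>x^2 - x c - a\<close> and \<open>x c' + a'\<close> with \<open>a, c, a', c'\<close> free of
  \<open>x\<close>. Since \<open>- c\<close> and \<open>c'\<close> agree with \<open>z\<close> and
  \<open>y\<close> to first order, they can be taken as new variables.\<close>

lemma normalisation:
  fixes f g :: "'a::field ps3"
  assumes f: "f - (xv + zv) * xv \<in> Mpow 3" and g: "g - (xv + zv) * yv \<in> Mpow 3"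
  obtains \<phi> F q where "K_algebra_automorphism \<phi>" "near_id \<phi>"
    "F \<in> K_yz" "F \<in> Mpow 3" "q \<in> K_yz" "q - yv * zv \<in> Mpow 3"
    "\<phi> ` ideal_gen {f, g} = ideal_gen {xv\<^sup>2 + xv * zv + F, xv * yv + q}"
proof -
  have part: "\<exists>q a c. h = q * f + a + xv * c \<and> a \<in> K_yz \<and> c \<in> K_yz \<and> c \<in> Mpow 1 \<and> a \<in> Mpow 2 \<and>
      h - ps_const (ps_coeff q 0 0 0) * ((xv + zv) * xv) - a - xv * c \<in> Mpow 3"
    if h: "h \<in> Mpow 2" for h
  proof -
    obtain q a c where *: "h = q * f + a + xv * c" "a \<in> K_yz" "c \<in> K_yz" "a \<in> Mpow 2" "c \<in> Mpow (2 - 1)"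
      using weierstrass_division[OF f h] by blast
    define q' where "q' = q - ps_const (ps_coeff q 0 0 0)"
    have q': "q' \<in> Mpow 1" by (simp add: q'_def Mpow_1_iff ps_coeff_const)
    have "h - ps_const (ps_coeff q 0 0 0) * ((xv + zv) * xv) - a - xv * c =
        q' * ((xv + zv) * xv) + q * (f - (xv + zv) * xv)"
      by (simp add: * q'_def algebra_simps)
    also have "\<dots> \<in> Mpow 3"
      by (intro Mpow_add Mpow_multL f Mpow_mult'[OF q' Mpow_mult[OF xz_Mpow xv_Mpow]]) simp
    finally show ?thesis using *
      by (intro exI[of _ q] exI[of _ a] exI[of _ c] conjI) simp_all
  qed
  have "xv * xv \<in> (Mpow 2 :: 'a ps3 set)" using Mpow_mult[OF xv_Mpow xv_Mpow] by (simp add: numeral_2_eq_2)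
  from part[OF this] obtain Q a c where 1: "xv * xv = Q * f + a + xv * c" and K1: "a \<in> K_yz" "c \<in> K_yz"
    and c: "c \<in> Mpow 1" and a2: "a \<in> Mpow 2"
    and e1: "xv * xv - ps_const (ps_coeff Q 0 0 0) * ((xv + zv) * xv) - a - xv * c \<in> Mpow 3" by blast
  have "(xv + zv) * yv \<in> (Mpow 2 :: 'a ps3 set)" using Mpow_mult[OF xz_Mpow yv_Mpow] by (simp add: numeral_2_eq_2)
  from Mpow_add[OF Mpow_mono[OF g] this] have "g \<in> Mpow 2" by simp
  from part[OF this] obtain Q' a' c' where 2: "g = Q' * f + a' + xv * c'" and K2: "a' \<in> K_yz" "c' \<in> K_yz"
    and c': "c' \<in> Mpow 1" and a2': "a' \<in> Mpow 2"
    and "g - ps_const (ps_coeff Q' 0 0 0) * ((xv + zv) * xv) - a' - xv * c' \<in> Mpow 3" by blast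
  from Mpow_diff[OF this(6) g]
  have e2: "(xv + zv) * yv - ps_const (ps_coeff Q' 0 0 0) * ((xv + zv) * xv) - a' - xv * c' \<in> Mpow 3"
    by (simp add: algebra_simps)
  note coeffs = ps_coeff_xv ps_coeff_yv ps_coeff_zv xz_mult_commute
  have K0: "ps_coeff c (Suc 0) 0 0 = 0" "ps_coeff a (Suc (Suc 0)) 0 0 = 0" "ps_coeff c' (Suc 0) 0 0 = 0"
    "ps_coeff a' (Suc (Suc 0)) 0 0 = 0"
    "ps_coeff a (Suc 0) i j = 0" "ps_coeff a' (Suc 0) i j = 0" for i j
    using K1 K2 by (simp_all add: K_yz_iff)
  \<comment> \<open>As \<open>a, c, a', c'\<close> contain no \<open>x\<close>, the coefficients of
    \<open>x^2\<close> give the constant terms of the quotients, and those of \<open>xy\<close> and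
    \<open>xz\<close> give the linear parts of \<open>c\<close> and \<open>c'\<close>.\<close>
  have Q: "ps_coeff Q 0 0 0 = 1" using MpowD[OF e1, of 2 0 0] by (simp add: coeffs numeral_2_eq_2 K0)
  have Q': "ps_coeff Q' 0 0 0 = 0" using MpowD[OF e2, of 2 0 0] by (simp add: coeffs numeral_2_eq_2 K0)
  have a: "a \<in> Mpow 3"
  proof (rule MpowI)
    fix i j k :: nat assume "i + j + k < 3"
    with MpowD[OF e1, of 0 j k] K1 show "ps_coeff a i j k = 0"
      by (cases "i = 0") (simp_all add: coeffs K_yz_iff)
  qed
  have a': "a' - yv * zv \<in> Mpow 3"
  proof (rule MpowI)
    fix i j k :: nat assume "i + j + k < 3"
    with MpowD[OF e2, of 0 j k] K2 show "ps_coeff (a' - yv * zv) i j k = 0"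
      by (cases "i = 0") (auto simp: coeffs K_yz_iff)
  qed
  have lin1: "h \<in> Mpow 2" if "h \<in> Mpow 1" "h \<in> K_yz" "ps_coeff h 0 1 0 = 0" "ps_coeff h 0 0 1 = 0" for h :: "'a ps3"
  proof (rule MpowI)
    fix i j k :: nat assume "i + j + k < 2"
    hence "(i, j, k) \<in> {(0,0,0), (1,0,0), (0,1,0), (0,0,1)}" by auto
    thus "ps_coeff h i j k = 0" using that by (auto simp: Mpow_1_iff K_yz_iff)
  qed
  have cz: "- c - zv \<in> Mpow 2"
  proof (rule lin1)
    show "- c - zv \<in> Mpow 1" by (intro Mpow_diff Mpow_minus c zv_Mpow)
    show "- c - zv \<in> K_yz" by (intro K_yz_diff K_yz_minus K1 K_yz_zv)
    show "ps_coeff (- c - zv) 0 1 0 = 0" "ps_coeff (- c - zv) 0 0 1 = 0"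
      using MpowD[OF e1, of 1 1 0] MpowD[OF e1, of 1 0 1] Q
      by (simp_all add: coeffs K0 minus_equation_iff[of "ps_coeff c 0 0 (Suc 0)"])
  qed
  have cy: "c' - yv \<in> Mpow 2"
  proof (rule lin1)
    show "c' - yv \<in> Mpow 1" by (intro Mpow_diff c' yv_Mpow)
    show "c' - yv \<in> K_yz" by (intro K_yz_diff K2 K_yz_yv)
    show "ps_coeff (c' - yv) 0 1 0 = 0" "ps_coeff (c' - yv) 0 0 1 = 0"
      using MpowD[OF e2, of 1 1 0] MpowD[OF e2, of 1 0 1] Q' by (simp_all add: coeffs K0)
  qed
  define \<psi> where "\<psi> = sub xv c' (- c)"
  note M = xv_Mpow c' Mpow_minus[OF c]
  have \<psi>: "alg_endo \<psi>" unfolding \<psi>_def by (rule alg_endo_sub[OF M])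
  have v: "\<psi> xv = xv" "\<psi> yv = c'" "\<psi> zv = - c"
    unfolding \<psi>_def by (simp_all only: sub_xv[OF M] sub_yv[OF M] sub_zv[OF M])
  have near: "h \<in> Mpow n \<Longrightarrow> \<psi> h - h \<in> Mpow (Suc n)" for n h
    using cz cy by (intro alg_endo_near_id \<psi>) (simp_all add: v)
  have bij: "bij \<psi>" using alg_endo_near_id_bij[OF \<psi> near] by blast
  have aut\<psi>: "K_algebra_automorphism \<psi>" by (rule alg_endo_automorphism[OF \<psi> bij])
  define \<phi> where "\<phi> = inv \<psi>"
  have aut: "K_algebra_automorphism \<phi>" unfolding \<phi>_def by (rule automorphism_inv[OF aut\<psi>])
  note e = automorphism_endo[OF aut]
  have \<phi>\<psi>: "\<phi> (\<psi> h) = h" and \<psi>\<phi>: "\<psi> (\<phi> h) = h" for h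
    using bij by (simp_all add: \<phi>_def bij_def surj_f_inv_f)
  have \<phi>v: "\<phi> xv = xv" "\<phi> c' = yv" "\<phi> c = - zv"
    using \<phi>\<psi>[of xv] \<phi>\<psi>[of yv] \<phi>\<psi>[of zv] by (simp_all add: v alg_endo_minus[OF e] minus_equation_iff)
  have near\<phi>: "near_id \<phi>"
    unfolding near_id_def
  proof (intro allI ballI)
    fix n and h :: "'a ps3" assume "h \<in> Mpow n"
    hence "\<phi> h \<in> Mpow n" by (rule alg_endo_Mpow[OF e])
    from Mpow_minus[OF near[OF this]] show "\<phi> h - h \<in> Mpow (Suc n)" by (simp add: \<psi>\<phi>)
  qed
  \<comment> \<open>\<open>\<psi>\<close> preserves \<open>K_yz\<close> by its construction. For its
    inverse, the part of \<open>\<phi> h\<close> divisible by \<open>x\<close> is sent by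
    \<open>\<psi>\<close> to a multiple of \<open>x\<close> in \<open>K_yz\<close>, which is
    zero.\<close>
  have K: "\<phi> h \<in> K_yz" if h: "h \<in> K_yz" for h
  proof -
    define u where "u = \<phi> h"
    have "\<psi> u = \<psi> (xfree u) + xv * \<psi> (xquot u)"
      using arg_cong[OF xfree_xquot[of u], of \<psi>] by (simp add: alg_endo_simps[OF \<psi>] v)
    moreover have 2: "\<psi> (xfree u) \<in> K_yz"
      unfolding \<psi>_def by (intro sub_K_yz K2 K_yz_minus K1 xfree_K_yz)
    moreover have "\<psi> u = h" by (simp add: u_def \<psi>\<phi>)
    ultimately have "xv * \<psi> (xquot u) \<in> K_yz" using K_yz_diff[OF h 2] by simp
    hence "\<psi> (xquot u) = 0"
      unfolding K_yz_iff by (intro ps_eqI) (force dest: spec[of _ "Suc _"])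
    hence "xquot u = 0" using \<phi>\<psi>[of "xquot u"] by (simp add: alg_endo_0[OF e])
    hence "u = xfree u" using xfree_xquot[of u] by simp
    thus ?thesis using xfree_K_yz[of u] by (simp add: u_def)
  qed
  obtain w where w: "Q * w = 1" using ps_unit_ex[of Q] Q by auto
  have f1: "xv * xv - xv * c - a = Q * f" using 1 by (simp add: algebra_simps)
  have "ideal_gen {f, g} = ideal_gen {xv * xv - xv * c - a, xv * c' + a'}"
  proof (rule ideal_gen_pair_eqI)
    show "f = w * (xv * xv - xv * c - a) + 0 * (xv * c' + a')"
      unfolding f1 using w by (simp add: mult.left_commute flip: mult.assoc)
    show "g = (Q' * w) * (xv * xv - xv * c - a) + 1 * (xv * c' + a')"
    proof -
      have "(Q' * w) * (Q * f) = Q' * f * (Q * w)" by (simp only: mult_ac)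
      thus ?thesis unfolding f1 using w 2 by simp
    qed
    show "xv * xv - xv * c - a = Q * f + 0 * g" by (simp add: f1)
    show "xv * c' + a' = (- Q') * f + 1 * g" by (simp add: 2)
  qed
  hence "\<phi> ` ideal_gen {f, g} = ideal_gen {\<phi> (xv * xv - xv * c - a), \<phi> (xv * c' + a')}"
    by (simp add: automorphism_ideal_gen[OF aut])
  also have "\<phi> (xv * xv - xv * c - a) = xv\<^sup>2 + xv * zv + (- \<phi> a)"
    by (simp add: alg_endo_simps[OF e] \<phi>v power2_eq_square)
  also have "\<phi> (xv * c' + a') = xv * yv + \<phi> a'"
    by (simp add: alg_endo_simps[OF e] \<phi>v)
  finally have "\<phi> ` ideal_gen {f, g} = ideal_gen {xv\<^sup>2 + xv * zv + (- \<phi> a), xv * yv + \<phi> a'}" .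
  moreover have "- \<phi> a \<in> K_yz" "\<phi> a' \<in> K_yz" by (intro K_yz_minus K K1 K2)+
  moreover have "- \<phi> a \<in> Mpow 3" by (intro Mpow_minus alg_endo_Mpow[OF e] a)
  moreover have "\<phi> a' - yv * zv \<in> Mpow 3"
  proof -
    have "\<phi> a' - a' \<in> Mpow 3" using near_idD[OF near\<phi> a2'] by simp
    from Mpow_add[OF this a'] show ?thesis by simp
  qed
  ultimately show ?thesis using that aut near\<phi> by blast
qed

subsection \<open>Units of the subrings\<close>

text \<open>\<open>P\<close> describes a face of the exponent monoid: a sum lies in it only if both
  summands do. Hence an inverse cut down to the face is still an inverse, which treats all three
  subrings at once.\<close>

lemma face_inverse:
  fixes P :: "nat \<Rightarrow> nat \<Rightarrow> nat \<Rightarrow> bool" and u :: "'a::field ps3"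
  assumes face: "\<And>i j k i' j' k'. P (i + i') (j + j') (k + k') \<longleftrightarrow> P i j k \<and> P i' j' k'"
    and u: "u \<in> {h. \<forall>i j k. ps_coeff h i j k \<noteq> 0 \<longrightarrow> P i j k}" "ps_coeff u 0 0 0 \<noteq> 0"
  shows "is_unit_of {h. \<forall>i j k. ps_coeff h i j k \<noteq> 0 \<longrightarrow> P i j k} u"
proof -
  obtain v where v: "u * v = 1" using u(2) by (rule ps_unit_ex)
  define w where "w = ps_make (\<lambda>i j k. if P i j k then ps_coeff v i j k else 0)"
  have P0: "P 0 0 0" using u by blast
  have split: "P i j k \<longleftrightarrow> P i' j' k' \<and> P (i - i') (j - j') (k - k')" if "i' \<le> i" "j' \<le> j" "k' \<le> k" for i j k i' j' k'
    using face[of i' "i - i'" j' "j - j'" k' "k - k'"] that by simp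
  have "u * w = 1"
  proof (rule ps_eqI)
    fix i j k
    show "ps_coeff (u * w) i j k = ps_coeff 1 i j k"
    proof (cases "P i j k")
      case True
      have "ps_coeff (u * w) i j k = ps_coeff (u * v) i j k"
        unfolding ps_coeff_mult
        by (intro sum.cong refl) (auto simp: w_def dest: split[THEN iffD1, rotated 3, OF True])
      thus ?thesis by (simp add: v)
    next
      case False
      have "ps_coeff (u * w) i j k = 0"
        unfolding ps_coeff_mult
      proof (intro sum.neutral ballI, clarsimp)
        fix i' j' k' assume le: "i' \<le> i" "j' \<le> j" "k' \<le> k" and "ps_coeff w (i - i') (j - j') (k - k') \<noteq> 0"
        hence "P (i - i') (j - j') (k - k')" by (simp add: w_def split: if_splits)
        with False split[OF le] u(1) show "ps_coeff u i' j' k' = 0" by blast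
      qed
      moreover have "\<not> (i = 0 \<and> j = 0 \<and> k = 0)" using False P0 by blast
      ultimately show ?thesis by (simp add: ps_coeff_1)
    qed
  qed
  moreover have "w \<in> {h. \<forall>i j k. ps_coeff h i j k \<noteq> 0 \<longrightarrow> P i j k}" by (simp add: w_def)
  ultimately show ?thesis using u(1) unfolding is_unit_of_def by blast
qed

lemma is_unit_of_K_yz: "u \<in> K_yz \<Longrightarrow> ps_coeff u 0 0 0 \<noteq> 0 \<Longrightarrow> is_unit_of K_yz (u :: 'a::field ps3)"
  and is_unit_of_K_y: "u \<in> K_y \<Longrightarrow> ps_coeff u 0 0 0 \<noteq> 0 \<Longrightarrow> is_unit_of K_y (u :: 'a::field ps3)"
  and is_unit_of_K_z: "u \<in> K_z \<Longrightarrow> ps_coeff u 0 0 0 \<noteq> 0 \<Longrightarrow> is_unit_of K_z (u :: 'a::field ps3)"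
  unfolding K_yz_def K_y_def K_z_def by (rule face_inverse; auto)+

lemma is_unit_of_coeff: "is_unit_of S (u :: 'a::field ps3) \<Longrightarrow> ps_coeff u 0 0 0 \<noteq> 0"
  using ps_unit_iff[of u] by (auto simp: is_unit_of_def)

lemma ps_coeff_yv_power_mult:
  "ps_coeff (yv ^ s * h :: 'a::comm_ring_1 ps3) i j k = (if j < s then 0 else ps_coeff h i (j - s) k)"
  by (induction s arbitrary: j) (auto simp: mult.assoc)

lemma ps_coeff_zv_power_mult:
  "ps_coeff (zv ^ s * h :: 'a::comm_ring_1 ps3) i j k = (if k < s then 0 else ps_coeff h i j (k - s))"
  by (induction s arbitrary: k) (auto simp: mult.assoc)

lemma K_z_unit_factor:
  fixes b :: "'a::field ps3"
  assumes b: "b \<in> K_z" "b \<in> Mpow s" "b \<notin> Mpow (Suc s)"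
  obtains \<beta> where "is_unit_of K_z \<beta>" "b = \<beta> * zv ^ s"
proof -
  define \<beta> where "\<beta> = ps_make (\<lambda>i j k. if i = 0 \<and> j = 0 then ps_coeff b 0 0 (k + s) else 0)"
  have nz: "i = 0 \<and> j = 0" if "ps_coeff b i j k \<noteq> 0" for i j k using b(1) that by (auto simp: K_z_def)
  have "ps_coeff b 0 0 s \<noteq> 0" using b(2,3) nz by (force simp: Mpow_Suc_iff)
  hence "is_unit_of K_z \<beta>" by (intro is_unit_of_K_z) (auto simp: \<beta>_def K_z_def)
  moreover have "b = zv ^ s * \<beta>"
  proof (rule ps_eqI)
    fix i j k
    have "ps_coeff b 0 0 k = 0" if "k < s" using b(2) that by (intro MpowD) auto
    thus "ps_coeff b i j k = ps_coeff (zv ^ s * \<beta>) i j k"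
      using nz[of i j k] by (auto simp: ps_coeff_zv_power_mult \<beta>_def)
  qed
  ultimately show ?thesis using that by (simp add: mult.commute)
qed

lemma K_y_unit_factor:
  fixes b :: "'a::field ps3"
  assumes b: "b \<in> K_y" "b \<in> Mpow s" "b \<notin> Mpow (Suc s)"
  obtains \<beta> where "is_unit_of K_y \<beta>" "b = \<beta> * yv ^ s"
proof -
  define \<beta> where "\<beta> = ps_make (\<lambda>i j k. if i = 0 \<and> k = 0 then ps_coeff b 0 (j + s) 0 else 0)"
  have nz: "i = 0 \<and> k = 0" if "ps_coeff b i j k \<noteq> 0" for i j k using b(1) that by (auto simp: K_y_def)
  have "ps_coeff b 0 s 0 \<noteq> 0" using b(2,3) nz by (force simp: Mpow_Suc_iff)
  hence "is_unit_of K_y \<beta>" by (intro is_unit_of_K_y) (auto simp: \<beta>_def K_y_def)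
  moreover have "b = yv ^ s * \<beta>"
  proof (rule ps_eqI)
    fix i j k
    have "ps_coeff b 0 j 0 = 0" if "j < s" using b(2) that by (intro MpowD) auto
    thus "ps_coeff b i j k = ps_coeff (yv ^ s * \<beta>) i j k"
      using nz[of i j k] by (auto simp: ps_coeff_yv_power_mult \<beta>_def)
  qed
  ultimately show ?thesis using that by (simp add: mult.commute)
qed

text \<open>The monomials of \<open>q\<close> are sorted into multiples of \<open>yz\<close>, pure
  powers of \<open>y\<close> and pure powers of \<open>z\<close>. The last part stays unfactored,
  since its order is first to be compared with that of \<open>\<Delta>\<close>.\<close>

lemma split_yz:
  fixes q :: "'a::field ps3"
  assumes q: "q \<in> K_yz" "q - yv * zv \<in> Mpow 3"
  obtains d \<alpha> r b where "q = d * yv * zv + \<alpha> * yv ^ r + b" "3 \<le> r" "is_unit_of K_yz d"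
    "ps_coeff d 0 0 0 = 1" "\<alpha> = 0 \<or> is_unit_of K_y \<alpha>" "\<alpha> \<in> K_yz" "b \<in> K_z" "b \<in> Mpow 3"
proof -
  define d where "d = ps_make (\<lambda>i j k. if i = 0 then ps_coeff q 0 (Suc j) (Suc k) else 0)"
  define c where "c = ps_make (\<lambda>i j k. if i = 0 \<and> k = 0 then ps_coeff q 0 j 0 else 0)"
  define b where "b = ps_make (\<lambda>i j k. if i = 0 \<and> j = 0 then ps_coeff q 0 0 k else 0)"
  have q': "ps_coeff q i j k = (if i = 0 \<and> j = 1 \<and> k = 1 then 1 else 0)" if "i + j + k < 3" for i j k
    using MpowD[OF q(2) that] by (auto simp: ps_coeff_zv split: if_splits)
  have d: "ps_coeff d 0 0 0 = 1" using q'[of 0 1 1] by (simp add: d_def)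
  have "d \<in> K_yz" by (simp add: d_def K_yz_iff)
  with d have dU: "is_unit_of K_yz d" by (simp add: is_unit_of_K_yz)
  have b: "b \<in> K_z" "b \<in> Mpow 3" using q' by (auto simp: b_def K_z_def Mpow_def)
  have c: "c \<in> K_y" "c \<in> Mpow 3" using q' by (auto simp: c_def K_y_def Mpow_def)
  have q_eq: "q = yv * (zv * d) + c + b"
  proof (rule ps_eqI)
    fix i j k
    show "ps_coeff q i j k = ps_coeff (yv * (zv * d) + c + b) i j k"
      using q(1) q'[of 0 0 0] by (cases "i = 0"; cases "j = 0"; cases "k = 0") (auto simp: b_def c_def d_def K_yz_iff)
  qed
  have "\<exists>\<alpha> r. c = \<alpha> * yv ^ r \<and> 3 \<le> r \<and> (\<alpha> = 0 \<or> is_unit_of K_y \<alpha>) \<and> \<alpha> \<in> K_yz"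
  proof (cases "c = 0")
    case True
    \<comment> \<open>Without pure powers of \<open>y\<close> the exponent is a default:
      \<open>3\<close> is the least value allowed for \<open>r\<close>.\<close>
    thus ?thesis by (intro exI[of _ 0] exI[of _ 3]) simp
  next
    case False
    then obtain r where r: "c \<in> Mpow r" "c \<notin> Mpow (Suc r)" by (rule Mpow_exact_ex)
    have "3 \<le> r" using r(2) c(2) Mpow_mono[of c 3 "Suc r"] by (auto simp: not_less_eq_eq[symmetric])
    moreover obtain \<alpha> where "is_unit_of K_y \<alpha>" "c = \<alpha> * yv ^ r" using K_y_unit_factor[OF c(1) r] by blast
    moreover from this have "\<alpha> \<in> K_yz" by (auto simp: is_unit_of_def K_y_def K_yz_def)
    ultimately show ?thesis by blast
  qed
  then obtain \<alpha> r where "c = \<alpha> * yv ^ r" "3 \<le> r" "\<alpha> = 0 \<or> is_unit_of K_y \<alpha>" "\<alpha> \<in> K_yz" by blast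
  with that[of d \<alpha> r b] show ?thesis using q_eq d dU b by (simp add: mult_ac)
qed

subsection \<open>The common factor of the two initial forms\<close>

text \<open>For series of order at least \<open>2\<close> this is linear independence of the degree
  \<open>2\<close> components. Unlike the condition on initial forms, it is symmetric and visibly
  invariant under automorphisms.\<close>

definition quadric_indep :: "'a::comm_ring_1 ps3 \<Rightarrow> 'a ps3 \<Rightarrow> bool" where
  "quadric_indep f g \<longleftrightarrow> (\<forall>a b. ps_const a * f + ps_const b * g \<in> Mpow 3 \<longrightarrow> a = 0 \<and> b = 0)"

lemma const_mult_Mpow_iff:
  "a \<noteq> 0 \<Longrightarrow> ps_const a * f \<in> Mpow n \<longleftrightarrow> f \<in> Mpow n" for a :: "'a::field"
  by (auto simp: Mpow_def)

lemma type22_generators: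
  fixes I :: "'a::field ps3 set"
  assumes "type22 I"
  obtains f g where "I = ideal_gen {f, g}" "f \<in> Mpow 2" "g \<in> Mpow 2" "quadric_indep f g"
proof -
  from assms obtain f g where I: "I = ideal_gen {f, g}" and "ps_order f = 2" "ps_order g = 2"
    and ini: "initial_form g \<notin> ideal_gen {initial_form f}"
    by (auto simp: type22_def)
  hence o: "ps_order f = enat 2" "ps_order g = enat 2" by (simp_all add: numeral_eq_enat)
  hence M: "f \<in> Mpow 2" "g \<in> Mpow 2" "f \<notin> Mpow 3" by (auto simp: ps_order_eq_iff numeral_3_eq_3)
  have "a = 0 \<and> b = 0" if ab: "ps_const a * f + ps_const b * g \<in> Mpow 3" for a b
  proof (cases "b = 0")
    case True
    with ab M(3) const_mult_Mpow_iff[of a f 3] show ?thesis by auto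
  next
    case False
    define c where "c = - a / b"
    have "ps_const (inverse b) * (ps_const a * f + ps_const b * g) = g - ps_const c * f"
      using False by (intro ps_eqI) (simp; simp add: c_def field_simps)
    hence gc: "g - ps_const c * f \<in> Mpow 3" using Mpow_multL[OF ab, of "ps_const (inverse b)"] by simp
    have "emb (hom_component 2 g) = emb (poly_monom c 0 0 0 * hom_component 2 f)"
      unfolding emb_mult emb_hom_component emb_poly_monom
    proof (rule ps_eqI)
      fix i j k :: nat
      show "ps_coeff (hom_eval xv yv zv g 2) i j k =
          ps_coeff (ps_const c * (xv ^ 0 * yv ^ 0 * zv ^ 0) * hom_eval xv yv zv f 2) i j k"
        using MpowD[OF gc, of i j k] by (simp add: hom_eval_id_coeff)
    qed
    hence "initial_form g = poly_monom c 0 0 0 * initial_form f"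
      using emb_inj by (auto simp: initial_form_def o)
    with ini show ?thesis by (auto simp: ideal_gen_singleton)
  qed
  hence "quadric_indep f g" by (auto simp: quadric_indep_def)
  with I M that show ?thesis by blast
qed

lemma card_degree_triples_3: "card (degree_triples 3) = 10"
proof -
  have "degree_triples 3 = (\<lambda>(i, j). (i, j, 3 - i - j)) ` (SIGMA i:{..3}. {..3 - i})"
    by (auto simp: degree_triples_def image_iff)
  moreover have "inj_on (\<lambda>(i, j). (i, j, 3 - i - j :: nat)) (SIGMA i:{..3}. {..3 - i})"
    by (auto simp: inj_on_def)
  ultimately have "card (degree_triples 3) = card (SIGMA i:{..3::nat}. {..3 - i})"
    by (simp add: card_image)
  thus ?thesis by (simp add: numeral_3_eq_3 numeral_eq_Suc)
qed

text \<open>There are \<open>10\<close> cubic monomials. Five classes independent modulo the initial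
  part together with the six products of a variable and a generator make \<open>11\<close> elements,
  so the products must be dependent in degree \<open>3\<close>.\<close>

lemma cubic_relation:
  fixes f g :: "'a::field ps3"
  assumes M: "f \<in> Mpow 2" "g \<in> Mpow 2" and H3: "hilbert_fun (ideal_gen {f, g}) 3 = 5"
  obtains a1 a2 a3 b1 b2 b3 where "lin a1 a2 a3 * f + lin b1 b2 b3 * g \<in> Mpow 4"
    "(a1, a2, a3, b1, b2, b3) \<noteq> (0, 0, 0, 0, 0, 0)"
proof (rule ccontr)
  note ex = that
  assume "\<not> thesis"
  hence no: "a1 = 0 \<and> a2 = 0 \<and> a3 = 0 \<and> b1 = 0 \<and> b2 = 0 \<and> b3 = 0"
    if "lin a1 a2 a3 * f + lin b1 b2 b3 * g \<in> Mpow 4" for a1 a2 a3 b1 b2 b3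
    using that ex by blast
  let ?I = "ideal_gen {f, g}"
  note I = ideal_gen_ideal[of "{f, g}"]
  from H3 obtain b where b: "\<And>i. i < 5 \<Longrightarrow> b i \<in> Mpow 3" "indep_mod (initial_part ?I 3) 5 b"
    by (auto simp: hilbert_fun_eq_iff[OF I] qdim_def)
  define w where "w = [xv * f, yv * f, zv * f, xv * g, yv * g, zv * g]"
  define b' where "b' i = (if i < 5 then b i else w ! (i - 5))" for i
  have w: "w ! i \<in> initial_part ?I 3" if "i < 6" for i
  proof -
    have "w ! i \<in> set w" using that by (intro nth_mem) (simp add: w_def)
    moreover have "\<forall>u\<in>set w. u \<in> ?I \<and> u \<in> Mpow 3"
      using Mpow_mult[OF xv_Mpow M(1)] Mpow_mult[OF yv_Mpow M(1)] Mpow_mult[OF zv_Mpow M(1)]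
        Mpow_mult[OF xv_Mpow M(2)] Mpow_mult[OF yv_Mpow M(2)] Mpow_mult[OF zv_Mpow M(2)]
      by (auto simp: w_def numeral_3_eq_3 intro!: ideal_multL[OF I] intro: ideal_gen_superset)
    ultimately show ?thesis unfolding initial_part_def by (auto intro!: bexI[of _ "w ! i"])
  qed
  have wM: "w ! i \<in> Mpow 3" if "i < 6" for i using w[OF that] by (simp add: initial_part_def)
  have lc: "lcomb (5 + 6) c b' = lcomb 5 c b + lcomb 6 (\<lambda>i. c (5 + i)) ((!) w)" for c
    unfolding lcomb_append by (intro arg_cong2[where f = "(+)"] lcomb_cong) (auto simp: b'_def)
  hence lc11: "lcomb 11 c b' = lcomb 5 c b + lcomb 6 (\<lambda>i. c (5 + i)) ((!) w)" for c by simp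
  have lw: "lcomb 6 c ((!) w) = lin (c 0) (c 1) (c 2) * f + lin (c 3) (c 4) (c 5) * g" for c
    by (simp add: lcomb_def w_def lin_def numeral_eq_Suc algebra_simps)
  have "indep_mod (Mpow 4) (5 + 6) b'"
    unfolding indep_mod_def
  proof (intro allI impI)
    fix c i assume c: "lcomb (5 + 6) c b' \<in> Mpow 4" and i: "i < (5 + 6 :: nat)"
    have "lcomb (5 + 6) c b' \<in> initial_part ?I 3"
      using Mpow_Suc_subset_initial_part[OF I, of 3] c by auto
    moreover have "lcomb 6 (\<lambda>i. c (5 + i)) ((!) w) \<in> initial_part ?I 3"
      by (rule lcomb_mem[OF K_subspace_initial_part[OF I] w])
    ultimately have "lcomb (5 + 6) c b' - lcomb 6 (\<lambda>i. c (5 + i)) ((!) w) \<in> initial_part ?I 3"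
      by (rule K_subspace_diff[OF K_subspace_initial_part[OF I]])
    hence "lcomb 5 c b \<in> initial_part ?I 3" by (simp add: lc11)
    from indep_modD[OF b(2) this] have c5: "c i = 0" if "i < 5" for i using that .
    hence "lcomb 5 c b = 0" by (simp add: lcomb_def)
    with c have "lin (c 5) (c 6) (c 7) * f + lin (c 8) (c 9) (c 10) * g \<in> Mpow 4"
      by (simp add: lc11 lw)
    from no[OF this] have "c 5 = 0" "c 6 = 0" "c 7 = 0" "c 8 = 0" "c 9 = 0" "c 10 = 0" by auto
    moreover have "i < 5 \<or> i = 5 \<or> i = 6 \<or> i = 7 \<or> i = 8 \<or> i = 9 \<or> i = 10" using i by auto
    ultimately show "c i = 0" using c5 by auto
  qed
  moreover have "b' i \<in> Mpow 3" if "i < 5 + 6" for i using that b(1) wM by (simp add: b'_def)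
  moreover obtain s where "spans_mod (Mpow 3) (Mpow 4) 10 (s :: nat \<Rightarrow> 'a ps3)"
    using qdim_Mpow[of 3, where ?'a = 'a] by (auto simp: qdim_def card_degree_triples_3)
  ultimately have "5 + 6 \<le> (10::nat)"
    using indep_le_spans[OF is_ideal_K_subspace[OF is_ideal_Mpow]] by blast
  thus False by simp
qed

lemma quadric_indep_automorphism:
  fixes f g :: "'a::field ps3"
  assumes \<phi>: "K_algebra_automorphism \<phi>" and "quadric_indep f g"
  shows "quadric_indep (\<phi> f) (\<phi> g)"
  unfolding quadric_indep_def
proof (intro allI impI)
  fix a b
  assume "ps_const a * \<phi> f + ps_const b * \<phi> g \<in> Mpow 3"
  hence "\<phi> (ps_const a * f + ps_const b * g) \<in> Mpow 3"
    by (simp add: alg_endo_simps[OF automorphism_endo[OF \<phi>]])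
  thus "a = 0 \<and> b = 0" using assms(2) by (simp add: quadric_indep_def automorphism_Mpow_iff[OF \<phi>])
qed

lemma linear_automorphism_to_xv:
  fixes a1 :: "'a::field"
  assumes "lin a1 a2 a3 \<noteq> 0"
  obtains \<theta> where "K_algebra_automorphism \<theta>" "\<theta> (lin a1 a2 a3) = xv"
proof -
  have r: "lin p q r \<in> range (\<lambda>(a, b, c). lin a b c)" for p q r :: 'a by (auto simp: image_iff)
  have z: "lin p q r = 0 \<longleftrightarrow> p = 0 \<and> q = 0 \<and> r = 0" for p q r :: 'a
    using lin_eq_iff[of p q r 0 0 0] by simp
  have "a1 \<noteq> 0 \<or> a2 \<noteq> 0 \<or> a3 \<noteq> 0" using assms by auto
  hence "lin_indep (lin a1 a2 a3) (lin 0 1 0) (lin 0 0 1) \<or> lin_indep (lin a1 a2 a3) (lin 1 0 0) (lin 0 0 1)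
      \<or> lin_indep (lin a1 a2 a3) (lin 1 0 0) (lin 0 1 0)"
    unfolding lin_indep_def by (auto simp: r lin_scale lin_add z)
  thus ?thesis using lin_indep_automorphism that by metis
qed

lemma mult_xv_Mpow_iff: "xv * h \<in> Mpow (Suc n) \<longleftrightarrow> h \<in> Mpow n"
proof
  assume *: "xv * h \<in> Mpow (Suc n)"
  show "h \<in> Mpow n"
  proof (rule MpowI)
    fix i j k assume "i + j + k < n"
    with MpowD[OF *, of "Suc i" j k] show "ps_coeff h i j k = 0" by simp
  qed
next
  assume "h \<in> Mpow n"
  from Mpow_mult[OF xv_Mpow this] show "xv * h \<in> Mpow (Suc n)" by simp
qed

text \<open>In the relation \<open>xf + Bg \<equiv> 0\<close> of initial forms, \<open>x\<close> is prime and cannot divide \<open>B\<close>, so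
  \<open>x\<close> divides the initial form of \<open>g\<close>.\<close>

lemma common_factor_xv:
  fixes f g :: "'a::field ps3"
  assumes M: "f \<in> Mpow 2" "g \<in> Mpow 2" and ind: "quadric_indep f g"
    and rel: "xv * f + lin b1 b2 b3 * g \<in> Mpow 4"
  obtains l1 l2 l3 where "g - xv * lin l1 l2 l3 \<in> Mpow 3" "f + lin b1 b2 b3 * lin l1 l2 l3 \<in> Mpow 3"
proof -
  have gdec: "g = xfree g + xv * xquot g" by (rule xfree_xquot)
  \<comment> \<open>If \<open>B = lin b1 b2 b3\<close> is a multiple of \<open>x\<close>, cancelling
    \<open>x\<close> makes the quadrics dependent. Otherwise the terms of the relation free of
    \<open>x\<close> show that \<open>lin 0 b2 b3 * xfree g\<close> has order \<open>4\<close>, and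
    the linear factor cancels.\<close>
  have g0: "xfree g \<in> Mpow 3"
  proof (cases "lin 0 b2 b3 \<in> Mpow (Suc 1)")
    case True
    hence b: "b2 = 0" "b3 = 0" using lin_Mpow2_iff[of 0 b2 b3] by (simp_all add: numeral_2_eq_2)
    have "xv * (f + ps_const b1 * g) \<in> Mpow (Suc 3)"
      using rel by (simp add: b lin_def algebra_simps)
    hence "f + ps_const b1 * g \<in> Mpow 3" by (simp only: mult_xv_Mpow_iff)
    with ind have False unfolding quadric_indep_def by (metis mult_1 ps_const_1 one_neq_zero)
    thus ?thesis ..
  next
    case False
    have "xv * f + lin b1 b2 b3 * g =
        xv * (f + lin b1 b2 b3 * xquot g + ps_const b1 * xfree g) + lin 0 b2 b3 * xfree g"
      by (subst gdec) (simp add: lin_def algebra_simps)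
    moreover have K: "lin 0 b2 b3 * xfree g \<in> K_yz"
      by (intro K_yz_mult xfree_K_yz) (simp add: lin_def K_yz_add K_yz_mult)
    ultimately have "lin 0 b2 b3 * xfree g \<in> Mpow (1 + 3)"
    proof (intro MpowI)
      fix i j k :: nat assume ijk: "i + j + k < 1 + 3"
      assume eq: "xv * f + lin b1 b2 b3 * g =
        xv * (f + lin b1 b2 b3 * xquot g + ps_const b1 * xfree g) + lin 0 b2 b3 * xfree g"
      show "ps_coeff (lin 0 b2 b3 * xfree g) i j k = 0"
      proof (cases "i = 0")
        case True
        have "ps_coeff (xv * f + lin b1 b2 b3 * g) i j k = 0" using ijk by (intro MpowD[OF rel]) simp
        thus ?thesis unfolding eq using True by simp
      qed (use K in \<open>simp add: K_yz_iff\<close>)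
    qed
    thus ?thesis using False by (rule Mpow_mult_cancel)
  qed
  have "xquot g \<in> Mpow 1" using xquot_Mpow[OF M(2)] by simp
  then obtain l1 l2 l3 where l: "xquot g - lin l1 l2 l3 \<in> Mpow 2" by (rule lin_part_ex)
  have "g - xv * lin l1 l2 l3 = xfree g + xv * (xquot g - lin l1 l2 l3)"
    by (subst (1) gdec) (simp add: algebra_simps)
  also have "\<dots> \<in> Mpow 3" by (intro Mpow_add g0 Mpow_mult'[OF xv_Mpow l]) simp
  finally have g: "g - xv * lin l1 l2 l3 \<in> Mpow 3" .
  have "xv * (f + lin b1 b2 b3 * lin l1 l2 l3) =
      (xv * f + lin b1 b2 b3 * g) - lin b1 b2 b3 * (g - xv * lin l1 l2 l3)"
    by (simp add: algebra_simps)
  also have "\<dots> \<in> Mpow (Suc 3)"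
    using rel Mpow_mult[OF lin_Mpow g] by (intro Mpow_diff) simp_all
  finally have "f + lin b1 b2 b3 * lin l1 l2 l3 \<in> Mpow 3" by (simp only: mult_xv_Mpow_iff)
  with g that show ?thesis by blast
qed

text \<open>Once the coefficient of \<open>f\<close> in the cubic relation is moved to
  \<open>x\<close>, the quadrics are \<open>- B l\<close> and \<open>x l\<close>. The forms
  \<open>x, B, l\<close> are independent: a relation involving \<open>l\<close> puts
  \<open>l^2\<close> into the initial ideal, and one without \<open>l\<close> makes the quadrics
  dependent.\<close>

lemma initial_forms_normalised:
  fixes f g :: "'a::field ps3"
  assumes M: "f \<in> Mpow 2" "g \<in> Mpow 2" and ind: "quadric_indep f g"
    and H3: "hilbert_fun (ideal_gen {f, g}) 3 = 5"
    and nosq: "\<not> contains_square_of_linear_form (initial_ideal (ideal_gen {f, g}))"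
  obtains \<phi> f' g' where "K_algebra_automorphism \<phi>" "\<phi> ` ideal_gen {f, g} = ideal_gen {f', g'}"
    "f' - (xv + zv) * xv \<in> Mpow 3" "g' - (xv + zv) * yv \<in> Mpow 3"
proof -
  obtain a1 a2 a3 b1 b2 b3 where rel: "lin a1 a2 a3 * f + lin b1 b2 b3 * g \<in> Mpow 4"
    and nz: "(a1, a2, a3, b1, b2, b3) \<noteq> (0, 0, 0, 0, 0, 0)"
    using cubic_relation[OF M H3] by metis
  have g3: "g \<notin> Mpow 3"
  proof
    assume "g \<in> Mpow 3"
    hence "ps_const 0 * f + ps_const 1 * g \<in> Mpow 3" by simp
    with ind show False unfolding quadric_indep_def by (metis one_neq_zero)
  qed
  have A: "lin a1 a2 a3 \<noteq> 0"
  proof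
    assume A0: "lin a1 a2 a3 = 0"
    hence "a1 = 0 \<and> a2 = 0 \<and> a3 = 0" using lin_eq_iff[of a1 a2 a3 0 0 0] by simp
    hence "lin b1 b2 b3 \<notin> Mpow (Suc 1)" using nz lin_Mpow2_iff[of b1 b2 b3] by (auto simp: numeral_2_eq_2)
    moreover have "lin b1 b2 b3 * g \<in> Mpow (1 + 3)" using rel A0 by simp
    ultimately have "g \<in> Mpow 3" by (metis Mpow_mult_cancel)
    with g3 show False by simp
  qed
  then obtain \<theta> where \<theta>: "K_algebra_automorphism \<theta>" and \<theta>A: "\<theta> (lin a1 a2 a3) = xv"
    by (rule linear_automorphism_to_xv)
  note e = automorphism_endo[OF \<theta>]
  define f1 where "f1 = \<theta> f"
  define g1 where "g1 = \<theta> g"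
  have M1: "f1 \<in> Mpow 2" "g1 \<in> Mpow 2"
    using M by (simp_all add: f1_def g1_def alg_endo_Mpow[OF e])
  have ind1: "quadric_indep f1 g1"
    unfolding f1_def g1_def by (rule quadric_indep_automorphism[OF \<theta> ind])
  have "\<theta> (lin b1 b2 b3) \<in> Mpow 1" by (rule alg_endo_Mpow[OF e lin_Mpow])
  then obtain c1 c2 c3 where c: "\<theta> (lin b1 b2 b3) - lin c1 c2 c3 \<in> Mpow 2" by (rule lin_part_ex)
  have "xv * f1 + \<theta> (lin b1 b2 b3) * g1 = \<theta> (lin a1 a2 a3 * f + lin b1 b2 b3 * g)"
    by (simp add: alg_endo_simps[OF e] \<theta>A f1_def g1_def)
  hence "xv * f1 + \<theta> (lin b1 b2 b3) * g1 \<in> Mpow 4" using rel by (simp add: alg_endo_Mpow[OF e])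
  moreover have "(\<theta> (lin b1 b2 b3) - lin c1 c2 c3) * g1 \<in> Mpow 4" using Mpow_mult[OF c M1(2)] by simp
  ultimately have "xv * f1 + \<theta> (lin b1 b2 b3) * g1 - (\<theta> (lin b1 b2 b3) - lin c1 c2 c3) * g1 \<in> Mpow 4"
    by (rule Mpow_diff)
  hence rel1: "xv * f1 + lin c1 c2 c3 * g1 \<in> Mpow 4" by (simp add: algebra_simps)
  obtain l1 l2 l3 where g1: "g1 - xv * lin l1 l2 l3 \<in> Mpow 3"
    and f1: "f1 + lin c1 c2 c3 * lin l1 l2 l3 \<in> Mpow 3"
    using M1 ind1 rel1 by (rule common_factor_xv)
  let ?B = "lin c1 c2 c3" and ?l = "lin l1 l2 l3"
  have l2: "?l \<notin> Mpow 2"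
  proof
    assume "?l \<in> Mpow 2"
    hence "xv * ?l \<in> Mpow 3" by (rule Mpow_mult'[OF xv_Mpow]) simp
    from Mpow_add[OF g1 this] have "ps_const 0 * f1 + ps_const 1 * g1 \<in> Mpow 3" by simp
    with ind1 show False unfolding quadric_indep_def by (metis one_neq_zero)
  qed
  have nosq1: "k - h\<^sup>2 \<notin> Mpow 3" if "h \<in> Mpow 1" "h \<notin> Mpow 2" "k \<in> ideal_gen {f1, g1}" for h k
  proof
    assume "k - h\<^sup>2 \<in> Mpow 3"
    from automorphism_square[OF automorphism_inv[OF \<theta>] that this]
    have "contains_square_of_linear_form (initial_ideal (inv \<theta> ` ideal_gen {f1, g1}))"
      by (subst contains_square_iff) (simp add: automorphism_ideal_gen[OF automorphism_inv[OF \<theta>]] ideal_gen_ideal, blast)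
    moreover have "inv \<theta> ` ideal_gen {f1, g1} = ideal_gen {f, g}"
      using automorphism_bij[OF \<theta>]
      by (simp add: automorphism_ideal_gen[OF automorphism_inv[OF \<theta>]] f1_def g1_def bij_is_inj)
    ultimately show False using nosq by simp
  qed
  have indep: "a = 0 \<and> b = 0 \<and> c = 0" if 0: "ps_const a * xv + ps_const b * ?B + ps_const c * ?l = 0" for a b c
  proof -
    have c0: "c = 0"
    proof (rule ccontr)
      assume "c \<noteq> 0"
      hence c: "ps_const (inverse c) * ps_const c = 1" by (simp flip: ps_const_mult)
      \<comment> \<open>Multiplying the relation \<open>a x + b B + c l = 0\<close> by
        \<open>l\<close> and using \<open>x l = g1\<close>, \<open>B l = - f1\<close> in degree
        \<open>2\<close> exhibits \<open>l^2\<close> as the degree \<open>2\<close> component of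
        \<open>k\<close>.\<close>
      define k where "k = ps_const (- inverse c) * (ps_const a * g1 - ps_const b * f1)"
      have "k = (ps_const (- inverse c) * ps_const a) * g1 + (ps_const (inverse c) * ps_const b) * f1"
        by (simp add: k_def ps_const_minus algebra_simps)
      hence "k \<in> ideal_gen {f1, g1}"
        by (simp add: ideal_add[OF ideal_gen_ideal] ideal_multL[OF ideal_gen_ideal] ideal_gen_superset)
      from nosq1[OF lin_Mpow l2 this] have no: "k - ?l\<^sup>2 \<notin> Mpow 3" .
      have "k - ?l\<^sup>2 = ps_const (- inverse c) *
          (ps_const a * (g1 - xv * ?l) - ps_const b * (f1 + ?B * ?l)
           + (ps_const a * xv + ps_const b * ?B + ps_const c * ?l) * ?l)
          + (ps_const (inverse c) * ps_const c) * ?l\<^sup>2 - ?l\<^sup>2"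
        by (simp add: k_def ps_const_minus power2_eq_square algebra_simps)
      also have "\<dots> = ps_const (- inverse c) * (ps_const a * (g1 - xv * ?l) - ps_const b * (f1 + ?B * ?l))"
        unfolding 0 c by simp
      also have "\<dots> \<in> Mpow 3" by (intro Mpow_multL Mpow_diff f1 g1)
      finally show False using no by simp
    qed
    have "ps_const (- b) * f1 + ps_const a * g1 =
        ps_const a * (g1 - xv * ?l) - ps_const b * (f1 + ?B * ?l) + (ps_const a * xv + ps_const b * ?B) * ?l"
      by (simp add: ps_const_minus algebra_simps)
    also have "ps_const a * xv + ps_const b * ?B = 0" using 0 c0 by simp
    also have "ps_const a * (g1 - xv * ?l) - ps_const b * (f1 + ?B * ?l) + 0 * ?l \<in> Mpow 3"
      by (intro Mpow_add Mpow_diff Mpow_multL[OF g1] Mpow_multL[OF f1]) simp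
    finally have "- b = 0 \<and> a = 0" using ind1 unfolding quadric_indep_def by blast
    with c0 show ?thesis by simp
  qed
  have r: "lin p q r \<in> range (\<lambda>(a, b, c). lin a b c)" for p q r :: 'a by (auto simp: image_iff)
  have "lin_indep xv ?B (?l - xv)"
    unfolding lin_indep_def
  proof (intro conjI allI impI)
    show "xv \<in> range (\<lambda>(a, b, c). lin a b (c :: 'a))" using r[of 1 0 0] by (simp add: lin_x)
    show "?l - xv \<in> range (\<lambda>(a, b, c). lin a b c)"
    proof -
      have "?l - xv = lin (l1 - 1) l2 l3" by (simp add: lin_diff flip: lin_x)
      thus ?thesis using r by simp
    qed
    fix a b c assume "ps_const a * xv + ps_const b * ?B + ps_const c * (?l - xv) = 0"
    hence "ps_const (a - c) * xv + ps_const b * ?B + ps_const c * ?l = 0"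
      by (simp add: ps_const_diff algebra_simps)
    from indep[OF this] show "a = 0" "b = 0" "c = 0" by auto
  qed (rule r)
  \<comment> \<open>With \<open>x, B, l - x\<close> as coordinates the common factor becomes
    \<open>x + z\<close>. The generators change roles: \<open>g1\<close> becomes the first one and
    \<open>- f1\<close> the second.\<close>
  then obtain \<eta> where \<eta>: "K_algebra_automorphism \<eta>" "\<eta> xv = xv" "\<eta> ?B = yv" "\<eta> (?l - xv) = zv"
    by (rule lin_indep_automorphism)
  note e' = automorphism_endo[OF \<eta>(1)]
  have \<eta>l: "\<eta> ?l = xv + zv" using \<eta>(2,4) by (simp add: alg_endo_diff[OF e'] algebra_simps)
  have "\<eta> (g1 - xv * ?l) \<in> Mpow 3" "- \<eta> (f1 + ?B * ?l) \<in> Mpow 3"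
    using f1 g1 by (simp_all add: alg_endo_Mpow[OF e'])
  hence "\<eta> g1 - (xv + zv) * xv \<in> Mpow 3" "- \<eta> f1 - (xv + zv) * yv \<in> Mpow 3"
    by (simp_all add: alg_endo_simps[OF e'] \<eta> \<eta>l mult.commute)
  moreover have "(\<eta> \<circ> \<theta>) ` ideal_gen {f, g} = ideal_gen {\<eta> g1, - \<eta> f1}"
  proof -
    have "(\<eta> \<circ> \<theta>) ` ideal_gen {f, g} = ideal_gen {\<eta> f1, \<eta> g1}"
      unfolding image_comp[symmetric] automorphism_ideal_gen[OF \<theta>] automorphism_ideal_gen[OF \<eta>(1)]
      by (simp add: f1_def g1_def)
    also have "\<dots> = ideal_gen {\<eta> g1, - \<eta> f1}"
      by (rule ideal_gen_pair_eqI[of _ 0 _ "-1" _ _ 1 0 0 1 "-1" 0]) simp_all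
    finally show ?thesis .
  qed
  ultimately show ?thesis using that automorphism_comp[OF \<eta>(1) \<theta>] by blast
qed

subsection \<open>Values of initial forms at points\<close>

text \<open>\<open>h(az, bz, cz)\<close>; for \<open>h\<close> of order at least \<open>n\<close> its coefficient of \<open>z\<^sup>n\<close> is the value of the
  degree \<open>n\<close> component of \<open>h\<close> at \<open>(a, b, c)\<close>.\<close>

definition line_restr :: "'a::comm_ring_1 \<Rightarrow> 'a \<Rightarrow> 'a \<Rightarrow> 'a ps3 \<Rightarrow> 'a ps3" where
  "line_restr a b c = sub (ps_const a * zv) (ps_const b * zv) (ps_const c * zv)"

lemma alg_endo_line_restr: "alg_endo (line_restr a b c)"
  and line_restr_xv: "line_restr a b c xv = ps_const a * zv"
  and line_restr_yv: "line_restr a b c yv = ps_const b * zv"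
  and line_restr_zv: "line_restr a b c zv = ps_const c * zv"
proof -
  have M: "ps_const t * zv \<in> Mpow 1" for t :: 'a by (rule Mpow_multL[OF zv_Mpow])
  show "alg_endo (line_restr a b c)" "line_restr a b c xv = ps_const a * zv"
    "line_restr a b c yv = ps_const b * zv" "line_restr a b c zv = ps_const c * zv"
    unfolding line_restr_def by (rule alg_endo_sub[OF M M M] sub_xv[OF M M M] sub_yv[OF M M M] sub_zv[OF M M M])+
qed

lemma line_restr_approx:
  fixes a b c :: "'a::comm_ring_1"
  assumes h: "h \<in> Mpow n"
  shows "line_restr a b c h -
    ps_const (\<Sum>(i, j, k)\<in>degree_triples n. ps_coeff h i j k * (a ^ i * b ^ j * c ^ k)) * zv ^ n \<in> Mpow (Suc n)"
proof -
  note e = alg_endo_line_restr[of a b c]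
  let ?h = "hom_eval (ps_const a * zv) (ps_const b * zv) (ps_const c * zv) h"
  have "?h m = 0" if "m < n" for m
    unfolding hom_eval_def using that by (intro sum.neutral) (auto simp: degree_triples_def MpowD[OF h])
  hence "(\<Sum>m<Suc n. ?h m) = ?h n" by simp
  moreover have "line_restr a b c h - (\<Sum>m<Suc n. ?h m) \<in> Mpow (Suc n)"
    using alg_endo_approx[OF e, of h "Suc n"] by (simp only: line_restr_xv line_restr_yv line_restr_zv)
  moreover have "?h n = ps_const (\<Sum>(i, j, k)\<in>degree_triples n. ps_coeff h i j k * (a ^ i * b ^ j * c ^ k)) * zv ^ n"
  proof -
    have pc: "ps_const t ^ m = ps_const (t ^ m)" for t :: 'a and m
      by (induction m) (simp_all add: ps_const_mult)
    show ?thesis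
      unfolding hom_eval_def ps_const_sum sum_distrib_right
      by (intro sum.cong refl)
         (auto simp: degree_triples_def power_mult_distrib pc ps_const_mult power_add mult_ac)
  qed
  ultimately show ?thesis by simp
qed

text \<open>The points of the line \<open>x + z = 0\<close> are \<open>(1 : t : -1)\<close> and
  \<open>(0 : 1 : 0)\<close>. If the coefficient of \<open>y^n\<close> is zero, the form vanishes at
  the latter; otherwise its values at the former are a polynomial in \<open>t\<close> of positive
  degree, which has a root.\<close>

lemma binary_form_zero:
  fixes h :: "'a::alg_closed_field ps3"
  assumes h: "h \<in> Mpow n" and n: "n > 0"
  shows "(\<exists>t. line_restr 1 t (- 1) h \<in> Mpow (Suc n)) \<or> line_restr 0 1 0 h \<in> Mpow (Suc n)"
proof (cases "ps_coeff h 0 n 0 = 0")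
  case True
  have "(\<Sum>(i, j, k)\<in>degree_triples n. ps_coeff h i j k * (0 ^ i * 1 ^ j * 0 ^ k)) = (0::'a)"
    using True by (intro sum.neutral) (auto simp: degree_triples_def power_0_left)
  with line_restr_approx[OF h, of 0 1 0] show ?thesis by simp
next
  case False
  define P where "P = (\<Sum>(i, j, k)\<in>degree_triples n. monom (ps_coeff h i j k * (- 1) ^ k) j)"
  have "coeff P n = (\<Sum>s\<in>degree_triples n. if s = (0, n, 0) then ps_coeff h 0 n 0 else 0)"
    unfolding P_def coeff_sum
    by (intro sum.cong refl) (auto simp: degree_triples_def split: if_splits)
  also have "\<dots> = ps_coeff h 0 n 0"
    using finite_degree_triples[of n] by (subst sum.delta) (auto simp: degree_triples_def)
  finally have "coeff P n \<noteq> 0" using False by simp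
  hence "degree P > 0" using n le_degree[of P n] by simp
  then obtain t where "poly P t = 0" using alg_closed_imp_poly_has_root by blast
  hence "(\<Sum>(i, j, k)\<in>degree_triples n. ps_coeff h i j k * (1 ^ i * t ^ j * (- 1) ^ k)) = 0"
    by (simp add: P_def poly_sum split_def poly_monom mult_ac)
  with line_restr_approx[OF h, of 1 t "- 1"] have "line_restr 1 t (- 1) h \<in> Mpow (Suc n)" by simp
  thus ?thesis by blast
qed

subsection \<open>The normal form\<close>

text \<open>On the plane \<open>b X\<close> has order at least \<open>m + 2\<close>, whereas
  \<open>y \<Delta>\<close> has order exactly \<open>m + 1\<close>.\<close>

lemma (in determinantal) rho_h3_exact_low:
  assumes "\<Delta> \<in> K_yz" "\<Delta> \<notin> Mpow (Suc m)" "b \<in> Mpow (Suc m)"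
  shows "rho h3 \<notin> Mpow (m + 2)"
proof
  assume "rho h3 \<in> Mpow (m + 2)"
  moreover have "rho (b * X) \<in> Mpow (m + 2)"
    by (intro rho_Mpow Mpow_mult'[OF assms(3) X_Mpow]) simp
  moreover have "yv * \<Delta> = rho h3 + rho (b * X)"
    by (simp add: h3_def rho_diff rho_mult[of yv] rho_yv rho_id assms(1))
  ultimately have "yv * \<Delta> \<in> Mpow (Suc (1 + m))" using Mpow_add by fastforce
  hence "yv \<in> (Mpow (Suc 1) :: 'a ps3 set)" using Mpow_mult_exact[OF _ yv_Mpow \<Delta>] assms(2) by blast
  from MpowD[OF this, of 0 1 0] show False by (simp add: ps_coeff_yv)
qed

text \<open>On the plane \<open>X\<close> is \<open>- z\<close> up to order two, so
  \<open>h3\<close> has leading component \<open>y \<Delta> + z b\<close>, in which the power of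
  \<open>z\<close> comes from \<open>b\<close> alone.\<close>

lemma (in determinantal) rho_h3_exact_high:
  assumes "\<Delta> \<in> K_yz" "b \<in> K_yz" "ps_coeff b 0 0 m \<noteq> 0"
  shows "rho h3 \<notin> Mpow (m + 2)"
proof
  assume "rho h3 \<in> Mpow (m + 2)"
  moreover have "rho h3 = yv * \<Delta> + zv * b - b * rho eps"
    by (simp add: h3_def X_def rho_diff rho_mult rho_add rho_yv rho_xv rho_id assms algebra_simps)
  moreover have "b * rho eps \<in> Mpow (m + 2)" by (intro Mpow_mult b rho_Mpow eps)
  ultimately have "yv * \<Delta> + zv * b \<in> Mpow (m + 2)"
    using Mpow_add[of "rho h3" "m + 2" "b * rho eps"] by simp
  from MpowD[OF this, of 0 0 "Suc m"] assms(3) show False by simp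
qed

section \<open>From the normal form to the Hilbert function\<close>

text \<open>With \<open>w = yv ^ (r - 1)\<close> one has
  \<open>g = y (x + d z + \<alpha> w) + b\<close>, and the bracket is
  \<open>L = x + z - eps\<close>. Dividing \<open>f\<close> by \<open>L\<close> as a polynomial in
  \<open>x\<close> gives the quotient \<open>x + eps\<close> and as remainder the value of
  \<open>f\<close> at \<open>x = - (d z + \<alpha> w)\<close>, which is
  \<open>normal_Delta\<close>.\<close>

definition normal_eps :: "'a::comm_ring_1 ps3 \<Rightarrow> 'a ps3 \<Rightarrow> nat \<Rightarrow> 'a ps3" where
  "normal_eps d \<alpha> r = (1 - d) * zv - \<alpha> * yv ^ (r - 1)"

definition normal_Delta :: "'a::comm_ring_1 ps3 \<Rightarrow> 'a ps3 \<Rightarrow> 'a ps3 \<Rightarrow> nat \<Rightarrow> 'a ps3" where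
  "normal_Delta F d \<alpha> r = F + d * (d - 1) * zv\<^sup>2 + \<alpha> * (2 * d - 1) * zv * yv ^ (r - 1)
                 + \<alpha>\<^sup>2 * yv ^ (2 * (r - 1))"

lemma normal_form_facts:
  fixes F d \<alpha> :: "'a::field ps3"
  assumes F: "F \<in> Mpow 3" and r: "3 \<le> r" and d: "ps_coeff d 0 0 0 = 1"
  shows "normal_eps d \<alpha> r \<in> Mpow 2" "normal_Delta F d \<alpha> r \<in> Mpow 3"
proof -
  have d1: "d - 1 \<in> Mpow 1" "1 - d \<in> Mpow 1" using d by (simp_all add: Mpow_1_iff ps_coeff_1)
  have y: "yv ^ (r - 1) \<in> (Mpow 2 :: 'a ps3 set)" "yv ^ (2 * (r - 1)) \<in> (Mpow 3 :: 'a ps3 set)"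
    by (rule Mpow_mono[OF Mpow_power1[OF yv_Mpow]]; use r in simp)+
  have z: "zv\<^sup>2 \<in> (Mpow 2 :: 'a ps3 set)" by (rule Mpow_power1[OF zv_Mpow])
  show "normal_eps d \<alpha> r \<in> Mpow 2"
    unfolding normal_eps_def
    by (intro Mpow_diff Mpow_mult'[OF d1(2) zv_Mpow] Mpow_multL y) simp
  have 1: "d * (d - 1) * zv\<^sup>2 \<in> Mpow 3" by (intro Mpow_mult'[OF Mpow_multL[OF d1(1)] z]) simp
  have 2: "\<alpha> * (2 * d - 1) * zv * yv ^ (r - 1) \<in> Mpow 3"
    by (intro Mpow_mult'[OF Mpow_multL[OF zv_Mpow] y(1)]) simp
  show "normal_Delta F d \<alpha> r \<in> Mpow 3"
    unfolding normal_Delta_def by (intro Mpow_add F 1 2 Mpow_multL[OF y(2)])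
qed

lemma normal_form_determinantal:
  fixes F d \<alpha> :: "'a::field ps3"
  assumes "determinantal (normal_eps d \<alpha> r) (normal_Delta F d \<alpha> r) b m" and r: "3 \<le> r"
  shows "determinantal.f (normal_eps d \<alpha> r) (normal_Delta F d \<alpha> r) = xv\<^sup>2 + xv * zv + F"
    "determinantal.g (normal_eps d \<alpha> r) b = xv * yv + d * yv * zv + \<alpha> * yv ^ r + b"
proof -
  interpret determinantal "normal_eps d \<alpha> r" "normal_Delta F d \<alpha> r" b m by fact
  define w :: "'a ps3" where "w = yv ^ (r - 1)"
  have w: "yv ^ (r - 1) = w" "yv ^ (2 * (r - 1)) = w * w" "yv ^ r = yv * w"
  proof -
    show "yv ^ (2 * (r - 1)) = w * w" by (simp only: w_def power_even_eq power2_eq_square)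
    show "yv ^ r = yv * w" using r by (cases r) (simp_all add: w_def)
  qed (simp add: w_def)
  show "f = xv\<^sup>2 + xv * zv + F"
    unfolding f_def L_def X_def unfolding normal_eps_def normal_Delta_def w power2_eq_square by algebra
  show "g = xv * yv + d * yv * zv + \<alpha> * yv ^ r + b"
    unfolding g_def L_def unfolding normal_eps_def w by algebra
qed

lemma normal_Delta_K_yz:
  fixes F :: "'a::comm_ring_1 ps3"
  shows "F \<in> K_yz \<Longrightarrow> d \<in> K_yz \<Longrightarrow> \<alpha> \<in> K_yz \<Longrightarrow> normal_Delta F d \<alpha> r \<in> K_yz"
proof -
  assume *: "F \<in> K_yz" "d \<in> K_yz" "\<alpha> \<in> K_yz"
  moreover have "(2 :: 'a ps3) \<in> K_yz" using K_yz_add[OF K_yz_1 K_yz_1, where ?'a = 'a] by simp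
  ultimately show ?thesis
    unfolding normal_Delta_def by (simp add: K_yz_add K_yz_mult K_yz_diff K_yz_power)
qed

lemma K_z_subset_K_yz: "b \<in> K_z \<Longrightarrow> b \<in> K_yz"
  by (auto simp: K_z_def K_yz_def)

lemma hilbert_fun_normal_form:
  fixes f g :: "'a::field ps3"
  assumes nf: "normal_form_generators e f g" and e: "5 \<le> e"
  shows "hilbert_fun (ideal_gen {f, g}) = H e"
    and "\<not> contains_square_of_linear_form (initial_ideal (ideal_gen {f, g}))"
proof -
  from nf obtain r s F d \<alpha> \<beta> where
    f: "f = xv\<^sup>2 + xv * zv + F" and g: "g = xv * yv + d * yv * zv + \<alpha> * yv ^ r + \<beta> * zv ^ s"
    and r: "3 \<le> r" and F: "F \<in> K_yz" "3 \<le> ps_order F" and d: "is_unit_of K_yz d" "ps_coeff d 0 0 0 = 1"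
    and \<alpha>: "\<alpha> = 0 \<or> is_unit_of K_y \<alpha>" and s: "e - 1 \<le> s"
    and ord: "ps_order (normal_Delta F d \<alpha> r) = enat (e - 2)"
    unfolding normal_form_generators_def normal_Delta_def[symmetric] by blast
  have F3: "F \<in> Mpow 3" using F(2) by (simp add: Mpow_iff_order numeral_eq_enat)
  have \<alpha>K: "\<alpha> \<in> K_yz" using \<alpha> by (auto simp: is_unit_of_def K_y_def K_yz_def)
  have dK: "d \<in> K_yz" using d by (simp add: is_unit_of_def)
  define m where "m = e - 2"
  have em: "e = m + 2" "m \<ge> 3" using e by (simp_all add: m_def)
  define eps where "eps = normal_eps d \<alpha> r"
  define \<Delta> where "\<Delta> = normal_Delta F d \<alpha> r"
  define b where "b = \<beta> * zv ^ s"
  have bM: "b \<in> Mpow (Suc m)"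
    unfolding b_def by (intro Mpow_multL Mpow_mono[OF Mpow_power1[OF zv_Mpow]]) (use s em in simp)
  have \<Delta>: "\<Delta> \<in> Mpow m" "\<Delta> \<notin> Mpow (Suc m)" using ord by (simp_all add: ps_order_eq_iff \<Delta>_def m_def)
  interpret det: determinantal eps \<Delta> b m
    by unfold_locales
       (use em \<Delta> bM normal_form_facts(1)[OF F3 r d(2)] in \<open>auto simp: eps_def intro: Mpow_mono\<close>)
  have fg: "f = det.f" "g = det.g"
    using normal_form_determinantal[OF _ r, of d \<alpha> F b m] det.determinantal_axioms
    by (simp_all add: f g eps_def \<Delta>_def b_def)
  have exact: "rho det.h3 \<notin> Mpow (m + 2)"
    by (rule det.rho_h3_exact_low[OF _ \<Delta>(2) bM]) (simp add: \<Delta>_def normal_Delta_K_yz F dK \<alpha>K)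
  show "hilbert_fun (ideal_gen {f, g}) = H e"
  proof
    fix t
    show "hilbert_fun (ideal_gen {f, g}) t = H e t"
      using det.hilbert_0 det.hilbert_low[of t] det.hilbert_high[OF exact, of t] em
      by (cases "t = 0"; cases "t \<le> m") (auto simp: fg H_def)
  qed
  show "\<not> contains_square_of_linear_form (initial_ideal (ideal_gen {f, g}))"
  proof
    assume "contains_square_of_linear_form (initial_ideal (ideal_gen {f, g}))"
    then obtain h k where h: "h \<in> Mpow 1" "h \<notin> Mpow 2" and k: "k \<in> ideal_gen {f, g}" "k - h\<^sup>2 \<in> Mpow 3"
      unfolding contains_square_iff[OF ideal_gen_ideal] by blast
    obtain h1 h2 h3 where l: "h - lin h1 h2 h3 \<in> Mpow 2" using h(1) by (rule lin_part_ex)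
    let ?l = "lin h1 h2 h3"
    obtain A B where AB: "k = A * f + B * g" using k by (auto simp: ideal_gen_pair)
    define a where "a = ps_coeff A 0 0 0"
    define c where "c = ps_coeff B 0 0 0"
    have A': "A - ps_const a \<in> Mpow 1" "B - ps_const c \<in> Mpow 1"
      by (simp_all add: a_def c_def Mpow_1_iff ps_coeff_const)
    have "ps_const a * ((xv + zv) * xv) + ps_const c * ((xv + zv) * yv) - ?l\<^sup>2 =
        (k - h\<^sup>2) + (h - ?l) * (h + ?l) - (A - ps_const a) * f - (B - ps_const c) * g
        - ps_const a * det.f' - ps_const c * det.g'"
      unfolding AB by (simp add: fg power2_eq_square algebra_simps)
    also have "\<dots> \<in> Mpow 3"
      using det.f_Mpow det.g_Mpow
      by (intro Mpow_diff Mpow_add k(2) Mpow_mult'[OF l Mpow_add[OF h(1) lin_Mpow]]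
          Mpow_mult'[OF A'(1), of f 2] Mpow_mult'[OF A'(2), of g 2] Mpow_multL det.f' det.g') (simp_all add: fg)
    finally have 0: "ps_const a * ((xv + zv) * xv) + ps_const c * ((xv + zv) * yv) - ?l\<^sup>2 \<in> Mpow 3" .
    have lsq: "?l\<^sup>2 = ps_const h1 * (xv * ?l) + ps_const h2 * (yv * ?l) + ps_const h3 * (zv * ?l)"
      by (simp add: power2_eq_square lin_def algebra_simps)
    note 0 = 0[unfolded lsq]
    note co = xz_mult_commute ps_coeff_xv ps_coeff_yv ps_coeff_zv ps_coeff_lin
    \<comment> \<open>The degree \<open>2\<close> component is \<open>a x(x+z) + c y(x+z)\<close>.
      It has no \<open>z^2\<close> and no \<open>y^2\<close>, and equal coefficients
      \<open>a\<close> at \<open>x^2\<close> and \<open>xz\<close>; in a square of a linear form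
      this leaves no nonzero coefficient.\<close>
    have "h3 * h3 = 0" using MpowD[OF 0, of 0 0 2] by (simp add: co numeral_2_eq_2)
    moreover have "h2 * h2 = 0" using MpowD[OF 0, of 0 2 0] by (simp add: co numeral_2_eq_2)
    moreover have "a = h1 * h1" using MpowD[OF 0, of 2 0 0] by (simp add: co numeral_2_eq_2)
    moreover have "a = h1 * h3 + h3 * h1" using MpowD[OF 0, of 1 0 1] by (simp add: co numeral_2_eq_2)
    ultimately have "h1 = 0" "h2 = 0" "h3 = 0" by auto
    with l h(2) show False by simp
  qed
qed

section \<open>From the initial forms to the normal form\<close>

text \<open>The outcome depends on whether \<open>\<Delta>\<close> has smaller order than
  \<open>b\<close>; if not, \<open>b\<close> has order \<open>e - 2\<close>. In both cases
  \<open>rho h3\<close> has exact order \<open>m + 1\<close> for the smaller order \<open>m\<close>,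
  so \<open>hilbert_high\<close> gives \<open>e = m + 2\<close>.\<close>

lemma normalisation_step:
  fixes f g :: "'a::field ps3"
  assumes f: "f - (xv + zv) * xv \<in> Mpow 3" and g: "g - (xv + zv) * yv \<in> Mpow 3"
    and mult: "has_multiplicity (ideal_gen {f, g}) e" and e: "5 \<le> e"
  obtains \<phi> f' g' where "K_algebra_automorphism \<phi>" "\<phi> ` ideal_gen {f, g} = ideal_gen {f', g'}"
      "normal_form_generators e f' g'"
    | \<phi> eps \<Delta> \<beta> where "K_algebra_automorphism \<phi>" "near_id \<phi>"
      "determinantal eps \<Delta> (\<beta> * zv ^ (e - 2)) (e - 2)" "is_unit_of K_z \<beta>"
      "\<phi> ` ideal_gen {f, g} =
        ideal_gen {determinantal.f eps \<Delta>, determinantal.g eps (\<beta> * zv ^ (e - 2))}"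
proof -
  obtain \<phi> F q where \<phi>: "K_algebra_automorphism \<phi>" "near_id \<phi>" and F: "F \<in> K_yz" "F \<in> Mpow 3"
    and q: "q \<in> K_yz" "q - yv * zv \<in> Mpow 3"
    and img: "\<phi> ` ideal_gen {f, g} = ideal_gen {xv\<^sup>2 + xv * zv + F, xv * yv + q}"
    using normalisation[OF f g] by metis
  obtain d \<alpha> r b where qd: "q = d * yv * zv + \<alpha> * yv ^ r + b" and r: "3 \<le> r"
    and d: "is_unit_of K_yz d" "ps_coeff d 0 0 0 = 1" and \<alpha>: "\<alpha> = 0 \<or> is_unit_of K_y \<alpha>" "\<alpha> \<in> K_yz"
    and b: "b \<in> K_z" "b \<in> Mpow 3"
    using split_yz[OF q] by metis
  define eps where "eps = normal_eps d \<alpha> r"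
  define \<Delta> where "\<Delta> = normal_Delta F d \<alpha> r"
  have eps: "eps \<in> Mpow 2" and \<Delta>: "\<Delta> \<in> Mpow 3"
    unfolding eps_def \<Delta>_def by (rule normal_form_facts[OF F(2) r d(2)])+
  have \<Delta>K: "\<Delta> \<in> K_yz"
    unfolding \<Delta>_def using F(1) d(1) \<alpha>(2) by (intro normal_Delta_K_yz) (simp_all add: is_unit_of_def)
  have bK: "b \<in> K_yz" using b(1) by (rule K_z_subset_K_yz)
  define J where "J = \<phi> ` ideal_gen {f, g}"
  obtain N where N: "hilbert_fun J t = e" if "t \<ge> N" for t
  proof -
    from mult obtain N where "hilbert_fun (ideal_gen {f, g}) t = e" if "t \<ge> N" for t
      by (auto simp: has_multiplicity_def)
    moreover have "hilbert_fun J t = hilbert_fun (ideal_gen {f, g}) t" for t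
      unfolding J_def by (rule automorphism_hilbert_fun[OF \<phi>(1) ideal_gen_ideal]) (simp add: img ideal_gen_ideal)
    ultimately show ?thesis using that by metis
  qed
  have detI: "determinantal eps \<Delta> b m" if "3 \<le> m" "\<Delta> \<in> Mpow m" "b \<in> Mpow m" for m
    using that eps by unfold_locales
  have det: "determinantal.f eps \<Delta> = xv\<^sup>2 + xv * zv + F" "determinantal.g eps b = xv * yv + q"
    using normal_form_determinantal[OF detI[unfolded eps_def \<Delta>_def, OF _ _ _], of 3] \<Delta> b(2) r
    by (simp_all add: eps_def \<Delta>_def qd add.assoc)
  have J: "J = ideal_gen {determinantal.f eps \<Delta>, determinantal.g eps b}"
    by (simp add: J_def img det)
  have mult_e: "e = m + 2" if D: "determinantal eps \<Delta> b m" and ex: "rho (determinantal.h3 eps \<Delta> b) \<notin> Mpow (m + 2)" for m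
    using determinantal.hilbert_high[OF D ex, of "max m N"] N[of "max m N"] J by simp
  \<comment> \<open>If both were zero, the ideal would be generated by \<open>L X\<close> and
    \<open>L y\<close>, with the unbounded Hilbert function \<open>t + 2\<close>.\<close>
  have nz: "\<Delta> \<noteq> 0 \<or> b \<noteq> 0"
  proof (rule ccontr)
    assume "\<not> (\<Delta> \<noteq> 0 \<or> b \<noteq> 0)"
    hence D: "determinantal eps \<Delta> b (N + e + 3)" by (intro detI) simp_all
    have "hilbert_fun J (N + e + 3) = N + e + 5" using determinantal.hilbert_low[OF D, of "N + e + 3"] J by simp
    with N[of "N + e + 3"] show False by simp
  qed
  show ?thesis
  proof (cases "\<exists>u. \<Delta> \<in> Mpow u \<and> \<Delta> \<notin> Mpow (Suc u) \<and> b \<in> Mpow (Suc u)")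
    case True
    then obtain u where u: "\<Delta> \<in> Mpow u" "\<Delta> \<notin> Mpow (Suc u)" "b \<in> Mpow (Suc u)" by blast
    have u3: "3 \<le> u" using u(2) \<Delta> Mpow_mono[of \<Delta> 3 "Suc u"] by (auto simp: not_less_eq_eq[symmetric])
    have D: "determinantal eps \<Delta> b u" using u u3 by (intro detI) (auto intro: Mpow_mono)
    have eu: "e = u + 2" by (rule mult_e[OF D determinantal.rho_h3_exact_low[OF D \<Delta>K u(2,3)]])
    have "\<exists>\<beta> s. b = \<beta> * zv ^ s \<and> e - 1 \<le> s \<and> (\<beta> = 0 \<or> is_unit_of K_z \<beta>)"
    proof (cases "b = 0")
      case True
      thus ?thesis by (intro exI[of _ 0] exI[of _ e]) simp
    next
      case False
      then obtain s where s: "b \<in> Mpow s" "b \<notin> Mpow (Suc s)" by (rule Mpow_exact_ex)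
      have "e - 1 \<le> s" using s(2) u(3) Mpow_mono[of b "Suc u" "Suc s"] eu by (cases "Suc u \<le> s") auto
      moreover obtain \<beta> where "is_unit_of K_z \<beta>" "b = \<beta> * zv ^ s" using K_z_unit_factor[OF b(1) s] by blast
      ultimately show ?thesis by blast
    qed
    then obtain \<beta> s where \<beta>: "b = \<beta> * zv ^ s" "e - 1 \<le> s" "\<beta> = 0 \<or> is_unit_of K_z \<beta>" by blast
    have "normal_form_generators e (xv\<^sup>2 + xv * zv + F) (xv * yv + q)"
      unfolding normal_form_generators_def normal_Delta_def[symmetric]
    proof (intro exI conjI)
      show "xv * yv + q = xv * yv + d * yv * zv + \<alpha> * yv ^ r + \<beta> * zv ^ s"
        by (simp add: qd \<beta>(1) add.assoc)
      show "3 \<le> ps_order F" using F(2) by (simp add: Mpow_iff_order numeral_eq_enat)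
      show "ps_order (normal_Delta F d \<alpha> r) = enat (e - 2)"
        using u eu by (simp add: ps_order_eq_iff \<Delta>_def)
      show "3 \<le> e - 1" using e by simp
    qed (use r F d \<alpha> \<beta> in auto)
    with that(1) \<phi>(1) img show ?thesis by blast
  next
    case False
    have "b \<noteq> 0"
    proof
      assume "b = 0"
      with nz obtain u where "\<Delta> \<in> Mpow u" "\<Delta> \<notin> Mpow (Suc u)" using Mpow_exact_ex by metis
      with False \<open>b = 0\<close> show False by auto
    qed
    then obtain s where s: "b \<in> Mpow s" "b \<notin> Mpow (Suc s)" by (rule Mpow_exact_ex)
    have s3: "3 \<le> s" using s(2) b(2) Mpow_mono[of b 3 "Suc s"] by (auto simp: not_less_eq_eq[symmetric])
    have "\<Delta> \<in> Mpow s"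
    proof (rule ccontr)
      assume n: "\<Delta> \<notin> Mpow s"
      hence "\<Delta> \<noteq> 0" by auto
      then obtain u where u: "\<Delta> \<in> Mpow u" "\<Delta> \<notin> Mpow (Suc u)" by (rule Mpow_exact_ex)
      have "Suc u \<le> s" using n u(1) Mpow_mono[of \<Delta> u s] by (cases "s \<le> u") auto
      with s(1) have "b \<in> Mpow (Suc u)" by (rule Mpow_mono)
      with u False show False by blast
    qed
    hence D: "determinantal eps \<Delta> b s" using s s3 by (intro detI) auto
    obtain \<beta> where \<beta>: "is_unit_of K_z \<beta>" "b = \<beta> * zv ^ s" using K_z_unit_factor[OF b(1) s] by blast
    have "ps_coeff b 0 0 s \<noteq> 0"
      using is_unit_of_coeff[OF \<beta>(1)] ps_coeff_zv_power_mult[of s \<beta> 0 0 s] by (simp add: \<beta>(2) mult.commute)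
    from mult_e[OF D determinantal.rho_h3_exact_high[OF D \<Delta>K bK this]] have "e = s + 2" .
    hence "s = e - 2" by simp
    with that(2)[OF \<phi> _ \<beta>(1), of eps \<Delta>] D \<beta>(2) J show ?thesis by (simp add: J_def)
  qed
qed

lemma has_multiplicity_automorphism:
  fixes I :: "'a::field ps3 set"
  assumes "K_algebra_automorphism \<phi>" "has_multiplicity (ideal_gen {f, g}) e"
    "\<phi> ` ideal_gen {f, g} = ideal_gen {f', g' :: 'a ps3}"
  shows "has_multiplicity (ideal_gen {f', g'}) e"
  using assms(2) automorphism_hilbert_fun[OF assms(1), of "ideal_gen {f, g}"]
  by (simp add: assms(3) ideal_gen_ideal has_multiplicity_def)

text \<open>If the first normalisation misses the condition on \<open>s\<close>, the line through \<open>(0 : 0 : 1)\<close> given by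
  \<open>y\<close> is replaced by one that meets \<open>x + z = 0\<close> in a zero \<open>(a : b : -a)\<close> of the form of degree
  \<open>e - 1\<close>; the shear below moves that zero to \<open>(1 : 0 : -1)\<close>.\<close>

lemma shear:
  fixes f g :: "'a::field ps3"
  assumes f: "f - (xv + zv) * xv \<in> Mpow 3" and g: "g - (xv + zv) * yv \<in> Mpow 3"
    and abc: "(\<exists>t. (a, b, c) = (1, t, - 1)) \<or> (a, b, c) = (0, 1, 0)"
  obtains \<chi> f' g' where "K_algebra_automorphism \<chi>" "\<chi> ` ideal_gen {f, g} = ideal_gen {f', g'}"
    "f' - (xv + zv) * xv \<in> Mpow 3" "g' - (xv + zv) * yv \<in> Mpow 3"
    "\<And>h. line_restr 1 0 (- 1) (\<chi> h) = line_restr a b c h"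
proof -
  have r: "lin p q r \<in> range (\<lambda>(a, b, c). lin a b c)" for p q r :: 'a by (auto simp: image_iff)
  have z: "lin p q r = 0 \<longleftrightarrow> p = 0 \<and> q = 0 \<and> r = 0" for p q r :: 'a
    using lin_eq_iff[of p q r 0 0 0] by simp
  have restr: "line_restr 1 0 (- 1) (\<chi> h) = line_restr a b c h"
    if "alg_endo \<chi>" "line_restr 1 0 (- 1) (\<chi> xv) = ps_const a * zv"
      "line_restr 1 0 (- 1) (\<chi> yv) = ps_const b * zv" "line_restr 1 0 (- 1) (\<chi> zv) = ps_const c * zv" for \<chi> h
    using alg_endo_unique[OF alg_endo_comp[OF alg_endo_line_restr that(1)] alg_endo_line_restr, of 1 0 "- 1" a b c h]
      that by (simp add: line_restr_xv line_restr_yv line_restr_zv)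
  note le = alg_endo_simps[OF alg_endo_line_restr] line_restr_xv line_restr_yv line_restr_zv
  from abc show ?thesis
  proof
    assume "\<exists>t. (a, b, c) = (1, t, - 1)"
    then obtain t where t: "a = 1" "b = t" "c = - 1" by auto
    \<comment> \<open>\<open>y - t x\<close> vanishes at \<open>(1 : t : -1)\<close> and becomes the
      new \<open>y\<close>. The second generator is corrected by \<open>t\<close> times the first to
      restore its initial form.\<close>
    have "lin_indep (lin 1 0 0) (lin (- t) 1 0) (lin 0 0 1)"
      unfolding lin_indep_def by (auto simp: r lin_scale lin_add z)
    then obtain \<chi> where \<chi>: "K_algebra_automorphism \<chi>" "\<chi> (lin 1 0 0) = xv" "\<chi> (lin (- t) 1 0) = yv" "\<chi> (lin 0 0 1) = zv"
      by (rule lin_indep_automorphism)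
    note e = automorphism_endo[OF \<chi>(1)]
    have v: "\<chi> xv = xv" "\<chi> zv = zv" using \<chi> by (simp_all add: lin_x lin_z)
    hence vy: "\<chi> yv = yv + ps_const t * xv"
      using \<chi>(3) by (simp add: lin_def alg_endo_simps[OF e] ps_const_minus algebra_simps)
    have "\<chi> (f - (xv + zv) * xv) \<in> Mpow 3" "\<chi> (g - (xv + zv) * yv - ps_const t * (f - (xv + zv) * xv)) \<in> Mpow 3"
      by (intro alg_endo_Mpow[OF e] Mpow_diff Mpow_multL[OF f] f g)+
    hence "\<chi> f - (xv + zv) * xv \<in> Mpow 3" "(\<chi> g - ps_const t * \<chi> f) - (xv + zv) * yv \<in> Mpow 3"
      by (simp_all add: alg_endo_simps[OF e] v vy algebra_simps)
    moreover have "\<chi> ` ideal_gen {f, g} = ideal_gen {\<chi> f, \<chi> g - ps_const t * \<chi> f}"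
      unfolding automorphism_ideal_gen[OF \<chi>(1)]
      by (rule ideal_gen_pair_eqI[of _ 1 _ 0 _ _ "ps_const t" 1 1 0 "- ps_const t" 1]) simp_all
    moreover have "line_restr 1 0 (- 1) (\<chi> h) = line_restr a b c h" for h
      by (intro restr e) (simp_all add: v vy le t)
    ultimately show ?thesis using that \<chi>(1) by blast
  next
    assume abc: "(a, b, c) = (0, 1, 0)"
    \<comment> \<open>Exchanging \<open>x\<close> and \<open>y\<close> also exchanges the
      generators; sending \<open>x - y + z\<close> to \<open>z\<close> keeps \<open>x + z\<close>
      fixed.\<close>
    have "lin_indep (lin 0 1 (0 :: 'a)) (lin 1 0 0) (lin 1 (- 1) 1)"
      unfolding lin_indep_def by (auto simp: r lin_scale lin_add z)
    then obtain \<chi> :: "'a ps3 \<Rightarrow> 'a ps3" where \<chi>: "K_algebra_automorphism \<chi>" "\<chi> (lin 0 1 0) = xv" "\<chi> (lin 1 0 0) = yv" "\<chi> (lin 1 (- 1) 1) = zv"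
      by (rule lin_indep_automorphism)
    note e = automorphism_endo[OF \<chi>(1)]
    have v: "\<chi> xv = yv" "\<chi> yv = xv" using \<chi> by (simp_all add: lin_x lin_y)
    hence vz: "\<chi> zv = zv - yv + xv"
      using \<chi>(4) by (simp add: lin_def alg_endo_simps[OF e] ps_const_minus algebra_simps)
    have "\<chi> (f - (xv + zv) * xv) \<in> Mpow 3" "\<chi> (g - (xv + zv) * yv) \<in> Mpow 3"
      by (intro alg_endo_Mpow[OF e] f g)+
    hence "\<chi> g - (xv + zv) * xv \<in> Mpow 3" "\<chi> f - (xv + zv) * yv \<in> Mpow 3"
      by (simp_all add: alg_endo_simps[OF e] v vz algebra_simps)
    moreover have "\<chi> ` ideal_gen {f, g} = ideal_gen {\<chi> g, \<chi> f}"
      unfolding automorphism_ideal_gen[OF \<chi>(1)] by (simp add: insert_commute)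
    moreover have "line_restr 1 0 (- 1) (\<chi> h) = line_restr a b c h" for h
      by (intro restr e) (use abc in \<open>simp_all add: v vz le ps_const_minus\<close>)
    ultimately show ?thesis using that \<chi>(1) by blast
  qed
qed

lemma normal_form_exists:
  fixes f g :: "'a::alg_closed_field ps3"
  assumes f: "f - (xv + zv) * xv \<in> Mpow 3" and g: "g - (xv + zv) * yv \<in> Mpow 3"
    and mult: "has_multiplicity (ideal_gen {f, g}) e" and e: "5 \<le> e"
  shows "\<exists>\<phi> f' g'. K_algebra_automorphism \<phi> \<and> normal_form_generators e f' g'
    \<and> \<phi> ` ideal_gen {f, g} = ideal_gen {f', g'}"
  using f g mult e
proof (cases rule: normalisation_step)
  case (1 \<phi> f' g')
  thus ?thesis by blast
next
  case (2 \<phi> eps \<Delta> \<beta>)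
  define m where "m = e - 2"
  interpret det: determinantal eps \<Delta> "\<beta> * zv ^ m" m using 2(3) by (simp add: m_def)
  have img: "\<phi> ` ideal_gen {f, g} = det.I" using 2(5) by (simp add: m_def)
  have "(\<exists>t. line_restr 1 t (- 1) det.h3 \<in> Mpow (Suc (Suc m))) \<or> line_restr 0 1 0 det.h3 \<in> Mpow (Suc (Suc m))"
    using det.h3_Mpow by (rule binary_form_zero) simp
  then obtain a b c where abc: "(\<exists>t. (a, b, c) = (1, t, - 1)) \<or> (a, b, c) = (0, 1, 0)"
    and zero: "line_restr a b c det.h3 \<in> Mpow (Suc (Suc m))" by blast
  note le = alg_endo_line_restr[of a b c]
  have ac: "a + c = 0" using abc by auto
  \<comment> \<open>At the point \<open>x + z\<close> vanishes, so \<open>f\<close> and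
    \<open>g\<close> restrict to order \<open>3\<close>; \<open>h3\<close> vanishes there in degree
    \<open>m + 1\<close> by choice. Hence so does every element of the ideal of order at least
    \<open>m + 1\<close>.\<close>
  have restr: "line_restr a b c k \<in> Mpow (Suc (Suc m))" if k: "k \<in> det.I" "k \<in> Mpow (Suc m)" for k
  proof -
    have "2 \<le> Suc m" using det.m by simp
    from det.standard_rep[OF k this] obtain A B C where AB: "A \<in> Mpow (Suc m - 2)" "B \<in> Mpow (Suc m - 2)"
      and keq: "k = A * det.f + B * det.g + C * det.h3" by auto
    have l: "line_restr a b c (xv + zv) = 0"
      by (simp add: alg_endo_simps[OF le] line_restr_xv line_restr_zv ac flip: distrib_right ps_const_add)
    have "line_restr a b c det.f' \<in> Mpow 3" "line_restr a b c det.g' \<in> Mpow 3"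
      by (intro alg_endo_Mpow[OF le] det.f' det.g')+
    hence fg: "line_restr a b c det.f \<in> Mpow 3" "line_restr a b c det.g \<in> Mpow 3"
      by (simp_all add: alg_endo_diff[OF le] alg_endo_mult[OF le, of "xv + zv"] l)
    show ?thesis
      unfolding keq alg_endo_add[OF le] alg_endo_mult[OF le]
      by (intro Mpow_add Mpow_multL[OF zero] Mpow_mult'[OF alg_endo_Mpow[OF le AB(1)] fg(1)]
          Mpow_mult'[OF alg_endo_Mpow[OF le AB(2)] fg(2)]) simp_all
  qed
  obtain \<chi> f2 g2 where \<chi>: "K_algebra_automorphism \<chi>" "\<chi> ` det.I = ideal_gen {f2, g2}"
    "f2 - (xv + zv) * xv \<in> Mpow 3" "g2 - (xv + zv) * yv \<in> Mpow 3"
    "\<And>h. line_restr 1 0 (- 1) (\<chi> h) = line_restr a b c h"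
    using shear[OF det.f' det.g' abc] by metis
  have "has_multiplicity det.I e" by (rule has_multiplicity_automorphism[OF 2(1) mult img])
  hence mult2: "has_multiplicity (ideal_gen {f2, g2}) e"
    by (rule has_multiplicity_automorphism[OF \<chi>(1) _ \<chi>(2)])
  show ?thesis
    using \<chi>(3,4) mult2 e
  proof (cases rule: normalisation_step)
    case (1 \<phi>' f' g')
    have "(\<phi>' \<circ> \<chi> \<circ> \<phi>) ` ideal_gen {f, g} = ideal_gen {f', g'}"
      unfolding image_comp[symmetric] img \<chi>(2) 1(2) ..
    moreover have "K_algebra_automorphism (\<phi>' \<circ> \<chi> \<circ> \<phi>)"
      by (intro automorphism_comp 1 2 \<chi>)
    ultimately show ?thesis using 1 by blast
  next
    case second: (2 \<phi>' eps' \<Delta>' \<beta>')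
    interpret det': determinantal eps' \<Delta>' "\<beta>' * zv ^ m" m using second(3) by (simp add: m_def)
    \<comment> \<open>The new \<open>h3\<close> comes from an element \<open>k\<close> of the first
      ideal, to which \<open>restr\<close> applies; \<open>\<phi>'\<close> keeps its leading
      component.\<close>
    have "det'.h3 \<in> \<phi>' ` ideal_gen {f2, g2}" using second(5) det'.h3_in by (simp add: m_def)
    then obtain k where k: "k \<in> det.I" "det'.h3 = \<phi>' (\<chi> k)"
      unfolding \<chi>(2)[symmetric] by blast
    have kM: "\<chi> k \<in> Mpow (Suc m)" "k \<in> Mpow (Suc m)"
      using det'.h3_Mpow automorphism_Mpow_iff[OF second(1)] automorphism_Mpow_iff[OF \<chi>(1)] by (auto simp: k(2))
    note le' = alg_endo_line_restr[of 1 0 "- 1"]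
    let ?r = "line_restr 1 0 (- 1)"
    have "?r (\<chi> k) \<in> Mpow (Suc (Suc m))" using restr[OF k(1) kM(2)] by (simp add: \<chi>(5))
    moreover have "?r (\<phi>' (\<chi> k) - \<chi> k) \<in> Mpow (Suc (Suc m))"
      by (intro alg_endo_Mpow[OF le'] near_idD[OF second(2)] kM)
    ultimately have "?r det'.h3 \<in> Mpow (Suc (Suc m))"
      using Mpow_add by (fastforce simp: k(2) alg_endo_diff[OF le'])
    \<comment> \<open>At \<open>(1 : 0 : -1)\<close> the term \<open>y \<Delta>\<close> disappears.
      The order of what remains would make the constant term of the unit \<open>\<beta>'\<close>
      vanish.\<close>
    moreover have "?r det'.h3 = - (?r \<beta>' * (- zv) ^ m * (zv + ?r eps'))"
      by (simp add: det'.h3_def det'.X_def alg_endo_simps[OF le'] line_restr_xv line_restr_yv line_restr_zv ps_const_minus)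
    ultimately have prod: "?r \<beta>' * (- zv) ^ m * (zv + ?r eps') \<in> Mpow (Suc (m + 1))" by simp
    have eps': "?r eps' \<in> Mpow 2" by (rule alg_endo_Mpow[OF le' det'.eps])
    have z1: "zv + ?r eps' \<in> Mpow 1" by (intro Mpow_add zv_Mpow Mpow_mono[OF eps']) simp
    have "zv + ?r eps' \<notin> Mpow (Suc 1)"
    proof
      assume "zv + ?r eps' \<in> Mpow (Suc 1)"
      from MpowD[OF this, of 0 0 1] MpowD[OF eps', of 0 0 1] show False by (simp add: ps_coeff_zv)
    qed
    moreover have \<beta>z: "?r \<beta>' * (- zv) ^ m \<in> Mpow m"
      by (intro Mpow_multL Mpow_power1 Mpow_minus zv_Mpow)
    ultimately have 0: "?r \<beta>' * (- zv) ^ m \<in> Mpow (Suc (0 + m))"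
      using Mpow_mult_exact[OF prod \<beta>z z1] by simp
    have "(- zv) ^ m \<notin> (Mpow (Suc m) :: 'a ps3 set)"
    proof
      assume "(- zv) ^ m \<in> (Mpow (Suc m) :: 'a ps3 set)"
      from Mpow_multL[OF this, of "(- 1) ^ m"] have "zv ^ m \<in> (Mpow (Suc m) :: 'a ps3 set)"
        by (simp flip: power_mult_distrib)
      from MpowD[OF this, of 0 0 m] show False
        using ps_coeff_monom[of 0 0 m 0 0 m, where ?'a = 'a] by simp
    qed
    with Mpow_mult_exact[OF 0 Mpow_UNIV Mpow_power1[OF Mpow_minus[OF zv_Mpow]]]
    have "?r \<beta>' \<in> Mpow (Suc 0)" by blast
    moreover obtain w where "\<beta>' * w = 1" using second(4) by (auto simp: is_unit_of_def)
    hence "?r \<beta>' * ?r w = 1" by (simp add: alg_endo_1[OF le'] flip: alg_endo_mult[OF le'])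
    hence "ps_coeff (?r \<beta>') 0 0 0 \<noteq> 0" using ps_unit_iff by blast
    ultimately show ?thesis by (simp add: Mpow_1_iff)
  qed
qed

theorem theorem4p2:
  fixes I :: "'a::{alg_closed_field, field_char_0} ps3 set" and e :: nat
  assumes "type22 I" and "has_multiplicity I e" and "5 \<le> e"
  shows "(hilbert_fun I = H e \<and> \<not> contains_square_of_linear_form (initial_ideal I))
    \<longleftrightarrow> (\<exists>\<phi> f g. K_algebra_automorphism \<phi> \<and> normal_form_generators e f g \<and>
           \<phi> ` I = ideal_gen {f, g})"
proof -
  obtain f g where I: "I = ideal_gen {f, g}" and M: "f \<in> Mpow 2" "g \<in> Mpow 2" and ind: "quadric_indep f g"
    using type22_generators[OF assms(1)] by metis
  have idI: "is_ideal I" unfolding I by (rule ideal_gen_ideal)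
  show ?thesis
  proof
    assume L: "hilbert_fun I = H e \<and> \<not> contains_square_of_linear_form (initial_ideal I)"
    \<comment> \<open>For \<open>e = 5\<close> this is the final value \<open>e\<close>, for
      \<open>e \<ge> 6\<close> it is \<open>t + 2\<close>.\<close>
    hence "hilbert_fun (ideal_gen {f, g}) 3 = 5" using assms(3) by (simp add: I H_def)
    then obtain \<phi> f1 g1 where \<phi>: "K_algebra_automorphism \<phi>" "\<phi> ` ideal_gen {f, g} = ideal_gen {f1, g1}"
      and fg1: "f1 - (xv + zv) * xv \<in> Mpow 3" "g1 - (xv + zv) * yv \<in> Mpow 3"
      using initial_forms_normalised[OF M ind] L unfolding I by metis
    have "has_multiplicity (ideal_gen {f1, g1}) e"
      by (rule has_multiplicity_automorphism[OF \<phi>(1) _ \<phi>(2)]) (use assms(2) I in simp)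
    from normal_form_exists[OF fg1 this assms(3)] obtain \<psi> f2 g2 where
      \<psi>: "K_algebra_automorphism \<psi>" "normal_form_generators e f2 g2" "\<psi> ` ideal_gen {f1, g1} = ideal_gen {f2, g2}"
      by blast
    have "(\<psi> \<circ> \<phi>) ` I = ideal_gen {f2, g2}"
      unfolding image_comp[symmetric] I \<phi>(2) \<psi>(3) ..
    with \<psi>(2) automorphism_comp[OF \<psi>(1) \<phi>(1)]
    show "\<exists>\<phi> f g. K_algebra_automorphism \<phi> \<and> normal_form_generators e f g \<and> \<phi> ` I = ideal_gen {f, g}"
      by blast
  next
    assume "\<exists>\<phi> f g. K_algebra_automorphism \<phi> \<and> normal_form_generators e f g \<and> \<phi> ` I = ideal_gen {f, g}"
    then obtain \<phi> f' g' where \<phi>: "K_algebra_automorphism \<phi>" and nf: "normal_form_generators e f' g'"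
      and img: "\<phi> ` I = ideal_gen {f', g'}" by blast
    have idJ: "is_ideal (\<phi> ` I)" unfolding img by (rule ideal_gen_ideal)
    note hilb = hilbert_fun_normal_form[OF nf assms(3), folded img]
    have "hilbert_fun I = H e"
      using hilb(1) automorphism_hilbert_fun[OF \<phi> idI idJ] by (auto simp: fun_eq_iff)
    moreover have "\<not> contains_square_of_linear_form (initial_ideal I)"
    proof
      assume "contains_square_of_linear_form (initial_ideal I)"
      then obtain h k where "h \<in> Mpow 1" "h \<notin> Mpow 2" "k \<in> I" "k - h\<^sup>2 \<in> Mpow 3"
        unfolding contains_square_iff[OF idI] by blast
      from automorphism_square[OF \<phi> this] hilb(2) show False
        unfolding contains_square_iff[OF idJ] by blast
    qed
    ultimately show "hilbert_fun I = H e \<and> \<not> contains_square_of_linear_form (initial_ideal I)" ..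
  qed
qed

end
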